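(* Let $X$ be a hereditarily decomposable continuum with the property of Kelley. Then $\mathcal{NB}(\mathcal{F}_1(X))$ is a continuum if and only if $X$ is a simple closed curve.
   Context: A continuum is a nonempty compact connected metric space; a subcontinuum of $X$ is a continuum contained in $X$. A continuum is decomposable if it is the union of two of its proper subcontinua; it is hereditarily decomposable if every nondegenerate subcontinuum of it is decomposable. A simple closed curve is a continuum homeomorphic to $S^1=\{z\in\mathbb{C}:|z|=1\}$. For a continuum $X$, $2^X$ is the set of nonempty closed subsets of $X$ with the Hausdorff metric (equivalently, the Vietoris topology), and $\mathcal{C}(X)=\{A\in 2^X: A\text{ is connected}\}$. $X$ has the property of Kelley if for every sequence $(x_n)_{n\in\mathbb{N}}$ in $X$ converging to some $x\in X$ and every $A\in\mathcal{C}(X)$ with $x\in A$, there are $A_n\in\mathcal{C}(X)$ with $x_n\in A_n$ for each $n$ and $\lim_{n\to\infty}A_n=A$ in $\mathcal{C}(X)$. For $A\in 2^X$ and $x\in X\setminus A$, $\kappa_{X\setminus A}(x)=\bigcup\{L\in\mathcal{C}(X): x\in L\subseteq X\setminus A\}$. The hyperspace of nonblockers is $\mathcal{NB}(\mathcal{F}_1(X))=\{A\in 2^X: A\neq X\text{ and }\kappa_{X\setminus A}(x)\text{ is dense in }X\text{ for every }x\in X\setminus A\}$, with the subspace topology from $2^X$. *)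

theory Defs
  imports "HOL-Analysis.Analysis"
begin

definition continuum :: "'a topology \<Rightarrow> bool" where
  "continuum T \<longleftrightarrow>
     topspace T \<noteq> {} \<and> compact_space T \<and> connected_space T \<and> metrizable_space T"

text \<open>A metric space is represented as a subset \<open>X\<close> of a type of class \<open>metric_space\<close>, carrying
  the restricted metric.\<close>

definition subcontinuum :: "'a::metric_space set \<Rightarrow> 'a set \<Rightarrow> bool" where
  "subcontinuum K X \<longleftrightarrow> K \<subseteq> X \<and> continuum (top_of_set K)"

definition decomposable :: "'a::metric_space set \<Rightarrow> bool" where
  "decomposable X \<longleftrightarrow>
     (\<exists>A B. subcontinuum A X \<and> A \<noteq> X \<and> subcontinuum B X \<and> B \<noteq> X \<and> X = A \<union> B)"

definition hereditarily_decomposable :: "'a::metric_space set \<Rightarrow> bool" where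
  "hereditarily_decomposable X \<longleftrightarrow>
     (\<forall>K. subcontinuum K X \<and> (\<exists>x\<in>K. \<exists>y\<in>K. x \<noteq> y) \<longrightarrow> decomposable K)"

definition simple_closed_curve :: "'a::metric_space set \<Rightarrow> bool" where
  "simple_closed_curve X \<longleftrightarrow>
     continuum (top_of_set X) \<and> X homeomorphic {z::complex. norm z = 1}"

definition hyperspace :: "'a::metric_space set \<Rightarrow> 'a set set" where
  "hyperspace X = {A. A \<noteq> {} \<and> closedin (top_of_set X) A}"

definition continuum_hyperspace :: "'a::metric_space set \<Rightarrow> 'a set set" where
  "continuum_hyperspace X = {A \<in> hyperspace X. connected A}"

text \<open>The Hausdorff distance. The default value \<open>0\<close> makes the function nonnegative on all
  pairs of sets, as the locale \<open>Metric_space\<close> demands; it is never used for nonempty subsets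
  of a compact set.\<close>

definition hausdorff_dist :: "'a::metric_space set \<Rightarrow> 'a set \<Rightarrow> real" where
  "hausdorff_dist A B =
     (if A \<noteq> {} \<and> B \<noteq> {} \<and> bounded A \<and> bounded B
      then max (SUP a\<in>A. infdist a B) (SUP b\<in>B. infdist b A) else 0)"

definition hyperspace_topology :: "'a::metric_space set \<Rightarrow> 'a set topology" where
  "hyperspace_topology X = Metric_space.mtopology (hyperspace X) hausdorff_dist"

definition property_of_Kelley :: "'a::metric_space set \<Rightarrow> bool" where
  "property_of_Kelley X \<longleftrightarrow>
     (\<forall>x p A. (\<forall>n::nat. x n \<in> X) \<and> p \<in> X \<and> x \<longlonglongrightarrow> p \<and>
              A \<in> continuum_hyperspace X \<and> p \<in> A \<longrightarrow>
        (\<exists>B. (\<forall>n. B n \<in> continuum_hyperspace X \<and> x n \<in> B n) \<and>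
             limitin (subtopology (hyperspace_topology X) (continuum_hyperspace X))
               B A sequentially))"

text \<open>\<open>kappa X A x\<close> stands for \<open>\<kappa>\<^bsub>X - A\<^esub>(x)\<close>.\<close>

definition kappa :: "'a::metric_space set \<Rightarrow> 'a set \<Rightarrow> 'a \<Rightarrow> 'a set" where
  "kappa X A x = \<Union>{L \<in> continuum_hyperspace X. x \<in> L \<and> L \<subseteq> X - A}"

definition nonblockers :: "'a::metric_space set \<Rightarrow> 'a set set" where
  "nonblockers X =
     {A \<in> hyperspace X. A \<noteq> X \<and> (\<forall>x\<in>X - A. top_of_set X closure_of kappa X A x = X)}"

text \<open>\<open>hausdorff_dist\<close> is a metric on the hyperspace of a compact set, so
  \<open>hyperspace_topology\<close> is its metric topology.\<close>

lemma bdd_above_infdist_image: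
  assumes "bounded A" "B \<noteq> {}"
  shows "bdd_above ((\<lambda>a. infdist a B) ` A)"
proof -
  obtain b where b: "b \<in> B" using assms by blast
  obtain e where e: "\<And>a. a \<in> A \<Longrightarrow> dist b a \<le> e"
    using assms(1) bounded_any_center by blast
  have "infdist a B \<le> e" if "a \<in> A" for a
    using infdist_le2[OF b] e[OF that] by (simp add: dist_commute)
  then show ?thesis by (rule bdd_aboveI2)
qed

lemma infdist_triangle_set:
  assumes "B \<noteq> {}" "bounded B" "C \<noteq> {}"
  shows "infdist a C \<le> infdist a B + (SUP b\<in>B. infdist b C)"
proof -
  let ?s = "SUP b\<in>B. infdist b C"
  have "infdist a C - ?s \<le> dist a b" if "b \<in> B" for b
    using infdist_triangle[of a C b]
      cSUP_upper[OF that bdd_above_infdist_image[OF assms(2,3)]] by linarith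
  then have "infdist a C - ?s \<le> infdist a B"
    unfolding infdist_notempty[OF assms(1)] by (intro cINF_greatest assms) auto
  then show ?thesis by linarith
qed

lemma Metric_space_hausdorff_dist:
  fixes X :: "'a::metric_space set"
  assumes "compact X"
  shows "Metric_space (hyperspace X) hausdorff_dist"
proof
  have H: "A \<noteq> {} \<and> bounded A \<and> closed A" if "A \<in> hyperspace X" for A
    using that assms closedin_compact[OF assms]
    by (auto simp: hyperspace_def compact_imp_bounded compact_imp_closed)
  show "0 \<le> hausdorff_dist A B" for A B :: "'a set"
  proof (cases "A \<noteq> {} \<and> B \<noteq> {} \<and> bounded A \<and> bounded B")
    case True
    then obtain a where "a \<in> A" by blast
    then have "0 \<le> (SUP a\<in>A. infdist a B)"
      using cSUP_upper2[OF bdd_above_infdist_image] True infdist_nonneg by metis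
    then show ?thesis by (simp add: hausdorff_dist_def le_max_iff_disj)
  qed (auto simp: hausdorff_dist_def)
  show "hausdorff_dist A B = hausdorff_dist B A" for A B :: "'a set"
    by (auto simp: hausdorff_dist_def max.commute)
  have U: "infdist a B \<le> hausdorff_dist A B" "infdist b A \<le> hausdorff_dist A B"
    if "A \<in> hyperspace X" "B \<in> hyperspace X" "a \<in> A" "b \<in> B" for A B a b
    using H[OF that(1)] H[OF that(2)] that
      cSUP_upper[OF that(3) bdd_above_infdist_image[of A B]]
      cSUP_upper[OF that(4) bdd_above_infdist_image[of B A]]
    by (auto simp: hausdorff_dist_def)
  show "hausdorff_dist A B = 0 \<longleftrightarrow> A = B"
    if "A \<in> hyperspace X" "B \<in> hyperspace X" for A B
  proof
    assume 0: "hausdorff_dist A B = 0"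
    have "infdist a B = 0" "infdist b A = 0" if "a \<in> A" "b \<in> B" for a b
      using U[OF \<open>A \<in> _\<close> \<open>B \<in> _\<close> that] 0 infdist_nonneg[of a B] infdist_nonneg[of b A] by linarith+
    then show "A = B"
      using H[OF that(1)] H[OF that(2)] in_closed_iff_infdist_zero by blast
  next
    assume "A = B"
    then show "hausdorff_dist A B = 0" using H[OF that(1)] by (simp add: hausdorff_dist_def)
  qed
  show "hausdorff_dist A C \<le> hausdorff_dist A B + hausdorff_dist B C"
    if h: "A \<in> hyperspace X" "B \<in> hyperspace X" "C \<in> hyperspace X" for A B C
  proof -
    note HH = H[OF h(1)] H[OF h(2)] H[OF h(3)]
    obtain a0 b0 c0 where z: "a0 \<in> A" "b0 \<in> B" "c0 \<in> C" using HH by blast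
    have s: "(SUP b\<in>B. infdist b C) \<le> hausdorff_dist B C"
      "(SUP b\<in>B. infdist b A) \<le> hausdorff_dist A B"
      using HH by (auto simp: hausdorff_dist_def)
    have "infdist a C \<le> hausdorff_dist A B + hausdorff_dist B C" if "a \<in> A" for a
      using infdist_triangle_set[of B C a] HH U(1)[OF h(1,2) that z(2)] s by linarith
    moreover have "infdist c A \<le> hausdorff_dist A B + hausdorff_dist B C" if "c \<in> C" for c
      using infdist_triangle_set[of B A c] HH U(2)[OF h(2,3) z(2) that] s by linarith
    ultimately have "(SUP a\<in>A. infdist a C) \<le> hausdorff_dist A B + hausdorff_dist B C"
      "(SUP c\<in>C. infdist c A) \<le> hausdorff_dist A B + hausdorff_dist B C"
      using HH by (auto intro!: cSUP_least)
    moreover have "hausdorff_dist A C = max (SUP a\<in>A. infdist a C) (SUP c\<in>C. infdist c A)"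
      using HH by (simp add: hausdorff_dist_def)
    ultimately show ?thesis by simp
  qed
qed

end

theory Submission
  imports Defs
begin

text \<open>The property of Kelley makes the set of points that can be joined, inside \<open>X - F\<close>, to a
  subcontinuum with interior open in \<open>X\<close>; if this set is dense, its complement is a nonblocker.
  When the nonblockers form a continuum, this and the minimality of suitable complements show that
  the minimal nonblockers are pairwise disjoint continua, which cover \<open>X\<close> and vary continuously.
  A nondegenerate member would contradict hereditary decomposability, so all singletons are nonblockers.
  Consider next the largest \<open>k\<close> for which the complement of any \<open>k\<close> points is continuumwise
  connected.  Comparing the pieces into which different sets of \<open>k + 1\<close> points cut \<open>X\<close> gives
  \<open>k = 1\<close>: no point cuts \<open>X\<close>, but every pair \<open>a, b\<close> does.  Each side of \<open>{a, b}\<close> is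
  linearly ordered by the cuts and hence an arc from \<open>a\<close> to \<open>b\<close>.
  For the converse, the nonblockers of a circle are its singletons.\<close>

section \<open>Compact metric spaces\<close>

text \<open>The difficulty is that the sets \<open>kappa X A x\<close> are in general not open,
  while connectedness and category arguments need open sets. The remedy is to anchor them at a
  continuum \<open>P\<close> with interior in \<open>X\<close>: continua supplied by the property of
  Kelley converge to a continuum containing \<open>P\<close>, so they must hit that interior and
  merge with it. Decomposability supplies the first such \<open>P\<close> different from
  \<open>X\<close>. The complement of a nonblocker is dense, so when the family is compact a limit
  of nonblockers never contains a nonempty open subset of \<open>X\<close>. This observation
  produces the further continua with interior, and it also bounds the number \<open>k\<close>, since
  otherwise finite nets of \<open>X\<close> would be nonblockers converging to \<open>X\<close>.
  Connectedness of the family serves a single purpose: it makes the union of the minimal nonblockers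
  connected, hence itself a continuum that can be used to reach points. Minimality is handled
  through terminality: a continuum that meets a minimal nonblocker and is not inside it contains it.
  In this form it passes to limits by the property of Kelley.\<close>

lemma dist_pos_compact_closed:
  fixes S T :: "'a::metric_space set"
  assumes "compact S" "closed T" "S \<inter> T = {}"
  shows "\<exists>d>0. \<forall>x\<in>S. \<forall>y\<in>T. d \<le> dist x y"
proof (cases "S = {} \<or> T = {}")
  case True
  then show ?thesis by (auto intro: exI[of _ 1])
next
  case False
  then obtain s where s: "s \<in> S" "\<And>x. x \<in> S \<Longrightarrow> infdist s T \<le> infdist x T"
    using continuous_attains_inf[OF assms(1), of "\<lambda>x. infdist x T"]
    by (auto simp: continuous_on_infdist)
  have "infdist s T > 0"
    using infdist_pos_not_in_closed[OF assms(2), of s] s assms(3) False by auto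
  then show ?thesis
    using s(2) infdist_le order_trans by blast
qed

text \<open>The cut-wire fence theorem for compact Hausdorff spaces. Its two relatively open pieces
  are complements of each other in the compact set \<open>Z\<close>, hence closed in the ambient
  type.\<close>

lemma cut_wire_metric:
  fixes Z :: "'a::metric_space set"
  assumes "compact Z" "closed S" "closed T" "S \<subseteq> Z" "T \<subseteq> Z"
    and "\<forall>C. connected C \<and> C \<subseteq> Z \<longrightarrow> C \<inter> S = {} \<or> C \<inter> T = {}"
  shows "\<exists>E F. closed E \<and> closed F \<and> E \<inter> F = {} \<and> E \<union> F = Z \<and> S \<subseteq> E \<and> T \<subseteq> F"
proof -
  have "separated_between (top_of_set Z) S T"
  proof (rule cut_wire_fence_theorem)
    show "compact_space (top_of_set Z)"
      using assms(1) by (simp add: compact_space_subtopology)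
    show "Hausdorff_space (top_of_set Z)"
      by (simp add: Hausdorff_space_subtopology)
    show "closedin (top_of_set Z) S" "closedin (top_of_set Z) T"
      using assms by (auto simp: closed_subset)
    show "disjnt C S \<or> disjnt C T" if "connectedin (top_of_set Z) C" for C
      using assms(6) that by (auto simp: connectedin_subtopology disjnt_def)
  qed
  then obtain U V where "openin (top_of_set Z) U" "openin (top_of_set Z) V" "U \<union> V = Z"
    "disjnt U V" "S \<subseteq> U" "T \<subseteq> V"
    by (auto simp: separated_between_def)
  moreover from this have "Z - U = V" "Z - V = U" by (auto simp: disjnt_def)
  with calculation have "closedin (top_of_set Z) U" "closedin (top_of_set Z) V"
    by (simp_all add: closedin_def) (use openin_imp_subset in blast)+
  ultimately show ?thesis
    using closedin_closed_trans[OF _ compact_imp_closed[OF assms(1)]]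
    unfolding disjnt_def by blast
qed

text \<open>If no connected subset of the sublevel set \<open>Z\<close> led from \<open>v\<close> to
  the level \<open>c\<close>, the cut-wire theorem would split \<open>Z\<close> into a closed
  \<open>E\<close> containing \<open>v\<close> and a closed \<open>F\<close> containing the level
  set. Adding the superlevel set to \<open>F\<close> would then disconnect \<open>L\<close>.\<close>

lemma boundary_bumping:
  fixes L :: "'a::metric_space set" and g :: "'a \<Rightarrow> real"
  assumes "compact L" "connected L" "continuous_on L g" "v \<in> L" "u \<in> L" "g v < c" "c \<le> g u"
  shows "\<exists>J w. compact J \<and> connected J \<and> J \<subseteq> L \<and> v \<in> J \<and> (\<forall>y\<in>J. g y \<le> c) \<and> w \<in> J \<and> g w = c"
proof -
  have cl: "closed L" using assms(1) compact_imp_closed by blast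
  define Z where "Z = {y\<in>L. g y \<le> c}"
  define T where "T = {y\<in>L. g y = c}"
  define G where "G = {y\<in>L. c \<le> g y}"
  have clZ: "closed Z" unfolding Z_def
    using continuous_on_closed_Collect_le[OF assms(3) continuous_on_const cl] .
  have clG: "closed G" unfolding G_def
    using continuous_on_closed_Collect_le[OF continuous_on_const assms(3) cl] .
  have TG: "T = Z \<inter> G" unfolding T_def Z_def G_def by auto
  have clT: "closed T" using clZ clG TG by auto
  have cZ: "compact Z" using clZ assms(1) unfolding Z_def
    by (metis (no_types, lifting) closed_Int_compact Int_absorb2 mem_Collect_eq subsetI)
  have "\<exists>C. connected C \<and> C \<subseteq> Z \<and> v \<in> C \<and> C \<inter> T \<noteq> {}"
  proof (rule ccontr)
    assume "\<not> ?thesis"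
    then have dis: "\<forall>C. connected C \<and> C \<subseteq> Z \<longrightarrow> C \<inter> {v} = {} \<or> C \<inter> T = {}" by auto
    have sub: "{v} \<subseteq> Z" "T \<subseteq> Z" using assms TG Z_def by auto
    obtain E F where EF: "closed E" "closed F" "E \<inter> F = {}" "E \<union> F = Z" "{v} \<subseteq> E" "T \<subseteq> F"
      using cut_wire_metric[OF cZ closed_singleton clT sub dis] by (elim exE conjE)
    have "L = Z \<union> G" unfolding Z_def G_def by auto
    then have "L = E \<union> (F \<union> G)" unfolding EF(4)[symmetric] by (simp only: Un_assoc)
    moreover have "E \<inter> (F \<union> G) = {}" using EF TG by blast
    moreover have "u \<in> F \<union> G" using assms G_def by auto
    ultimately show False
      using connected_as_closed_union[OF assms(2), of E "F \<union> G"] EF clG by blast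
  qed
  then obtain C where C: "connected C" "C \<subseteq> Z" "v \<in> C" "C \<inter> T \<noteq> {}" by blast
  have "closure C \<subseteq> Z" using C clZ closure_minimal by blast
  moreover have "compact (closure C)"
    using compact_Int_closed[OF cZ, of "closure C"] calculation by (simp add: Int_absorb1)
  moreover obtain w where "w \<in> C" "w \<in> T" using C by blast
  moreover have "v \<in> closure C" "w \<in> closure C"
    using C(3) \<open>w \<in> C\<close> closure_subset[of C] by auto
  moreover have "connected (closure C)" using C(1) by (rule connected_imp_connected_closure)
  moreover have "g w = c" using \<open>w \<in> T\<close> by (simp add: T_def)
  ultimately show ?thesis
    unfolding Z_def by (intro exI[of _ "closure C"] exI[of _ w]) auto
qed

lemma boundary_bumping_ball:
  fixes L :: "'a::metric_space set"
  assumes "compact L" "connected L" "v \<in> L" "u \<in> L" "dist z v < c" "c \<le> dist z u"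
  shows "\<exists>J w. compact J \<and> connected J \<and> J \<subseteq> L \<and> v \<in> J \<and> J \<subseteq> cball z c \<and> w \<in> J \<and> dist z w = c"
proof -
  have "continuous_on L (dist z)" by (intro continuous_intros)
  from boundary_bumping[OF assms(1,2) this assms(3,4,5,6)]
  obtain J w where "compact J" "connected J" "J \<subseteq> L" "v \<in> J" "\<forall>y\<in>J. dist z y \<le> c" "w \<in> J" "dist z w = c"
    by (elim exE conjE)
  moreover from this have "J \<subseteq> cball z c" by auto
  ultimately show ?thesis by (intro exI conjI)
qed

text \<open>Boundary bumping for minus the distance to \<open>D\<close>. The continuum stops short
  of \<open>D\<close>, so it can serve as a witness inside the complement of \<open>D\<close>, yet
  it comes as close to \<open>D\<close> as desired.\<close>

lemma boundary_bumping_near: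
  fixes L :: "'a::metric_space set"
  assumes "compact L" "connected L" "v \<in> L" "closed D" "L \<inter> D \<noteq> {}" "v \<notin> D" "e > 0"
  shows "\<exists>J w. compact J \<and> connected J \<and> J \<subseteq> L \<and> v \<in> J \<and> J \<inter> D = {} \<and> w \<in> J \<and> infdist w D < e"
proof -
  obtain u where u: "u \<in> L" "u \<in> D" using assms by blast
  have pos: "infdist v D > 0"
    using infdist_pos_not_in_closed[OF assms(4), of v] assms u by auto
  \<comment> \<open>The level is below \<open>e\<close>, so that \<open>J\<close> ends close to
    \<open>D\<close>, and below the distance of \<open>v\<close> from \<open>D\<close>, so that
    \<open>v\<close> starts on the correct side of it.\<close>
  define c where "c = min (e/2) (infdist v D / 2)"
  have c: "c > 0" "c < e" "c < infdist v D" using pos assms(7) by (auto simp: c_def)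
  have "continuous_on L (\<lambda>y. - infdist y D)" by (intro continuous_intros)
  note cont = this
  have "- infdist v D < - c" "- c \<le> - infdist u D" using c u by auto
  from boundary_bumping[OF assms(1,2) cont assms(3) u(1) this]
  obtain J w where J: "compact J" "connected J" "J \<subseteq> L" "v \<in> J" "\<forall>y\<in>J. - infdist y D \<le> - c"
    "w \<in> J" "- infdist w D = - c"
    by (elim exE conjE)
  have "J \<inter> D = {}"
  proof (rule ccontr)
    assume "J \<inter> D \<noteq> {}"
    then obtain y where "y \<in> J" "y \<in> D" by blast
    then show False using J(5) c by fastforce
  qed
  moreover have "infdist w D < e" using J c by auto
  ultimately show ?thesis using J(1-4,6) by (intro exI conjI)
qed

definition reach_in :: "'a::metric_space set \<Rightarrow> 'a set \<Rightarrow> 'a \<Rightarrow> 'a set" where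
  "reach_in L D v = \<Union>{J. compact J \<and> connected J \<and> v \<in> J \<and> J \<subseteq> L - D}"

text \<open>If the closure missed \<open>D\<close>, it would stay at a positive distance
  \<open>d\<close> from it, whereas continua from \<open>v\<close> inside \<open>L - D\<close> come
  within \<open>d\<close> of \<open>D\<close>.\<close>

lemma bumping_closure:
  fixes L :: "'a::metric_space set"
  assumes "compact L" "connected L" "v \<in> L" "closed D" "L \<inter> D \<noteq> {}" "v \<notin> D"
  defines "M \<equiv> closure (reach_in L D v)"
  shows "compact M" "connected M" "M \<subseteq> L" "v \<in> M" "M \<inter> D \<noteq> {}"
proof -
  have v: "v \<in> reach_in L D v"
    unfolding reach_in_def using assms(3,6) by (intro UnionI[of "{v}"]) auto
  then show "v \<in> M" unfolding M_def using closure_subset by blast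
  have "connected (reach_in L D v)"
    unfolding reach_in_def by (rule connected_Union) auto
  then show "connected M" unfolding M_def by (rule connected_imp_connected_closure)
  have "reach_in L D v \<subseteq> L" unfolding reach_in_def by auto
  then show sub: "M \<subseteq> L" unfolding M_def using closure_minimal compact_imp_closed assms(1) by blast
  then show cM: "compact M"
    using compact_Int_closed[OF assms(1), of M] unfolding M_def by (simp add: Int_absorb1)
  show "M \<inter> D \<noteq> {}"
  proof
    assume "M \<inter> D = {}"
    then obtain d where d: "d > 0" "\<forall>x\<in>M. \<forall>y\<in>D. d \<le> dist x y"
      using dist_pos_compact_closed[OF cM assms(4)] by blast
    obtain J w where J: "compact J" "connected J" "J \<subseteq> L" "v \<in> J" "J \<inter> D = {}" "w \<in> J" "infdist w D < d"
      using boundary_bumping_near[OF assms(1-6) d(1)] by (elim exE conjE)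
    then have "w \<in> reach_in L D v" unfolding reach_in_def by blast
    then have "w \<in> M" unfolding M_def using closure_subset by blast
    then have "d \<le> infdist w D"
      using d(2) assms(5) infdist_notempty[of D w]
      by (metis (no_types, lifting) Int_empty_right cINF_greatest)
    then show False using J by simp
  qed
qed

section \<open>Hausdorff convergence\<close>

text \<open>A relation between points that avoids the suprema. For nonempty compact sets,
  \<open>hausdorff_dist A B < e\<close> implies it and it implies
  \<open>hausdorff_dist A B \<le> e\<close>, so both give the same limits.\<close>

definition hclose :: "real \<Rightarrow> 'a::metric_space set \<Rightarrow> 'a set \<Rightarrow> bool" where
  "hclose e A B \<longleftrightarrow> (\<forall>a\<in>A. \<exists>b\<in>B. dist a b < e) \<and> (\<forall>b\<in>B. \<exists>a\<in>A. dist a b < e)"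

definition hlim :: "(nat \<Rightarrow> 'a::metric_space set) \<Rightarrow> 'a set \<Rightarrow> bool" where
  "hlim A B \<longleftrightarrow> (\<forall>e>0. \<exists>N. \<forall>n\<ge>N. hclose e (A n) B)"

lemma hcloseD:
  "hclose e A B \<Longrightarrow> a \<in> A \<Longrightarrow> \<exists>b\<in>B. dist a b < e"
  "hclose e A B \<Longrightarrow> b \<in> B \<Longrightarrow> \<exists>a\<in>A. dist a b < e"
  unfolding hclose_def by blast+

lemma hlimD:
  assumes "hlim A B" "e > 0"
  shows "\<exists>N. \<forall>n\<ge>N. hclose e (A n) B"
  using assms unfolding hlim_def by simp

lemma hlim_subseq:
  assumes "hlim A B" "strict_mono r"
  shows "hlim (\<lambda>n. A (r n)) B"
  unfolding hlim_def
proof (intro allI impI)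
  fix e :: real assume "e > 0"
  obtain N where N: "\<forall>n\<ge>N. hclose e (A n) B"
    using hlimD[OF assms(1) \<open>e > 0\<close>] ..
  have "r n \<ge> N" if "n \<ge> N" for n
    using seq_suble[OF assms(2), of n] that by simp
  with N show "\<exists>N. \<forall>n\<ge>N. hclose e (A (r n)) B"
    by (intro exI[of _ N]) simp
qed

lemma hlim_upper:
  assumes "hlim A B" "closed B" "\<And>n. a n \<in> A n" "a \<longlonglongrightarrow> x"
  shows "x \<in> B"
proof -
  have "\<exists>b\<in>B. dist b x < e" if "e > 0" for e
  proof -
    have e2: "e/2 > 0" using that by simp
    obtain N where N: "\<forall>n\<ge>N. hclose (e/2) (A n) B"
      using hlimD[OF assms(1) e2] ..
    obtain M where M: "\<forall>n\<ge>M. dist (a n) x < e/2"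
      using metric_LIMSEQ_D[OF assms(4) e2] ..
    define k where "k = max N M"
    have "k \<ge> N" "k \<ge> M" by (auto simp: k_def)
    then obtain b where b: "b \<in> B" "dist (a k) b < e/2" using N assms(3)[of k] hcloseD(1) by blast
    have "dist (a k) x < e/2" using M \<open>k \<ge> M\<close> by simp
    then have "dist b x < e" using b(2) by (metis dist_commute dist_triangle_half_r)
    then show ?thesis using b(1) by blast
  qed
  then have "x \<in> closure B" by (simp add: closure_approachable)
  then show ?thesis using assms(2) by simp
qed

text \<open>The points are chosen nearly nearest to \<open>b\<close>. The slack
  \<open>1 / real (Suc n)\<close> accounts for an infimum that may not be attained and vanishes in
  the limit.\<close>

lemma hlim_lower:
  assumes "hlim A B" "b \<in> B" "\<And>n. A n \<noteq> {}"
  shows "\<exists>a. (\<forall>n. a n \<in> A n) \<and> a \<longlonglongrightarrow> b"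
proof -
  have "\<exists>y. y \<in> A n \<and> dist b y < infdist b (A n) + 1 / real (Suc n)" for n
    using assms(3)[of n] cINF_less_iff[of "A n" "dist b" "infdist b (A n) + 1 / real (Suc n)"]
    by (auto simp: infdist_notempty bdd_below_image_dist)
  then obtain a where a: "\<And>n. a n \<in> A n" "\<And>n. dist b (a n) < infdist b (A n) + 1 / real (Suc n)"
    by metis
  have "a \<longlonglongrightarrow> b"
  proof (rule metric_LIMSEQ_I)
    fix e :: real assume "e > 0"
    then have e2: "e/2 > 0" by simp
    obtain N where N: "\<forall>n\<ge>N. hclose (e/2) (A n) B"
      using hlimD[OF assms(1) e2] ..
    obtain M where M: "1 / real (Suc M) < e/2" using nat_approx_posE[OF e2] .
    have "dist (a n) b < e" if "n \<ge> max N M" for n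
    proof -
      have "n \<ge> N" using that by simp
      then obtain y where "y \<in> A n" "dist y b < e/2" using N assms(2) hcloseD(2) by blast
      then have "infdist b (A n) < e/2" using infdist_le[of y "A n" b] by (simp add: dist_commute)
      moreover have "1 / real (Suc n) \<le> 1 / real (Suc M)" using that by (intro frac_le) auto
      ultimately show ?thesis using a(2)[of n] M by (simp only: dist_commute[of b])
    qed
    then show "\<exists>no. \<forall>n\<ge>no. dist (a n) b < e" by blast
  qed
  then show ?thesis using a(1) by blast
qed

lemma hlim_unique:
  assumes "hlim A B" "hlim A C" "closed B" "closed C" "\<And>n. A n \<noteq> {}"
  shows "B = C"
proof -
  have "x \<in> C'" if "hlim A B'" "hlim A C'" "closed C'" "x \<in> B'" for x B' C'
    using hlim_lower[OF that(1,4) assms(5)] hlim_upper[OF that(2,3)] by blast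
  then show ?thesis using assms by blast
qed

lemma hlim_avoid:
  assumes "hlim A B" "compact B" "closed R" "B \<inter> R = {}"
  shows "\<exists>N. \<forall>n\<ge>N. A n \<inter> R = {}"
proof -
  obtain d where d: "d > 0" "\<forall>x\<in>B. \<forall>y\<in>R. d \<le> dist x y"
    using dist_pos_compact_closed[OF assms(2,3,4)] by blast
  obtain N where N: "\<forall>n\<ge>N. hclose d (A n) B"
    using hlimD[OF assms(1) d(1)] ..
  have "A n \<inter> R = {}" if "n \<ge> N" for n
  proof (rule ccontr)
    assume "A n \<inter> R \<noteq> {}"
    then obtain a where "a \<in> A n" "a \<in> R" by blast
    moreover have "hclose d (A n) B" using N that by simp
    then obtain b where "b \<in> B" "dist a b < d" using \<open>a \<in> A n\<close> hcloseD(1) by blast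
    ultimately show False using d(2) by (metis dist_commute not_le)
  qed
  then show ?thesis by blast
qed

lemma hyperspace_compact:
  fixes X :: "'a::metric_space set"
  assumes "compact X"
  shows "A \<in> hyperspace X \<longleftrightarrow> A \<subseteq> X \<and> A \<noteq> {} \<and> compact A"
proof
  assume "A \<in> hyperspace X"
  then have "A \<noteq> {}" "closedin (top_of_set X) A" by (auto simp: hyperspace_def)
  then show "A \<subseteq> X \<and> A \<noteq> {} \<and> compact A"
    using closedin_compact[OF assms] closedin_imp_subset by metis
next
  assume "A \<subseteq> X \<and> A \<noteq> {} \<and> compact A"
  then show "A \<in> hyperspace X"
    by (simp add: hyperspace_def closed_subset compact_imp_closed)
qed

lemma hausdorff_dist_less:
  fixes A B :: "'a::metric_space set"
  assumes "compact A" "compact B" "A \<noteq> {}" "B \<noteq> {}" "hausdorff_dist A B < e"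
  shows "hclose e A B"
  unfolding hclose_def
proof
  have bd: "bounded A" "bounded B" using assms compact_imp_bounded by auto
  have hd: "hausdorff_dist A B = max (SUP a\<in>A. infdist a B) (SUP b\<in>B. infdist b A)"
    using assms bd by (simp add: hausdorff_dist_def)
  have near: "\<exists>b\<in>C. dist a b < e" if "infdist a C < e" "C \<noteq> {}" for a C
    using that cINF_less_iff[of C "dist a" e] by (simp add: infdist_notempty bdd_below_image_dist)
  show "\<forall>a\<in>A. \<exists>b\<in>B. dist a b < e"
  proof
    fix a assume "a \<in> A"
    then have "infdist a B \<le> (SUP a\<in>A. infdist a B)"
      by (rule cSUP_upper) (rule bdd_above_infdist_image[OF bd(1) assms(4)])
    then show "\<exists>b\<in>B. dist a b < e" using near[of a B] hd assms by auto
  qed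
  show "\<forall>b\<in>B. \<exists>a\<in>A. dist a b < e"
  proof
    fix b assume "b \<in> B"
    then have "infdist b A \<le> (SUP b\<in>B. infdist b A)"
      by (rule cSUP_upper) (rule bdd_above_infdist_image[OF bd(2) assms(3)])
    then show "\<exists>a\<in>A. dist a b < e" using near[of b A] hd assms by (auto simp: dist_commute)
  qed
qed

lemma hausdorff_dist_le:
  fixes A B :: "'a::metric_space set"
  assumes "compact A" "compact B" "A \<noteq> {}" "B \<noteq> {}"
    "hclose e A B"
  shows "hausdorff_dist A B \<le> e"
proof -
  have bd: "bounded A" "bounded B" using assms compact_imp_bounded by auto
  have "(SUP a\<in>A. infdist a B) \<le> e"
  proof (rule cSUP_least[OF assms(3)])
    fix a assume "a \<in> A"
    then obtain b where "b \<in> B" "dist a b < e" using hcloseD(1)[OF assms(5)] by blast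
    then show "infdist a B \<le> e" by (intro infdist_le2) auto
  qed
  moreover have "(SUP b\<in>B. infdist b A) \<le> e"
  proof (rule cSUP_least[OF assms(4)])
    fix b assume "b \<in> B"
    then obtain a where "a \<in> A" "dist a b < e" using hcloseD(2)[OF assms(5)] by blast
    then show "infdist b A \<le> e" by (intro infdist_le2) (auto simp: dist_commute)
  qed
  ultimately show ?thesis using assms bd by (simp add: hausdorff_dist_def)
qed

lemma limitin_hyperspace:
  fixes X :: "'a::metric_space set"
  assumes "compact X" "\<And>n. A n \<in> hyperspace X" "B \<in> hyperspace X"
  shows "limitin (hyperspace_topology X) A B sequentially \<longleftrightarrow> hlim A B"
proof -
  interpret Metric_space "hyperspace X" hausdorff_dist
    by (rule Metric_space_hausdorff_dist[OF assms(1)])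
  have c: "A n \<noteq> {}" "compact (A n)" "B \<noteq> {}" "compact B" for n
    using assms hyperspace_compact[OF assms(1)] by auto
  have "limitin mtopology A B sequentially \<longleftrightarrow> (\<forall>e>0. \<exists>N. \<forall>n\<ge>N. hausdorff_dist (A n) B < e)"
    using assms by (simp add: limit_metric_sequentially)
  also have "\<dots> \<longleftrightarrow> hlim A B"
  proof
    assume L: "\<forall>e>0. \<exists>N. \<forall>n\<ge>N. hausdorff_dist (A n) B < e"
    show "hlim A B" unfolding hlim_def
    proof (intro allI impI)
      fix e :: real assume "e > 0"
      with L obtain N where N: "\<forall>n\<ge>N. hausdorff_dist (A n) B < e" by blast
      have "hclose e (A n) B" if "n \<ge> N" for n
        using hausdorff_dist_less[OF c(2,4,1,3)] N that by simp
      then show "\<exists>N. \<forall>n\<ge>N. hclose e (A n) B"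
        by (intro exI[of _ N]) simp
    qed
  next
    assume L: "hlim A B"
    show "\<forall>e>0. \<exists>N. \<forall>n\<ge>N. hausdorff_dist (A n) B < e"
    proof (intro allI impI)
      fix e :: real assume "e > 0"
      then have e2: "e/2 > 0" by simp
      obtain N where N: "\<forall>n\<ge>N. hclose (e/2) (A n) B"
        using hlimD[OF L e2] ..
      have "hausdorff_dist (A n) B < e" if "n \<ge> N" for n
      proof -
        have "hausdorff_dist (A n) B \<le> e/2"
          by (rule hausdorff_dist_le[OF c(2,4,1,3)]) (use N that in simp)+
        then show ?thesis using \<open>e > 0\<close> by simp
      qed
      then show "\<exists>N. \<forall>n\<ge>N. hausdorff_dist (A n) B < e" by (intro exI[of _ N]) simp
    qed
  qed
  finally show ?thesis unfolding hyperspace_topology_def .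
qed

section \<open>Continua with the property of Kelley\<close>

lemma LIMSEQ_dist_Suc:
  fixes y :: "nat \<Rightarrow> 'a::metric_space"
  assumes "\<And>n. dist (y n) x < 1 / real (Suc n)"
  shows "y \<longlonglongrightarrow> x"
proof (rule metric_LIMSEQ_I)
  fix e :: real assume "e > 0"
  then obtain N where N: "1 / real (Suc N) < e" by (rule nat_approx_posE)
  have "dist (y n) x < e" if "n \<ge> N" for n
  proof -
    have "1 / real (Suc n) \<le> 1 / real (Suc N)" using that by (intro frac_le) auto
    then show ?thesis using assms[of n] N by linarith
  qed
  then show "\<exists>N. \<forall>n\<ge>N. dist (y n) x < e" by blast
qed

lemma subset_closure_iff:
  "X \<subseteq> closure K \<longleftrightarrow> (\<forall>U. open U \<longrightarrow> U \<inter> X \<noteq> {} \<longrightarrow> U \<inter> K \<noteq> {})"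
proof
  assume "X \<subseteq> closure K"
  then show "\<forall>U. open U \<longrightarrow> U \<inter> X \<noteq> {} \<longrightarrow> U \<inter> K \<noteq> {}"
    using open_Int_closure_eq_empty by fast
next
  assume R: "\<forall>U. open U \<longrightarrow> U \<inter> X \<noteq> {} \<longrightarrow> U \<inter> K \<noteq> {}"
  have "(- closure K) \<inter> K = {}" using closure_subset[of K] by blast
  then have "(- closure K) \<inter> X = {}" using R by (meson closed_closure open_Compl)
  then show "X \<subseteq> closure K" by blast
qed

locale kelley_continuum =
  fixes X :: "'a::metric_space set"
  assumes cpt: "compact X" and conn: "connected X"
    and kelley: "\<And>x p A. (\<And>n::nat. x n \<in> X) \<Longrightarrow> x \<longlonglongrightarrow> p \<Longrightarrow> A \<subseteq> X \<Longrightarrow> compact A \<Longrightarrow> connected A \<Longrightarrow> p \<in> A \<Longrightarrow>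
        \<exists>B. (\<forall>n. B n \<subseteq> X \<and> compact (B n) \<and> connected (B n) \<and> x n \<in> B n) \<and> hlim B A"
begin

definition cont :: "'a set \<Rightarrow> bool" where
  "cont L \<longleftrightarrow> L \<subseteq> X \<and> L \<noteq> {} \<and> compact L \<and> connected L"

text \<open>The interior relative to \<open>X\<close> is used in two ways: continua converging to a
  superset of \<open>P\<close> must eventually hit it, and so must some continuum out of any dense
  \<open>kappa\<close> set.\<close>

definition fat :: "'a set \<Rightarrow> bool" where
  "fat P \<longleftrightarrow> cont P \<and> (\<exists>U. open U \<and> U \<inter> X \<noteq> {} \<and> U \<inter> X \<subseteq> P)"

text \<open>When \<open>P\<close> is a continuum disjoint from \<open>F\<close>, this is
  \<open>kappa X F p\<close> for every \<open>p\<close> in \<open>P\<close>. Naming the set by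
  \<open>P\<close> instead of by a point keeps the interior of \<open>P\<close> available.\<close>

definition reach :: "'a set \<Rightarrow> 'a set \<Rightarrow> 'a set" where
  "reach P F = {v. \<exists>L. cont L \<and> v \<in> L \<and> L \<inter> P \<noteq> {} \<and> L \<inter> F = {}}"

definition dense_set :: "'a set \<Rightarrow> bool" where
  "dense_set S \<longleftrightarrow> (\<forall>U. open U \<longrightarrow> U \<inter> X \<noteq> {} \<longrightarrow> U \<inter> X \<inter> S \<noteq> {})"

lemma closedX: "closed X" by (rule compact_imp_closed[OF cpt])

lemma contD:
  "cont L \<Longrightarrow> L \<subseteq> X" "cont L \<Longrightarrow> L \<noteq> {}" "cont L \<Longrightarrow> compact L"
  "cont L \<Longrightarrow> connected L" "cont L \<Longrightarrow> closed L"
  by (simp_all add: cont_def compact_imp_closed)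

lemma cont_Un: "cont L \<Longrightarrow> cont M \<Longrightarrow> L \<inter> M \<noteq> {} \<Longrightarrow> cont (L \<union> M)"
  by (simp add: cont_def connected_Un compact_Un)

lemma fat_cont: "fat P \<Longrightarrow> cont P" unfolding fat_def by simp

lemma fat_mono: "fat P \<Longrightarrow> P \<subseteq> R \<Longrightarrow> cont R \<Longrightarrow> fat R"
  unfolding fat_def by blast

lemma reachI: "cont L \<Longrightarrow> v \<in> L \<Longrightarrow> L \<inter> P \<noteq> {} \<Longrightarrow> L \<inter> F = {} \<Longrightarrow> v \<in> reach P F"
  unfolding reach_def by blast

lemma reachE:
  assumes "v \<in> reach P F"
  obtains L where "cont L" "v \<in> L" "L \<inter> P \<noteq> {}" "L \<inter> F = {}"
  using assms unfolding reach_def by (elim CollectE exE conjE)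

lemma reach_sub: "reach P F \<subseteq> X - F"
  unfolding reach_def using contD(1) by blast

lemma reach_base: "cont P \<Longrightarrow> P \<inter> F = {} \<Longrightarrow> P \<subseteq> reach P F"
  by (auto intro!: reachI[of P] dest: contD(2))

lemma reach_absorb:
  assumes "cont L" "L \<inter> F = {}" "L \<inter> reach P F \<noteq> {}"
  shows "L \<subseteq> reach P F"
proof -
  obtain v where "v \<in> L" "v \<in> reach P F" using assms(3) by blast
  from \<open>v \<in> reach P F\<close> obtain M where M: "cont M" "v \<in> M" "M \<inter> P \<noteq> {}" "M \<inter> F = {}" by (rule reachE)
  have c: "cont (L \<union> M)" using cont_Un[OF assms(1) M(1)] M(2) \<open>v \<in> L\<close> by blast
  show ?thesis
  proof
    fix y assume "y \<in> L"
    then show "y \<in> reach P F" using reachI[OF c, of y P F] M assms(2) by blast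
  qed
qed

lemma reach_join:
  assumes "cont P" "P \<inter> F = {}" "u \<in> reach P F" "v \<in> reach P F"
  shows "\<exists>L. cont L \<and> u \<in> L \<and> v \<in> L \<and> L \<inter> F = {}"
proof -
  from assms(3) obtain L where L: "cont L" "u \<in> L" "L \<inter> P \<noteq> {}" "L \<inter> F = {}" by (rule reachE)
  from assms(4) obtain M where M: "cont M" "v \<in> M" "M \<inter> P \<noteq> {}" "M \<inter> F = {}" by (rule reachE)
  have "cont (L \<union> P)" using cont_Un[OF L(1) assms(1) L(3)] .
  then have "cont ((L \<union> P) \<union> M)" using cont_Un[OF _ M(1)] M(3) by blast
  then show ?thesis using L M assms(2) by (intro exI[of _ "(L \<union> P) \<union> M"]) blast
qed

text \<open>The only places where the property of Kelley enters are this lemma and the closedness of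
  the family of minimal nonblockers.\<close>

lemma reach_nbhd:
  assumes "fat P" "closed F" "P \<inter> F = {}" "x \<in> reach P F"
  shows "\<exists>R d. cont R \<and> P \<subseteq> R \<and> R \<inter> F = {} \<and> 0 < d \<and> ball x d \<inter> X \<subseteq> R"
proof (cases "F = {}")
  \<comment> \<open>The empty set is treated apart because \<open>infdist y {}\<close> is 0 by
    convention, which would make the set \<open>Z\<close> below empty.\<close>
  case True
  have "cont X" using cpt conn fat_cont[OF assms(1)] contD(1,2) unfolding cont_def by blast
  then show ?thesis using contD(1)[OF fat_cont[OF assms(1)]] True
    by (intro exI[of _ X] exI[of _ 1]) auto
next
  case False
  note P = fat_cont[OF assms(1)]
  from assms(4) obtain L where L: "cont L" "x \<in> L" "L \<inter> P \<noteq> {}" "L \<inter> F = {}" by (rule reachE)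
  define M where "M = L \<union> P"
  have M: "cont M" unfolding M_def using cont_Un[OF L(1) P L(3)] .
  have MF: "M \<inter> F = {}" unfolding M_def using L assms(3) by blast
  have xM: "x \<in> M" "P \<subseteq> M" unfolding M_def using L by auto
  obtain d0 where d0: "d0 > 0" "\<forall>x\<in>M. \<forall>y\<in>F. d0 \<le> dist x y"
    using dist_pos_compact_closed[OF contD(3)[OF M] assms(2) MF] by blast
  have dM: "d0 \<le> infdist m F" if "m \<in> M" for m
    unfolding infdist_notempty[OF False] using d0(2) that False by (intro cINF_greatest) auto
  \<comment> \<open>Half of the distance between \<open>M\<close> and \<open>F\<close> leaves room:
    continua close enough to \<open>M\<close> still lie in \<open>Z\<close>.\<close>
  define Z where "Z = X \<inter> {y. d0/2 \<le> infdist y F}"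
  have "closed {y. d0/2 \<le> infdist y F}"
    by (intro closed_Collect_le continuous_intros)
  then have clZ: "closed Z" and cZ: "compact Z"
    unfolding Z_def using closedX cpt by (auto intro: compact_Int_closed)
  have MZ: "M \<subseteq> Z" unfolding Z_def using dM contD(1)[OF M] d0(1) by fastforce
  define R where "R = connected_component_set Z x"
  have RZ: "R \<subseteq> Z" unfolding R_def by (rule connected_component_subset)
  have xR: "x \<in> R" unfolding R_def using MZ xM by auto
  have "closed R" unfolding R_def using clZ by (rule closed_connected_component)
  then have "compact R" using cZ RZ by (metis compact_Int_closed inf.absorb_iff2)
  moreover have "connected R" unfolding R_def by (rule connected_connected_component)
  moreover have "R \<subseteq> X" "R \<noteq> {}" using RZ xR unfolding Z_def by blast+
  ultimately have cR: "cont R" unfolding cont_def by blast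
  have maxR: "C \<subseteq> R" if "connected C" "C \<subseteq> Z" "x \<in> C" for C
    unfolding R_def using that by (intro connected_component_maximal)
  have MR: "M \<subseteq> R" using maxR[OF contD(4)[OF M] MZ xM(1)] .
  have RF: "R \<inter> F = {}"
  proof (rule ccontr)
    assume "R \<inter> F \<noteq> {}"
    then obtain y where "y \<in> R" "y \<in> F" by blast
    then show False using RZ d0(1) unfolding Z_def by force
  qed
  obtain U where U: "open U" "U \<inter> X \<noteq> {}" "U \<inter> X \<subseteq> P" using assms(1) unfolding fat_def by blast
  then obtain p0 where p0: "p0 \<in> U" "p0 \<in> X" by blast
  obtain r0 where r0: "r0 > 0" "ball p0 r0 \<subseteq> U" by (rule openE[OF U(1) p0(1)])
  have "\<exists>d>0. ball x d \<inter> X \<subseteq> R"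
  proof (rule ccontr)
    assume neg: "\<not> ?thesis"
    have "\<exists>y. y \<in> ball x (1 / real (Suc n)) \<and> y \<in> X \<and> y \<notin> R" for n
    proof -
      have "1 / real (Suc n) > 0" by simp
      with neg have "\<not> ball x (1 / real (Suc n)) \<inter> X \<subseteq> R" by blast
      then show ?thesis by blast
    qed
    then obtain y where y: "\<And>n. y n \<in> ball x (1 / real (Suc n))" "\<And>n. y n \<in> X" "\<And>n. y n \<notin> R"
      by metis
    have "y \<longlonglongrightarrow> x" using y(1) by (intro LIMSEQ_dist_Suc) (simp add: dist_commute)
    \<comment> \<open>The continua \<open>B n\<close> through \<open>y n\<close> approximate
      \<open>M\<close>, so a late one lies in \<open>Z\<close> and hits the open set
      \<open>U\<close> inside \<open>P\<close>. It is thereby joined to \<open>M\<close> within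
      \<open>Z\<close> and lies in the component \<open>R\<close>, contrary to the choice of
      \<open>y n\<close>.\<close>
    from kelley[OF y(2) this contD(1,3,4)[OF M] xM(1)]
    obtain B where B: "\<forall>n. B n \<subseteq> X \<and> compact (B n) \<and> connected (B n) \<and> y n \<in> B n" "hlim B M" by blast
    define e where "e = min (d0/2) r0"
    have e: "e > 0" "e \<le> d0/2" "e \<le> r0" using d0 r0 by (auto simp: e_def)
    obtain n where n: "hclose e (B n) M" using hlimD[OF B(2) e(1)] by blast
    have BZ: "B n \<subseteq> Z"
    proof
      fix b assume b: "b \<in> B n"
      then obtain m where m: "m \<in> M" "dist b m < e" using n hcloseD(1) by blast
      have "infdist m F \<le> infdist b F + dist m b" by (rule infdist_triangle)
      then have "d0/2 \<le> infdist b F" using dM[OF m(1)] m(2) e by (simp add: dist_commute)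
      then show "b \<in> Z" unfolding Z_def using B(1) b by blast
    qed
    have "p0 \<in> M" using p0 U xM by blast
    then obtain b where b: "b \<in> B n" "dist b p0 < e" using n hcloseD(2) by blast
    then have "b \<in> U" using r0 e by (auto simp: dist_commute subset_eq)
    then have "b \<in> M" using U xM b B(1) by blast
    then have "connected (B n \<union> M)" using b B(1) contD(4)[OF M] by (intro connected_Un) auto
    then have "B n \<union> M \<subseteq> R" using maxR BZ MZ xM(1) by blast
    then show False using y(3)[of n] B(1) by blast
  qed
  then show ?thesis using cR xM(2) MR RF by blast
qed

lemma reach_open:
  assumes "fat P" "closed F" "P \<inter> F = {}"
  shows "\<exists>G. open G \<and> reach P F = G \<inter> X"
proof -
  define G where "G = \<Union>{ball x d | x d. ball x d \<inter> X \<subseteq> reach P F}"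
  have "reach P F \<subseteq> G \<inter> X"
  proof
    fix x assume x: "x \<in> reach P F"
    obtain R d where R: "cont R" "P \<subseteq> R" "R \<inter> F = {}" "0 < d" "ball x d \<inter> X \<subseteq> R"
      using reach_nbhd[OF assms x] by blast
    have "x \<in> R" using R(4,5) x reach_sub by fastforce
    then have "R \<subseteq> reach P F" using reach_absorb[OF R(1,3)] x by blast
    then have "ball x d \<inter> X \<subseteq> reach P F" using R(5) by blast
    then have "x \<in> G" unfolding G_def using R(4) centre_in_ball by blast
    then show "x \<in> G \<inter> X" using x reach_sub by blast
  qed
  moreover have "G \<inter> X \<subseteq> reach P F" unfolding G_def by blast
  moreover have "open G" unfolding G_def by auto
  ultimately show ?thesis by blast
qed

lemma hull_compact:
  assumes "fat P" "closed F" "P \<inter> F = {}"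
  shows "compact (X - reach P F)" "closed (X - reach P F)"
proof -
  obtain G where "open G" "reach P F = G \<inter> X" using reach_open[OF assms] by blast
  then have "X - reach P F = X \<inter> (- G)" "closed (- G)" by auto
  then show "compact (X - reach P F)" using cpt compact_Int_closed by metis
  then show "closed (X - reach P F)" by (rule compact_imp_closed)
qed

text \<open>Finitely many of the neighbourhoods cover \<open>K\<close>. The continua belonging to
  them all contain \<open>P\<close>, so their union with \<open>P\<close> is again a
  continuum.\<close>

lemma reach_nbhd_compact:
  assumes "fat P" "closed F" "P \<inter> F = {}" "compact K" "K \<subseteq> reach P F"
  shows "\<exists>R U. cont R \<and> P \<subseteq> R \<and> R \<inter> F = {} \<and> open U \<and> K \<subseteq> U \<and> U \<inter> X \<subseteq> R"
proof -
  have "\<forall>x\<in>K. \<exists>R d. cont R \<and> P \<subseteq> R \<and> R \<inter> F = {} \<and> 0 < d \<and> ball x d \<inter> X \<subseteq> R"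
    using reach_nbhd[OF assms(1,2,3)] assms(5) by blast
  then obtain R d where Rd: "\<And>x. x \<in> K \<Longrightarrow> cont (R x) \<and> P \<subseteq> R x \<and> R x \<inter> F = {} \<and> 0 < d x \<and> ball x (d x) \<inter> X \<subseteq> R x"
    by metis
  have "K \<subseteq> (\<Union>x\<in>K. ball x (d x))" using Rd by force
  then obtain C where C: "C \<subseteq> K" "finite C" "K \<subseteq> (\<Union>x\<in>C. ball x (d x))"
    using compactE_image[OF assms(4), of K "\<lambda>x. ball x (d x)"] by auto
  define S where "S = P \<union> (\<Union>x\<in>C. R x)"
  note P = fat_cont[OF assms(1)]
  have eq: "S = \<Union>(insert P (R ` C))" unfolding S_def by auto
  have "connected S" unfolding eq
  proof (rule connected_Union)
    show "connected T" if "T \<in> insert P (R ` C)" for T using that Rd C(1) P contD(4) by blast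
    show "\<Inter> (insert P (R ` C)) \<noteq> {}" using Rd C(1) contD(2)[OF P] by blast
  qed
  moreover have "compact S" unfolding S_def
    using C(1,2) Rd contD(3) P by (intro compact_Un compact_UN) auto
  moreover have "S \<subseteq> X" unfolding S_def using Rd C(1) P contD(1) by blast
  moreover have "S \<noteq> {}" unfolding S_def using contD(2)[OF P] by blast
  ultimately have "cont S" unfolding cont_def by blast
  moreover have "S \<inter> F = {}" unfolding S_def using Rd C(1) assms(3) by blast
  moreover have "(\<Union>x\<in>C. ball x (d x)) \<inter> X \<subseteq> S" unfolding S_def using Rd C(1) by blast
  moreover have "open (\<Union>x\<in>C. ball x (d x))" by blast
  moreover have "P \<subseteq> S" unfolding S_def by blast
  ultimately show ?thesis using C(3) by blast
qed

lemma NB_iff: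
  "A \<in> nonblockers X \<longleftrightarrow> A \<subseteq> X \<and> A \<noteq> {} \<and> compact A \<and> A \<noteq> X \<and>
     (\<forall>x\<in>X - A. \<forall>U. open U \<longrightarrow> U \<inter> X \<noteq> {} \<longrightarrow> (\<exists>L. cont L \<and> x \<in> L \<and> L \<inter> A = {} \<and> L \<inter> U \<noteq> {}))"
proof -
  have ch: "L \<in> continuum_hyperspace X \<longleftrightarrow> cont L" for L
    unfolding continuum_hyperspace_def cont_def using hyperspace_compact[OF cpt] by auto
  have kap: "kappa X A x = \<Union>{L. cont L \<and> x \<in> L \<and> L \<inter> A = {}}" for x
    unfolding kappa_def ch using contD(1) by blast
  have "top_of_set X closure_of kappa X A x = X \<longleftrightarrow>
     (\<forall>U. open U \<longrightarrow> U \<inter> X \<noteq> {} \<longrightarrow> (\<exists>L. cont L \<and> x \<in> L \<and> L \<inter> A = {} \<and> L \<inter> U \<noteq> {}))" for x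
  proof -
    have "top_of_set X closure_of kappa X A x = X \<longleftrightarrow> X \<subseteq> closure (kappa X A x)"
      unfolding closure_of_subtopology kap using contD(1) by (auto simp: inf_absorb2 Sup_le_iff)
    also have "\<dots> \<longleftrightarrow> (\<forall>U. open U \<longrightarrow> U \<inter> X \<noteq> {} \<longrightarrow> U \<inter> kappa X A x \<noteq> {})"
      by (rule subset_closure_iff)
    also have "\<dots> \<longleftrightarrow> (\<forall>U. open U \<longrightarrow> U \<inter> X \<noteq> {} \<longrightarrow> (\<exists>L. cont L \<and> x \<in> L \<and> L \<inter> A = {} \<and> L \<inter> U \<noteq> {}))"
    proof -
      have "U \<inter> kappa X A x \<noteq> {} \<longleftrightarrow> (\<exists>L. cont L \<and> x \<in> L \<and> L \<inter> A = {} \<and> L \<inter> U \<noteq> {})" for U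
        unfolding kap by blast
      then show ?thesis by simp
    qed
    finally show ?thesis .
  qed
  then show ?thesis unfolding nonblockers_def mem_Collect_eq hyperspace_compact[OF cpt] conj_assoc by simp
qed

lemma NBD:
  "A \<in> nonblockers X \<Longrightarrow> A \<subseteq> X" "A \<in> nonblockers X \<Longrightarrow> A \<noteq> {}" "A \<in> nonblockers X \<Longrightarrow> compact A"
  "A \<in> nonblockers X \<Longrightarrow> closed A" "A \<in> nonblockers X \<Longrightarrow> A \<noteq> X"
  by (auto simp: NB_iff compact_imp_closed)

lemma NB_reach:
  "A \<in> nonblockers X \<Longrightarrow> x \<in> X \<Longrightarrow> x \<notin> A \<Longrightarrow> open U \<Longrightarrow> U \<inter> X \<noteq> {} \<Longrightarrow>
    \<exists>L. cont L \<and> x \<in> L \<and> L \<inter> A = {} \<and> L \<inter> U \<noteq> {}"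
  unfolding NB_iff by blast

lemma NB_dense_set:
  assumes "A \<in> nonblockers X"
  shows "dense_set (X - A)"
  unfolding dense_set_def
proof (intro allI impI)
  fix U assume U: "open U" "U \<inter> X \<noteq> {}"
  obtain x where "x \<in> X" "x \<notin> A" using NBD(1,5)[OF assms] by blast
  then obtain L where "cont L" "L \<inter> A = {}" "L \<inter> U \<noteq> {}" using NB_reach[OF assms _ _ U] by blast
  then show "U \<inter> X \<inter> (X - A) \<noteq> {}" using contD(1) by blast
qed

lemma dense_set_mono: "dense_set S \<Longrightarrow> S \<subseteq> T \<Longrightarrow> dense_set T"
  unfolding dense_set_def by blast

text \<open>From a point off \<open>A\<close>, the continua in \<open>X - A\<close> come into every
  open set, in particular into the interior of \<open>P\<close>. Here \<open>P\<close> is allowed to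
  meet \<open>A\<close>.\<close>

lemma reach_supset_NB:
  assumes "A \<in> nonblockers X" "F \<subseteq> A" "fat P"
  shows "X - A \<subseteq> reach P F"
proof
  fix v assume v: "v \<in> X - A"
  obtain U where "open U" "U \<inter> X \<noteq> {}" "U \<inter> X \<subseteq> P" using assms(3) unfolding fat_def by blast
  then obtain L where "cont L" "v \<in> L" "L \<inter> A = {}" "L \<inter> U \<noteq> {}"
    using NB_reach[OF assms(1), of v] v by blast
  then show "v \<in> reach P F"
    using reachI[of L v P F] assms(2) contD(1)[of L] \<open>U \<inter> X \<subseteq> P\<close> by blast
qed

text \<open>Two points of \<open>reach P F\<close> are joined through \<open>P\<close> by a
  continuum off \<open>F\<close>, and such a continuum cannot leave \<open>reach P F\<close>. Hence
  density of this one set gives density of every \<open>kappa\<close> set of its complement.\<close>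

lemma hull_NB:
  assumes "fat P" "closed F" "F \<subseteq> X" "F \<noteq> {}" "P \<inter> F = {}" "dense_set (reach P F)"
  shows "X - reach P F \<in> nonblockers X"
  unfolding NB_iff
proof (intro conjI ballI allI impI)
  note P = fat_cont[OF assms(1)]
  show "compact (X - reach P F)" using hull_compact[OF assms(1,2,5)] by simp
  show "X - reach P F \<noteq> {}" using reach_sub[of P F] assms by blast
  show "X - reach P F \<noteq> X" using reach_base[OF P assms(5)] contD(1,2)[OF P] by blast
  fix x U assume x: "x \<in> X - (X - reach P F)" and U: "open U" "U \<inter> X \<noteq> {}"
  obtain y where y: "y \<in> U" "y \<in> reach P F" using assms(6) U unfolding dense_set_def by blast
  obtain L where L: "cont L" "x \<in> L" "y \<in> L" "L \<inter> F = {}"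
    using reach_join[OF P assms(5)] x y(2) by blast
  have "L \<subseteq> reach P F" using reach_absorb[OF L(1,4)] L(3) y(2) by blast
  then show "\<exists>L. cont L \<and> x \<in> L \<and> L \<inter> (X - reach P F) = {} \<and> L \<inter> U \<noteq> {}" using L y by blast
qed blast

text \<open>A version of a theorem of Bing on points that do not weakly block a given continuum.\<close>

lemma exists_maximal_reach:
  assumes "fat P" "a \<in> X - P"
  shows "\<exists>q\<in>X - P. reach P {a} \<subseteq> reach P {q} \<and> dense_set (reach P {q}) \<and> (\<forall>r\<in>X - reach P {q}. reach P {r} = reach P {q})"
proof -
  note P = fat_cont[OF assms(1)]
  define S where "S = {reach P {q} |q. q \<in> X - P \<and> reach P {a} \<subseteq> reach P {q}}"
  have base: "P \<subseteq> reach P {r}" if "r \<notin> P" for r using reach_base[OF P, of "{r}"] that by blast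
  have "\<exists>U\<in>S. \<forall>Y\<in>C. Y \<subseteq> U" if C: "subset.chain S C" for C
  proof (cases "C = {}")
    case True
    then show ?thesis unfolding S_def using assms(2) by blast
  next
    case False
    have CS: "C \<subseteq> S" using C unfolding subset.chain_def by blast
    \<comment> \<open>The members of the chain are open, so if their union were \<open>X\<close>,
      one member would be \<open>X\<close> by compactness. But \<open>reach P {q}\<close> omits
      \<open>q\<close>. A point \<open>r\<close> outside the union then yields the upper bound
      \<open>reach P {r}\<close>.\<close>
    have "\<not> X \<subseteq> \<Union>C"
    proof
      assume XC: "X \<subseteq> \<Union>C"
      have op: "openin (top_of_set X) Y" if Y: "Y \<in> C" for Y
      proof -
        obtain q where q: "q \<in> X - P" "Y = reach P {q}" using CS Y unfolding S_def by blast
        have "P \<inter> {q} = {}" using q(1) by blast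
        from reach_open[OF assms(1) closed_singleton this]
        obtain G where "open G" "reach P {q} = G \<inter> X" by (elim exE conjE)
        then show ?thesis unfolding q(2) openin_open by (metis Int_commute)
      qed
      have "\<forall>c\<in>C. openin (top_of_set X) c" using op by blast
      then obtain D where D: "D \<subseteq> C" "finite D" "X \<subseteq> \<Union>D"
        using cpt XC unfolding compact_eq_openin_cover by meson
      have "D \<noteq> {}" using D(3) assms(2) by blast
      moreover have "subset.chain S D" using C D(1) unfolding subset.chain_def by blast
      ultimately have "\<Union>D \<in> D" using Union_in_chain[OF D(2)] by blast
      then obtain q where "q \<in> X - P" "\<Union>D = reach P {q}" using D(1) CS unfolding S_def by blast
      then show False using D(3) reach_sub[of P "{q}"] by blast
    qed
    then obtain r where r: "r \<in> X" "r \<notin> \<Union>C" by blast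
    have "P \<subseteq> \<Union>C"
    proof -
      obtain Y where "Y \<in> C" using False by blast
      then obtain q where "q \<in> X - P" "Y = reach P {q}" using CS unfolding S_def by blast
      then show ?thesis using base[of q] \<open>Y \<in> C\<close> by blast
    qed
    then have rP: "r \<notin> P" using r by blast
    have up: "Y \<subseteq> reach P {r}" if Y: "Y \<in> C" for Y
    proof
      fix v assume "v \<in> Y"
      obtain q where q: "Y = reach P {q}" using CS Y unfolding S_def by blast
      from \<open>v \<in> Y\<close> obtain L where L: "cont L" "v \<in> L" "L \<inter> P \<noteq> {}" "L \<inter> {q} = {}" unfolding q by (rule reachE)
      have "L \<subseteq> Y" unfolding q using reachI[OF L(1) _ L(3,4)] by blast
      then have "r \<notin> L" using r Y by blast
      then show "v \<in> reach P {r}" using reachI[OF L(1,2,3), of "{r}"] by blast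
    qed
    moreover have "reach P {a} \<subseteq> reach P {r}"
    proof -
      obtain Y where "Y \<in> C" using False by blast
      moreover from this have "reach P {a} \<subseteq> Y" using CS unfolding S_def by blast
      ultimately show ?thesis using up by blast
    qed
    ultimately show ?thesis unfolding S_def using r(1) rP by blast
  qed
  then obtain Y where Y: "Y \<in> S" "\<forall>Z\<in>S. Y \<subseteq> Z \<longrightarrow> Z = Y" using subset_Zorn by meson
  then obtain q where q: "q \<in> X - P" "reach P {a} \<subseteq> reach P {q}" "Y = reach P {q}" unfolding S_def by blast
  have mx: "reach P {r} = reach P {q}" if "r \<in> X" "r \<notin> P" "reach P {q} \<subseteq> reach P {r}" for r
  proof -
    have "reach P {r} \<in> S" unfolding S_def using that q by blast
    then show ?thesis using Y(2) q(3) that(3) by blast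
  qed
  have qP: "P \<inter> {q} = {}" using q by blast
  \<comment> \<open>If the maximal set were not dense, its closure \<open>W\<close> would be a
    continuum missing some \<open>r\<close> and so would lie in \<open>reach P {r}\<close>. Boundary
    bumping puts \<open>q\<close> into \<open>W\<close>, while \<open>q\<close> is not in
    \<open>reach P {q}\<close>, so the set would not be maximal.\<close>
  have "dense_set (reach P {q})"
  proof (rule ccontr)
    assume "\<not> ?thesis"
    then obtain U where U: "open U" "U \<inter> X \<noteq> {}" "U \<inter> X \<inter> reach P {q} = {}" unfolding dense_set_def by blast
    then obtain r where r: "r \<in> U" "r \<in> X" by blast
    define W where "W = closure (reach P {q})"
    have WX: "W \<subseteq> X" unfolding W_def using reach_sub closedX closure_minimal by (metis Diff_subset order_trans)
    have rW: "r \<notin> W"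
    proof
      assume "r \<in> W"
      then have "U \<inter> reach P {q} \<noteq> {}" unfolding W_def using r U(1) open_Int_closure_eq_empty by blast
      then show False using U(3) reach_sub[of P "{q}"] by blast
    qed
    obtain p where p: "p \<in> P" using contD(2)[OF P] by blast
    have conn_reach: "connected (reach P {q})"
    proof -
      have "reach P {q} = \<Union>{L. cont L \<and> P \<subseteq> L \<and> L \<inter> {q} = {}}"
      proof (intro equalityI subsetI)
        fix v assume "v \<in> reach P {q}"
        then obtain L where L: "cont L" "v \<in> L" "L \<inter> P \<noteq> {}" "L \<inter> {q} = {}" by (rule reachE)
        then have "cont (L \<union> P)" using cont_Un P by blast
        then show "v \<in> \<Union>{L. cont L \<and> P \<subseteq> L \<and> L \<inter> {q} = {}}" using L qP by blast
      next
        fix v assume "v \<in> \<Union>{L. cont L \<and> P \<subseteq> L \<and> L \<inter> {q} = {}}"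
        then obtain L where L: "cont L" "P \<subseteq> L" "L \<inter> {q} = {}" "v \<in> L" by blast
        have "L \<inter> P \<noteq> {}" using L(2) p by blast
        then show "v \<in> reach P {q}" by (rule reachI[OF L(1,4) _ L(3)])
      qed
      moreover have "connected (\<Union>{L. cont L \<and> P \<subseteq> L \<and> L \<inter> {q} = {}})"
        using contD(4) p by (intro connected_Union) auto
      ultimately show ?thesis by simp
    qed
    have PW: "P \<subseteq> W" unfolding W_def using base[of q] q closure_subset by blast
    have "compact W" unfolding W_def using cpt WX W_def by (metis closed_closure compact_Int_closed inf.absorb_iff2)
    moreover have "connected W" unfolding W_def using conn_reach by (rule connected_imp_connected_closure)
    ultimately have cW: "cont W" unfolding cont_def using WX PW p by blast
    have "W \<inter> P \<noteq> {}" "W \<inter> {r} = {}" using PW p rW by blast+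
    then have Wr: "W \<subseteq> reach P {r}" using reachI[OF cW] by blast
    have qW: "q \<in> W"
    proof (rule ccontr)
      assume "q \<notin> W"
      then obtain d where d: "d > 0" "\<forall>x\<in>W. \<forall>y\<in>{q}. d \<le> dist x y"
        using dist_pos_compact_closed[OF contD(3)[OF cW] closed_singleton[of q]] by blast
      have "p \<in> X" "q \<in> X" "p \<notin> {q}" using p contD(1)[OF P] q by auto
      have "X \<inter> {q} \<noteq> {}" using q by blast
      from boundary_bumping_near[OF cpt conn \<open>p \<in> X\<close> closed_singleton[of q] this \<open>p \<notin> {q}\<close> d(1)]
      obtain J w where J: "compact J" "connected J" "J \<subseteq> X" "p \<in> J" "J \<inter> {q} = {}" "w \<in> J" "infdist w {q} < d"
        by (elim exE conjE)
      then have "cont J" unfolding cont_def by blast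
      then have "w \<in> reach P {q}" using reachI[of J w P "{q}"] J p by blast
      then have "w \<in> W" unfolding W_def using closure_subset by blast
      then show False using d J(7) by fastforce
    qed
    have "reach P {q} \<subseteq> reach P {r}" using Wr unfolding W_def using closure_subset by blast
    then have "reach P {r} = reach P {q}" using mx r PW rW by blast
    then show False using Wr qW reach_sub[of P "{q}"] by blast
  qed
  \<comment> \<open>A continuum that reaches \<open>P\<close> off \<open>q\<close> stays inside
    \<open>reach P {q}\<close> and therefore avoids every \<open>r\<close> outside it. This gives
    one inclusion, and maximality gives the other.\<close>
  moreover have "reach P {r} = reach P {q}" if r: "r \<in> X - reach P {q}" for r
  proof -
    have rP: "r \<notin> P" using base[of q] q r by blast
    have "reach P {q} \<subseteq> reach P {r}"
    proof
      fix v assume "v \<in> reach P {q}"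
      then obtain L where L: "cont L" "v \<in> L" "L \<inter> P \<noteq> {}" "L \<inter> {q} = {}" by (rule reachE)
      then have "L \<subseteq> reach P {q}" using reachI[OF L(1) _ L(3,4)] by blast
      then show "v \<in> reach P {r}" using reachI[OF L(1,2,3), of "{r}"] r by blast
    qed
    then show ?thesis using mx rP r by blast
  qed
  ultimately show ?thesis using q by blast
qed

end

lemma finite_net:
  fixes X :: "'a::metric_space set"
  assumes "compact X" "S \<subseteq> X" "e > 0"
  shows "\<exists>F. finite F \<and> F \<subseteq> S \<and> S \<subseteq> (\<Union>f\<in>F. ball f e)"
proof -
  have "closure S \<subseteq> X" using assms(1,2) by (simp add: closure_minimal compact_imp_closed)
  then have "compact (closure S)" using assms(1) by (metis closed_closure compact_Int_closed inf.absorb_iff2)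
  moreover have "closure S \<subseteq> (\<Union>f\<in>S. ball f e)"
  proof
    fix y assume "y \<in> closure S"
    then obtain f where "f \<in> S" "dist f y < e" using assms(3) unfolding closure_approachable by blast
    then show "y \<in> (\<Union>f\<in>S. ball f e)" by auto
  qed
  ultimately obtain F where F: "F \<subseteq> S" "finite F" "closure S \<subseteq> (\<Union>f\<in>F. ball f e)"
    using compactE_image[of "closure S" S "\<lambda>f. ball f e"] open_ball by metis
  have "S \<subseteq> (\<Union>f\<in>F. ball f e)" using F(3) closure_subset[of S] by (rule order_trans[rotated])
  then show ?thesis using F by blast
qed

lemma strict_mono_add: "strict_mono (\<lambda>n::nat. n + N)"
  by (simp add: strict_mono_def)

lemma LIMSEQ_eventually_in:
  assumes "x \<longlonglongrightarrow> p" "open U" "p \<in> U"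
  shows "\<exists>N. \<forall>n\<ge>N. x n \<in> U"
  using topological_tendstoD[OF assms] by (simp add: eventually_sequentially)

context kelley_continuum
begin

lemma contI: "L \<subseteq> X \<Longrightarrow> x \<in> L \<Longrightarrow> compact L \<Longrightarrow> connected L \<Longrightarrow> cont L"
  unfolding cont_def by blast

lemma compact_closed_subset: "closed Z \<Longrightarrow> Z \<subseteq> X \<Longrightarrow> compact Z"
  using compact_Int_closed[OF cpt, of Z] by (simp add: Int_absorb1)

text \<open>The closure of the union of all continua from \<open>v\<close> inside
  \<open>X - P\<close> meets \<open>P\<close> by boundary bumping and never leaves the closure of
  \<open>X - P\<close>.\<close>

lemma joins_boundary:
  assumes "cont P" "v \<in> closure (X - P)"
  shows "\<exists>M. cont M \<and> v \<in> M \<and> M \<subseteq> closure (X - P) \<and> M \<inter> P \<noteq> {}"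
proof (cases "v \<in> P")
  case True
  then have "cont {v}" using contD(1)[OF assms(1)] by (auto simp: cont_def)
  then show ?thesis using True assms(2) by (intro exI[of _ "{v}"]) auto
next
  case False
  have ZX: "closure (X - P) \<subseteq> X" using closedX by (simp add: closure_minimal)
  then have vX: "v \<in> X" using assms(2) by blast
  have XP: "X \<inter> P \<noteq> {}" using contD(1,2)[OF assms(1)] by blast
  note b = bumping_closure[OF cpt conn vX contD(5)[OF assms(1)] XP False]
  have "reach_in X P v \<subseteq> X - P" unfolding reach_in_def by blast
  then have sub: "closure (reach_in X P v) \<subseteq> closure (X - P)" by (rule closure_mono)
  have "cont (closure (reach_in X P v))" by (rule contI[OF b(3,4,1,2)])
  then show ?thesis using b(4,5) sub by (intro exI conjI)
qed

lemma cont_component: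
  assumes "compact Z" "Z \<subseteq> X" "T \<in> components Z"
  shows "cont T"
  unfolding cont_def
  using in_components_nonempty[OF assms(3)] in_components_connected[OF assms(3)]
    order_trans[OF in_components_subset[OF assms(3)] assms(2)]
    compact_closed_subset[OF closed_components[OF compact_imp_closed[OF assms(1)] assms(3)]]
  by blast

text \<open>The closed sets are removed from \<open>U\<close> one after another, and what remains is
  open and still meets \<open>X\<close>.\<close>

lemma dense_set_finite_Union:
  assumes "finite \<T>" "\<And>T. T \<in> \<T> \<Longrightarrow> closed T \<and> (\<forall>U. open U \<longrightarrow> U \<inter> X \<noteq> {} \<longrightarrow> \<not> U \<inter> X \<subseteq> T)"
    "open U" "U \<inter> X \<noteq> {}"
  shows "\<not> U \<inter> X \<subseteq> \<Union>\<T>"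
  using assms
proof (induction arbitrary: U rule: finite_induct)
  case empty
  then show ?case by blast
next
  case (insert T \<T>)
  have "open (U - T)" using insert.prems by (simp add: open_Diff)
  moreover have "(U - T) \<inter> X \<noteq> {}" using insert.prems by blast
  ultimately have "\<not> (U - T) \<inter> X \<subseteq> \<Union>\<T>" using insert.IH[of "U - T"] insert.prems(1) by blast
  then show ?case by blast
qed

end

section \<open>Minimal nonblockers\<close>

text \<open>Compactness and connectedness of the space of nonblockers are stated through sequences.
  In \<open>nb_connected\<close> the two limit conditions express that \<open>S\<close> is closed
  and that its complement is closed.\<close>

locale kelley_nonblockers = kelley_continuum +
  assumes decomp: "\<exists>P Q. cont P \<and> cont Q \<and> P \<noteq> X \<and> Q \<noteq> X \<and> X = P \<union> Q"
    and nb_compact: "\<And>A. (\<And>n::nat. A n \<in> nonblockers X) \<Longrightarrow>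
        \<exists>B r. B \<in> nonblockers X \<and> strict_mono (r::nat\<Rightarrow>nat) \<and> hlim (\<lambda>n. A (r n)) B"
    and nb_connected: "\<And>S. S \<subseteq> nonblockers X \<Longrightarrow> S \<noteq> {} \<Longrightarrow>
        (\<And>A B. (\<And>n::nat. A n \<in> S) \<Longrightarrow> B \<in> nonblockers X \<Longrightarrow> hlim A B \<Longrightarrow> B \<in> S) \<Longrightarrow>
        (\<And>A B. (\<And>n::nat. A n \<in> nonblockers X - S) \<Longrightarrow> B \<in> nonblockers X \<Longrightarrow> hlim A B \<Longrightarrow> B \<notin> S) \<Longrightarrow>
        S = nonblockers X"
begin

text \<open>If all components of the closure of \<open>X - P\<close> meeting \<open>U\<close> were nowhere dense, then every
  finite subset of \<open>U\<close> would lie in a nonblocker, and by compactness so would \<open>U\<close> itself.\<close>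

lemma fat_component:
  assumes "fat P" "open U" "U \<inter> X \<noteq> {}" "U \<inter> X \<inter> P = {}"
  shows "\<exists>T\<in>components (closure (X - P)). fat T \<and> T \<inter> U \<noteq> {}"
proof (rule ccontr)
  assume neg: "\<not> ?thesis"
  note P = fat_cont[OF assms(1)]
  define Z where "Z = closure (X - P)"
  have ZX: "Z \<subseteq> X" unfolding Z_def using closedX by (simp add: closure_minimal)
  have cZ: "compact Z" using ZX unfolding Z_def by (intro compact_closed_subset) auto
  have UZ: "U \<inter> X \<subseteq> Z" unfolding Z_def using assms(4) closure_subset[of "X - P"] by blast
  have hull: "X - reach P F \<in> nonblockers X" if F: "finite F" "F \<noteq> {}" "F \<subseteq> U \<inter> X" for F
  proof -
    have FP: "P \<inter> F = {}" using F(3) assms(4) by blast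
    define \<T> where "\<T> = connected_component_set Z ` F"
    have comp: "connected_component_set Z f \<in> components Z" if "f \<in> F" for f
      using that F(3) UZ by (auto simp: components_def)
    have "closed T \<and> (\<forall>V. open V \<longrightarrow> V \<inter> X \<noteq> {} \<longrightarrow> \<not> V \<inter> X \<subseteq> T)" if "T \<in> \<T>" for T
    proof -
      obtain f where f: "f \<in> F" "T = connected_component_set Z f" using \<open>T \<in> \<T>\<close> unfolding \<T>_def by blast
      have T: "T \<in> components Z" using comp f by blast
      have "f \<in> T" using f F(3) UZ by auto
      then have "T \<inter> U \<noteq> {}" using f F(3) by blast
      then have "\<not> fat T" using neg T unfolding Z_def by blast
      then show ?thesis using cont_component[OF cZ ZX T] contD(5) unfolding fat_def by blast
    qed
    moreover have "finite \<T>" unfolding \<T>_def using F(1) by simp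
    ultimately have small: "\<not> V \<inter> X \<subseteq> \<Union>\<T>" if "open V" "V \<inter> X \<noteq> {}" for V
      using dense_set_finite_Union[OF _ _ that] by simp
    \<comment> \<open>A point that does not reach \<open>P\<close> off \<open>F\<close> still has a
      continuum to \<open>P\<close> inside \<open>Z\<close>. Some \<open>f\<close> in
      \<open>F\<close> lies on it, so the point belongs to the component of
      \<open>f\<close>.\<close>
    have sub: "X - reach P F \<subseteq> \<Union>\<T>"
    proof
      fix v assume v: "v \<in> X - reach P F"
      then have "v \<notin> P" using reach_base[OF P FP] by blast
      then have "v \<in> closure (X - P)" using v closure_subset[of "X - P"] by blast
      from joins_boundary[OF P this]
      obtain M where M: "cont M" "v \<in> M" "M \<subseteq> closure (X - P)" "M \<inter> P \<noteq> {}" by (elim exE conjE)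
      have "M \<inter> F \<noteq> {}" using reachI[OF M(1,2,4), of F] v by blast
      then obtain f where f: "f \<in> M" "f \<in> F" by blast
      have "M \<subseteq> connected_component_set Z f"
        by (rule connected_component_maximal[OF f(1) contD(4)[OF M(1)]]) (use M(3) Z_def in simp)
      then show "v \<in> \<Union>\<T>" unfolding \<T>_def using f M(2) by blast
    qed
    have "dense_set (reach P F)" unfolding dense_set_def
    proof (intro allI impI)
      fix V assume "open V" "V \<inter> X \<noteq> {}"
      then have "\<not> V \<inter> X \<subseteq> \<Union>\<T>" by (rule small)
      then show "V \<inter> X \<inter> reach P F \<noteq> {}" using sub by blast
    qed
    then show ?thesis
      using hull_NB[OF assms(1) finite_imp_closed[OF F(1)] _ F(2) FP] F(3) by blast
  qed
  \<comment> \<open>Finite nets of \<open>U \<inter> X\<close> with mesh tending to zero lie in the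
    corresponding hulls, so a limit of these hulls contains \<open>U \<inter> X\<close>. The
    complement of a nonblocker is dense, which forbids this.\<close>
  have "\<exists>F. finite F \<and> F \<subseteq> U \<inter> X \<and> U \<inter> X \<subseteq> (\<Union>f\<in>F. ball f (1 / real (Suc n)))" for n
    by (rule finite_net[OF cpt]) auto
  then obtain F where F: "\<And>n. finite (F n) \<and> F n \<subseteq> U \<inter> X \<and> U \<inter> X \<subseteq> (\<Union>f\<in>F n. ball f (1 / real (Suc n)))"
    by metis
  have Fne: "F n \<noteq> {}" for n using F[of n] assms(3) by auto
  have "X - reach P (F n) \<in> nonblockers X" for n using hull[of "F n"] F[of n] Fne[of n] by blast
  from nb_compact[of "\<lambda>n. X - reach P (F n)", OF this] obtain B r where B: "B \<in> nonblockers X" "strict_mono r"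
    "hlim (\<lambda>n. X - reach P (F (r n))) B" by (elim exE conjE)
  have "U \<inter> X \<subseteq> B"
  proof
    fix u assume u: "u \<in> U \<inter> X"
    have "\<exists>f\<in>F n. dist f u < 1 / real (Suc n)" for n using F[of n] u by fastforce
    then obtain f where f: "\<And>n. f n \<in> F n" "\<And>n. dist (f n) u < 1 / real (Suc n)" by metis
    have "f \<longlonglongrightarrow> u" using f(2) by (rule LIMSEQ_dist_Suc)
    then have lim: "(\<lambda>n. f (r n)) \<longlonglongrightarrow> u" using LIMSEQ_subseq_LIMSEQ[OF _ B(2)] by (simp add: o_def)
    have "f (r n) \<in> X - reach P (F (r n))" for n using f(1) F[of "r n"] reach_sub[of P "F (r n)"] by blast
    from hlim_upper[OF B(3) NBD(4)[OF B(1)] this lim] show "u \<in> B" .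
  qed
  moreover have "U \<inter> X \<inter> (X - B) \<noteq> {}" using NB_dense_set[OF B(1)] assms(2,3) unfolding dense_set_def by blast
  ultimately show False by blast
qed

lemma exists_fat_proper: "\<exists>P. fat P \<and> P \<noteq> X"
proof -
  obtain P Q where PQ: "cont P" "cont Q" "P \<noteq> X" "Q \<noteq> X" "X = P \<union> Q" using decomp by (elim exE conjE)
  have "open (- Q)" using contD(5)[OF PQ(2)] by auto
  moreover have "- Q \<inter> X \<noteq> {}" "- Q \<inter> X \<subseteq> P" using PQ(4,5) by blast+
  ultimately have "fat P" unfolding fat_def using PQ(1) by blast
  then show ?thesis using PQ(3) by blast
qed

text \<open>If the given proper continuum contains \<open>x\<close>, it is enlarged to a continuum
  \<open>R\<close> that is a neighbourhood of \<open>x\<close> but still omits a point. A fat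
  component of the closure of \<open>X - R\<close> stays away from \<open>x\<close>.\<close>

lemma fat_avoiding_point:
  assumes "x \<in> X"
  shows "\<exists>P. fat P \<and> x \<notin> P"
proof -
  obtain P where P: "fat P" "P \<noteq> X" using exists_fat_proper by blast
  show ?thesis
  proof (cases "x \<in> P")
    case False
    then show ?thesis using P by blast
  next
    case True
    obtain a where "a \<in> X - P" using P contD(1)[OF fat_cont[OF P(1)]] by blast
    then obtain q where q: "q \<in> X - P" using exists_maximal_reach[OF P(1)] by blast
    have Pq: "P \<inter> {q} = {}" using q by blast
    have "x \<in> reach P {q}" using reach_base[OF fat_cont[OF P(1)] Pq] True by blast
    from reach_nbhd[OF P(1) closed_singleton Pq this]
    obtain R d where R: "cont R" "P \<subseteq> R" "R \<inter> {q} = {}" "0 < d" "ball x d \<inter> X \<subseteq> R" by (elim exE conjE)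
    have fR: "fat R" using fat_mono[OF P(1) R(2,1)] .
    have "- R \<inter> X \<noteq> {}" "- R \<inter> X \<inter> R = {}" using q R(3) by blast+
    from fat_component[OF fR _ this] obtain T where T: "T \<in> components (closure (X - R))" "fat T"
      using contD(5)[OF R(1)] by auto
    have "T \<subseteq> closure (X - R)" using T(1) in_components_subset by blast
    moreover have "X - R \<subseteq> - ball x d" using R(5) by blast
    then have "closure (X - R) \<subseteq> - ball x d" by (intro closure_minimal) (auto simp: closed_Compl)
    ultimately have "x \<notin> T" using R(4) by auto
    then show ?thesis using T by blast
  qed
qed

text \<open>Every nonblocker is cut down to one determined by a single point of it, which is why the
  minimal ones have the form \<open>X - reach P {b}\<close>.\<close>

lemma hull_point:
  assumes "A \<in> nonblockers X" "a \<in> A" "fat P" "a \<notin> P"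
  shows "X - reach P {a} \<in> nonblockers X" "X - reach P {a} \<subseteq> A"
proof -
  have sub: "X - A \<subseteq> reach P {a}" using reach_supset_NB[OF assms(1) _ assms(3)] assms(2) by blast
  then show "X - reach P {a} \<subseteq> A" by blast
  have "dense_set (reach P {a})" using dense_set_mono[OF NB_dense_set[OF assms(1)] sub] .
  then show "X - reach P {a} \<in> nonblockers X"
    using hull_NB[OF assms(3) closed_singleton, of a] NBD(1)[OF assms(1)] assms(2,4) by blast
qed

definition Bmin :: "'a set set" where
  "Bmin = {B \<in> nonblockers X. \<forall>A\<in>nonblockers X. A \<subseteq> B \<longrightarrow> A = B}"

lemma BminD: "B \<in> Bmin \<Longrightarrow> B \<in> nonblockers X" "B \<in> Bmin \<Longrightarrow> A \<in> nonblockers X \<Longrightarrow> A \<subseteq> B \<Longrightarrow> A = B"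
  unfolding Bmin_def by blast+

text \<open>The complement of a maximal \<open>reach P {q}\<close> is minimal: a nonblocker inside
  it contains the hull of one of its own points, and by maximality that hull is the whole
  complement.\<close>

lemma exists_Bmin:
  assumes "fat P" "a \<in> X - P"
  shows "\<exists>B\<in>Bmin. B \<inter> P = {} \<and> B \<subseteq> X - reach P {a}"
proof -
  obtain q where q: "q \<in> X - P" "reach P {a} \<subseteq> reach P {q}" "dense_set (reach P {q})" "\<forall>r\<in>X - reach P {q}. reach P {r} = reach P {q}"
    using exists_maximal_reach[OF assms] by blast
  have Pq: "P \<inter> {q} = {}" using q by blast
  have base: "P \<subseteq> reach P {q}" using reach_base[OF fat_cont[OF assms(1)] Pq] .
  have "X - reach P {q} \<in> nonblockers X"
    using hull_NB[OF assms(1) closed_singleton _ _ Pq q(3)] q(1) by blast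
  moreover have "A = X - reach P {q}" if A: "A \<in> nonblockers X" "A \<subseteq> X - reach P {q}" for A
  proof -
    obtain a where a: "a \<in> A" using NBD(2)[OF A(1)] by blast
    then have "a \<notin> P" using A(2) base by blast
    from hull_point(2)[OF A(1) a assms(1) this] show ?thesis using q(4) A(2) a by blast
  qed
  ultimately have min: "X - reach P {q} \<in> Bmin" unfolding Bmin_def by blast
  have "(X - reach P {q}) \<inter> P = {}" "X - reach P {q} \<subseteq> X - reach P {a}" using base q(2) by blast+
  then show ?thesis by (intro bexI[OF _ min] conjI)
qed

text \<open>The same set results for every point \<open>b\<close> and every fat \<open>P\<close>
  omitting it. This freedom lets \<open>P\<close> and \<open>b\<close> be adapted to each argument
  below.\<close>

lemma Bmin_hull:
  assumes "B \<in> Bmin" "b \<in> B" "fat P" "b \<notin> P"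
  shows "X - reach P {b} = B"
  by (rule BminD(2)[OF assms(1) hull_point[OF BminD(1)[OF assms(1)] assms(2-4)]])

text \<open>If \<open>s\<close> in \<open>B\<close> were missed by \<open>L\<close>, then
  \<open>X - B\<close> would be \<open>reach P {s}\<close>, and a continuum that avoids
  \<open>s\<close> cannot contain points both inside and outside that set.\<close>

lemma Bmin_terminal:
  assumes "B \<in> Bmin" "cont L" "L \<inter> B \<noteq> {}" "\<not> L \<subseteq> B"
  shows "B \<subseteq> L"
proof
  fix s assume s: "s \<in> B"
  show "s \<in> L"
  proof (rule ccontr)
    assume sL: "s \<notin> L"
    have "s \<in> X" using s NBD(1)[OF BminD(1)[OF assms(1)]] by blast
    then obtain P where P: "fat P" "s \<notin> P" using fat_avoiding_point by blast
    have eq: "X - reach P {s} = B" using Bmin_hull[OF assms(1) s P] .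
    have "L \<inter> reach P {s} \<noteq> {}" using assms(4) contD(1)[OF assms(2)] eq by blast
    then have "L \<subseteq> reach P {s}" using reach_absorb[OF assms(2)] sL by blast
    then show False using assms(3) eq by blast
  qed
qed

text \<open>If a nonblocker \<open>A\<close> were a proper subset of \<open>B\<close>, a point of
  \<open>B - A\<close> could leave \<open>B\<close> along a continuum off \<open>A\<close>. By
  terminality this continuum contains \<open>B\<close> and hence \<open>A\<close>.\<close>

lemma terminal_Bmin:
  assumes "B \<in> nonblockers X" "\<And>L. cont L \<Longrightarrow> L \<inter> B \<noteq> {} \<Longrightarrow> \<not> L \<subseteq> B \<Longrightarrow> B \<subseteq> L"
  shows "B \<in> Bmin"
proof -
  have "A = B" if A: "A \<in> nonblockers X" "A \<subseteq> B" for A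
  proof (rule ccontr)
    assume "A \<noteq> B"
    then obtain r where r: "r \<in> B" "r \<notin> A" using A(2) by blast
    have "- B \<inter> X \<noteq> {}" using NBD(1,5)[OF assms(1)] by blast
    moreover have "open (- B)" using NBD(4)[OF assms(1)] by auto
    ultimately obtain L where L: "cont L" "r \<in> L" "L \<inter> A = {}" "L \<inter> - B \<noteq> {}"
      using NB_reach[OF A(1), of r "- B"] r NBD(1)[OF assms(1)] by blast
    then have "B \<subseteq> L" using assms(2)[OF L(1)] r by blast
    then show False using A L(3) NBD(2)[OF A(1)] by blast
  qed
  then show ?thesis unfolding Bmin_def using assms(1) by blast
qed

text \<open>Terminality is what passes to the limit. Kelley continua \<open>M n\<close> converging
  to \<open>L\<close> pass through points of \<open>B n\<close> and, for large \<open>n\<close>,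
  also contain a point outside \<open>B n\<close>. Hence they contain \<open>B n\<close>, and so
  \<open>L\<close> contains the limit.\<close>

lemma Bmin_closed:
  assumes "\<And>n. B n \<in> Bmin" "hlim B A" "A \<in> nonblockers X"
  shows "A \<in> Bmin"
proof (rule terminal_Bmin[OF assms(3)])
  fix L assume L: "cont L" "L \<inter> A \<noteq> {}" "\<not> L \<subseteq> A"
  note nb = BminD(1)[OF assms(1)]
  have ne: "B n \<noteq> {}" for n using NBD(2)[OF nb] .
  obtain b where b: "b \<in> A" "b \<in> L" using L(2) by blast
  obtain y where y: "y \<in> L" "y \<notin> A" using L(3) by blast
  obtain bs where bs: "\<forall>n. bs n \<in> B n" "bs \<longlonglongrightarrow> b" using hlim_lower[OF assms(2) b(1) ne] by blast
  have "bs n \<in> X" for n using bs(1) NBD(1)[OF nb[of n]] by blast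
  from kelley[OF this bs(2) contD(1,3,4)[OF L(1)] b(2)] obtain M where
    M: "\<forall>n. M n \<subseteq> X \<and> compact (M n) \<and> connected (M n) \<and> bs n \<in> M n" "hlim M L" by (elim exE conjE)
  have cM: "cont (M n)" for n unfolding cont_def using M(1) by blast
  have "M n \<noteq> {}" for n using contD(2)[OF cM] .
  then obtain ys where ys: "\<forall>n. ys n \<in> M n" "ys \<longlonglongrightarrow> y" using hlim_lower[OF M(2) y(1)] by blast
  have "open (- A)" using NBD(4)[OF assms(3)] by auto
  then obtain d where d: "d > 0" "cball y d \<subseteq> - A" using y(2) open_contains_cball by blast
  have "A \<inter> cball y d = {}" using d by blast
  then obtain N1 where N1: "\<forall>n\<ge>N1. B n \<inter> cball y d = {}"
    using hlim_avoid[OF assms(2) NBD(3)[OF assms(3)] closed_cball] by blast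
  obtain N2 where N2: "\<forall>n\<ge>N2. ys n \<in> ball y d"
    using LIMSEQ_eventually_in[OF ys(2) open_ball, of y d] d(1) by auto
  define N where "N = max N1 N2"
  have BM: "B n \<subseteq> M n" if n: "n \<ge> N" for n
  proof -
    have "ys n \<in> cball y d" using N2 n ball_subset_cball unfolding N_def by fastforce
    moreover have "B n \<inter> cball y d = {}" using N1 n unfolding N_def by simp
    ultimately have "\<not> M n \<subseteq> B n" using ys(1) by blast
    moreover have "M n \<inter> B n \<noteq> {}" using bs(1) M(1) by blast
    ultimately show ?thesis using Bmin_terminal[OF assms(1) cM] by blast
  qed
  show "A \<subseteq> L"
  proof
    fix c assume "c \<in> A"
    then obtain cs where cs: "\<forall>n. cs n \<in> B n" "cs \<longlonglongrightarrow> c" using hlim_lower[OF assms(2) _ ne] by blast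
    have "cs (n + N) \<in> M (n + N)" for n using BM[of "n + N"] cs(1) by auto
    moreover have "(\<lambda>n. cs (n + N)) \<longlonglongrightarrow> c" using cs(2) by (rule LIMSEQ_ignore_initial_segment)
    ultimately show "c \<in> L"
      using hlim_upper[OF hlim_subseq[OF M(2) strict_mono_add[of N]] contD(5)[OF L(1)], of "\<lambda>n. cs (n + N)" c] by blast
  qed
qed

lemma Bmin_seq:
  assumes "\<And>n::nat. B n \<in> Bmin"
  shows "\<exists>C r. C \<in> Bmin \<and> strict_mono (r::nat\<Rightarrow>nat) \<and> hlim (\<lambda>n. B (r n)) C"
proof -
  from nb_compact[of B, OF BminD(1)[OF assms]] obtain C r where
    C: "C \<in> nonblockers X" "strict_mono r" "hlim (\<lambda>n. B (r n)) C" by (elim exE conjE)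
  then show ?thesis using Bmin_closed[OF assms C(3,1)] by blast
qed

text \<open>In a separation of \<open>B\<close> into \<open>C\<close> and \<open>D\<close>, a
  continuum from \<open>r\<close> in \<open>D\<close> towards \<open>C\<close> leaves
  \<open>B\<close> before it reaches \<open>C\<close>. It misses a point \<open>s\<close> of
  \<open>C\<close>, and \<open>X - B\<close> is \<open>reach P {s}\<close>, so it would lie entirely
  off \<open>B\<close> although it contains \<open>r\<close>.\<close>

lemma Bmin_cont:
  assumes "B \<in> Bmin"
  shows "cont B"
proof -
  note nb = BminD(1)[OF assms]
  have "connected B"
  proof (rule ccontr)
    assume "\<not> connected B"
    then obtain C D where CD: "closed C" "closed D" "C \<noteq> {}" "D \<noteq> {}" "C \<union> D = B" "C \<inter> D = {}"
      unfolding connected_closed_set[OF NBD(4)[OF nb]] by blast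
    obtain s where s: "s \<in> C" using CD(3) by blast
    obtain r where r: "r \<in> D" using CD(4) by blast
    have sB: "s \<in> B" "s \<in> X" "r \<in> X" using s r CD(5) NBD(1)[OF nb] by blast+
    obtain P where P: "fat P" "s \<notin> P" using fat_avoiding_point[OF sB(2)] by blast
    have eq: "X - reach P {s} = B" using Bmin_hull[OF assms sB(1) P] .
    have "compact D" using CD(2,5) NBD(1)[OF nb] by (intro compact_closed_subset) auto
    moreover have "D \<inter> C = {}" using CD(6) by blast
    ultimately obtain d where d: "d > 0" "\<forall>x\<in>D. \<forall>y\<in>C. d \<le> dist x y"
      using dist_pos_compact_closed[OF _ CD(1)] by blast
    have "X \<inter> C \<noteq> {}" "r \<notin> C" using sB s r CD(6) by blast+
    from boundary_bumping_near[OF cpt conn sB(3) CD(1) this d(1)]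
    obtain J w where J: "compact J" "connected J" "J \<subseteq> X" "r \<in> J" "J \<inter> C = {}" "w \<in> J" "infdist w C < d"
      by (elim exE conjE)
    have cJ: "cont J" unfolding cont_def using J by blast
    have "d \<le> infdist x C" if "x \<in> D" for x
      unfolding infdist_notempty[OF CD(3)] using d(2) that CD(3) by (intro cINF_greatest) auto
    then have "w \<notin> D" using J(7) by fastforce
    then have "w \<notin> B" using J(5,6) CD(5) by blast
    then have "w \<in> reach P {s}" using eq J(3,6) by blast
    moreover have "J \<inter> {s} = {}" using J(5) s by blast
    ultimately have "J \<subseteq> reach P {s}" using reach_absorb[OF cJ] J(6) by blast
    then show False using J(4) r CD(5) eq by blast
  qed
  then show ?thesis unfolding cont_def using NBD[OF nb] by blast
qed

lemma Bmin_disjoint: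
  assumes "B \<in> Bmin" "C \<in> Bmin" "B \<inter> C \<noteq> {}"
  shows "B = C"
proof (cases "B \<subseteq> C")
  case True
  then show ?thesis using BminD assms by blast
next
  case False
  then have "C \<subseteq> B" using Bmin_terminal[OF assms(2) Bmin_cont[OF assms(1)] assms(3)] by blast
  then show ?thesis using BminD assms by blast
qed

text \<open>Lower semicontinuity of the passage from a nonblocker to the minimal ones inside it. It
  supplies the openness half of the clopen argument for the union of the minimal
  nonblockers.\<close>

lemma Bmin_lower:
  assumes "B \<in> Bmin" "B \<subseteq> A" "\<And>n. As n \<in> nonblockers X" "hlim As A"
  shows "\<exists>r C. strict_mono (r::nat\<Rightarrow>nat) \<and> (\<forall>n. C n \<in> Bmin \<and> C n \<subseteq> As (r n)) \<and> hlim C B"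
proof -
  obtain b where b: "b \<in> B" using NBD(2)[OF BminD(1)[OF assms(1)]] by blast
  then have "b \<in> X" using NBD(1)[OF BminD(1)[OF assms(1)]] by blast
  then obtain P where P: "fat P" "b \<notin> P" using fat_avoiding_point by blast
  have ne: "As n \<noteq> {}" for n using NBD(2)[OF assms(3)] .
  have "b \<in> A" using b assms(2) by blast
  from hlim_lower[OF assms(4) this ne] obtain a where a: "\<forall>n. a n \<in> As n" "a \<longlonglongrightarrow> b" by blast
  have "open (- P)" using contD(5)[OF fat_cont[OF P(1)]] by auto
  then obtain N where N: "\<forall>n\<ge>N. a n \<in> - P" using LIMSEQ_eventually_in[OF a(2)] P(2) by blast
  have "\<exists>D\<in>Bmin. D \<subseteq> X - reach P {a (n + N)} \<and> D \<subseteq> As (n + N)" for n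
  proof -
    have aP: "a (n + N) \<notin> P" using N by simp
    have "a (n + N) \<in> X - P" using aP a(1) NBD(1)[OF assms(3)] by blast
    from exists_Bmin[OF P(1) this] obtain D where D: "D \<in> Bmin" "D \<subseteq> X - reach P {a (n + N)}" by blast
    moreover have "X - reach P {a (n + N)} \<subseteq> As (n + N)"
      using hull_point(2)[OF assms(3) _ P(1) aP] a(1) by blast
    ultimately show ?thesis by blast
  qed
  then obtain D where D: "\<And>n. D n \<in> Bmin" "\<And>n. D n \<subseteq> X - reach P {a (n + N)}" "\<And>n. D n \<subseteq> As (n + N)"
    by metis
  from Bmin_seq[of D, OF D(1)] obtain B' s where B': "B' \<in> Bmin" "strict_mono s" "hlim (\<lambda>n. D (s n)) B'"
    by (elim exE conjE)
  \<comment> \<open>Otherwise a point \<open>r\<close> of \<open>B'\<close> has a continuum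
    neighbourhood \<open>R\<close> containing \<open>P\<close> and missing \<open>b\<close>. For
    late indices \<open>R\<close> also misses the point of the sequence \<open>a\<close> near
    \<open>b\<close> but meets the chosen minimal set, which was to lie outside the points reaching
    \<open>P\<close>.\<close>
  have "B' = B"
  proof (rule ccontr)
    assume "B' \<noteq> B"
    then have dis: "B' \<inter> B = {}" using Bmin_disjoint[OF B'(1) assms(1)] by blast
    obtain r where r: "r \<in> B'" using NBD(2)[OF BminD(1)[OF B'(1)]] by blast
    have rok: "r \<in> reach P {b}"
      using r dis Bmin_hull[OF assms(1) b P] NBD(1)[OF BminD(1)[OF B'(1)]] by blast
    have Pb: "P \<inter> {b} = {}" using P(2) by blast
    from reach_nbhd[OF P(1) closed_singleton Pb rok] obtain R d where
      R: "cont R" "P \<subseteq> R" "R \<inter> {b} = {}" "0 < d" "ball r d \<inter> X \<subseteq> R" by (elim exE conjE)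
    have ne': "D (s n) \<noteq> {}" for n using NBD(2)[OF BminD(1)[OF D(1)]] .
    obtain rs where rs: "\<forall>n. rs n \<in> D (s n)" "rs \<longlonglongrightarrow> r" using hlim_lower[OF B'(3) r ne'] by blast
    obtain N1 where N1: "\<forall>n\<ge>N1. rs n \<in> ball r d"
      using LIMSEQ_eventually_in[OF rs(2) open_ball, of r d] R(4) by auto
    have "open (- R)" "b \<in> - R" using contD(5)[OF R(1)] R(3) by auto
    then obtain N2 where N2: "\<forall>n\<ge>N2. a n \<in> - R" using LIMSEQ_eventually_in[OF a(2)] by blast
    define n where "n = max N1 N2"
    have "s n \<ge> n" using seq_suble[OF B'(2)] .
    then have "s n + N \<ge> N2" unfolding n_def by simp
    then have aR: "a (s n + N) \<notin> R" using N2 by blast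
    have rsX: "rs n \<in> X" using rs(1) NBD(1)[OF BminD(1)[OF D(1)]] by blast
    have "rs n \<in> ball r d" using N1 unfolding n_def by simp
    then have "rs n \<in> R" using R(5) rsX by blast
    then have "rs n \<in> reach P {a (s n + N)}"
      using reachI[OF R(1), of "rs n" P "{a (s n + N)}"] R(2) aR contD(2)[OF fat_cont[OF P(1)]] by blast
    then show False using rs(1) D(2)[of "s n"] by blast
  qed
  then have "hlim (\<lambda>n. D (s n)) B" using B'(3) by simp
  moreover have "strict_mono (\<lambda>n. s n + N)" using B'(2) by (simp add: strict_mono_def)
  moreover have "\<forall>n. D (s n) \<in> Bmin \<and> D (s n) \<subseteq> As (s n + N)" using D by blast
  ultimately show ?thesis by (intro exI[of _ "\<lambda>n. s n + N"] exI[of _ "\<lambda>n. D (s n)"] conjI)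
qed

end

lemma connected_from_point:
  assumes "\<forall>v\<in>R. \<exists>M. connected M \<and> p \<in> M \<and> v \<in> M \<and> M \<subseteq> R"
  shows "connected R"
proof -
  have "R \<subseteq> \<Union>{M. connected M \<and> p \<in> M \<and> M \<subseteq> R}"
  proof
    fix v assume "v \<in> R"
    with assms obtain M where "connected M" "p \<in> M" "v \<in> M" "M \<subseteq> R" by blast
    then show "v \<in> \<Union>{M. connected M \<and> p \<in> M \<and> M \<subseteq> R}" by (intro UnionI[of M]) simp_all
  qed
  moreover have "\<Union>{M. connected M \<and> p \<in> M \<and> M \<subseteq> R} \<subseteq> R" by (rule Union_least) simp
  ultimately have eq: "\<Union>{M. connected M \<and> p \<in> M \<and> M \<subseteq> R} = R" by (rule equalityI[rotated])
  have "connected (\<Union>{M. connected M \<and> p \<in> M \<and> M \<subseteq> R})" by (rule connected_Union) auto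
  then show ?thesis unfolding eq .
qed

section \<open>The minimal nonblockers cover the continuum\<close>

context kelley_nonblockers
begin

definition Bmin_union :: "'a set" where "Bmin_union = \<Union>Bmin"

lemma Bmin_union_sub: "Bmin_union \<subseteq> X" unfolding Bmin_union_def using NBD(1)[OF BminD(1)] by blast

lemma Bmin_union_closed: "closed Bmin_union"
  unfolding closed_sequential_limits
proof (intro allI impI, elim conjE)
  fix y l assume y: "\<forall>n. y n \<in> Bmin_union" "y \<longlonglongrightarrow> l"
  then have "\<forall>n. \<exists>B\<in>Bmin. y n \<in> B" unfolding Bmin_union_def by blast
  then obtain B where B: "\<And>n. B n \<in> Bmin" "\<And>n. y n \<in> B n" by metis
  from Bmin_seq[of B, OF B(1)] obtain C r where C: "C \<in> Bmin" "strict_mono r" "hlim (\<lambda>n. B (r n)) C"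
    by (elim exE conjE)
  have "(\<lambda>n. y (r n)) \<longlonglongrightarrow> l" using LIMSEQ_subseq_LIMSEQ[OF y(2) C(2)] by (simp add: o_def)
  from hlim_upper[OF C(3) NBD(4)[OF BminD(1)[OF C(1)]] B(2) this] have "l \<in> C" .
  then show "l \<in> Bmin_union" unfolding Bmin_union_def using C(1) by blast
qed

lemma Bmin_union_nonempty: "Bmin_union \<noteq> {}"
proof -
  obtain P where P: "fat P" "P \<noteq> X" using exists_fat_proper by blast
  then obtain a where "a \<in> X - P" using contD(1)[OF fat_cont[OF P(1)]] by blast
  then obtain B where B: "B \<in> Bmin" using exists_Bmin[OF P(1)] by blast
  then obtain b where "b \<in> B" using NBD(2)[OF BminD(1)[OF B]] by blast
  then show ?thesis unfolding Bmin_union_def using B by blast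
qed

text \<open>In a separation into \<open>C\<close> and \<open>D\<close>, each minimal nonblocker lies
  on one side. The nonblockers containing a minimal one inside \<open>C\<close> form a closed set
  because minimal nonblockers have convergent subsequences, and an open set by lower semicontinuity.
  So they are all nonblockers, which fails for a minimal one inside \<open>D\<close>.\<close>

lemma Bmin_union_connected: "connected Bmin_union"
proof (rule ccontr)
  assume "\<not> connected Bmin_union"
  then have "\<exists>C D. closed C \<and> closed D \<and> C \<noteq> {} \<and> D \<noteq> {} \<and> C \<union> D = Bmin_union \<and> C \<inter> D = {}"
    unfolding connected_closed_set[OF Bmin_union_closed] not_not .
  then obtain C D where CD: "closed C" "closed D" "C \<noteq> {}" "D \<noteq> {}" "C \<union> D = Bmin_union" "C \<inter> D = {}"
    by (elim exE conjE)
  have split: "B \<subseteq> C \<or> B \<subseteq> D" if B: "B \<in> Bmin" for B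
  proof -
    have BY: "B \<subseteq> C \<union> D" using B CD(5) unfolding Bmin_union_def by blast
    have "C \<inter> D \<inter> B = {}" using CD(6) by blast
    from connected_closedD[OF contD(4)[OF Bmin_cont[OF B]] this BY CD(1,2)] BY show ?thesis by blast
  qed
  define S where "S = {A \<in> nonblockers X. \<exists>B\<in>Bmin. B \<subseteq> A \<and> B \<subseteq> C}"
  have "S = nonblockers X"
  proof (rule nb_connected)
    show "S \<subseteq> nonblockers X" unfolding S_def by blast
    obtain c where "c \<in> C" using CD(3) by blast
    then obtain B where B: "B \<in> Bmin" "c \<in> B" using CD(5) unfolding Bmin_union_def by blast
    then have "B \<subseteq> C" using split[OF B(1)] \<open>c \<in> C\<close> CD(6) by blast
    then have "B \<in> S" unfolding S_def using B BminD(1) by blast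
    then show "S \<noteq> {}" by blast
  next
    fix As A assume A: "\<And>n::nat. As n \<in> S" "A \<in> nonblockers X" "hlim As A"
    have "\<exists>B. B \<in> Bmin \<and> B \<subseteq> As n \<and> B \<subseteq> C" for n using A(1)[of n] unfolding S_def by blast
    then obtain B where B: "\<And>n. B n \<in> Bmin" "\<And>n. B n \<subseteq> As n" "\<And>n. B n \<subseteq> C" by metis
    from Bmin_seq[of B, OF B(1)] obtain E r where E: "E \<in> Bmin" "strict_mono r" "hlim (\<lambda>n. B (r n)) E"
      by (elim exE conjE)
    have "E \<subseteq> A \<and> E \<subseteq> C"
    proof (intro conjI subsetI)
      fix e assume "e \<in> E"
      moreover have "B (r n) \<noteq> {}" for n using NBD(2)[OF BminD(1)[OF B(1)]] .
      ultimately have "\<exists>es. (\<forall>n. es n \<in> B (r n)) \<and> es \<longlonglongrightarrow> e" by (rule hlim_lower[OF E(3)])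
      then obtain es where es: "\<forall>n. es n \<in> B (r n)" "es \<longlonglongrightarrow> e" by (elim exE conjE)
      have esA: "es n \<in> As (r n)" and esC: "es n \<in> C" for n using es(1) B(2,3) by blast+
      show "e \<in> A" by (rule hlim_upper[OF hlim_subseq[OF A(3) E(2)] NBD(4)[OF A(2)] esA es(2)])
      show "e \<in> C" by (rule closed_sequentially[OF CD(1) esC es(2)])
    qed
    then show "A \<in> S" unfolding S_def using A(2) E(1) by blast
  next
    fix As A assume A: "\<And>n::nat. As n \<in> nonblockers X - S" "A \<in> nonblockers X" "hlim As A"
    show "A \<notin> S"
    proof
      assume "A \<in> S"
      then obtain B where B: "B \<in> Bmin" "B \<subseteq> A" "B \<subseteq> C" unfolding S_def by blast
      have "As n \<in> nonblockers X" for n using A(1) by blast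
      from Bmin_lower[OF B(1,2) this A(3)] obtain r E where
        E: "strict_mono r" "\<forall>n. E n \<in> Bmin \<and> E n \<subseteq> As (r n)" "hlim E B" by (elim exE conjE)
      have "E n \<subseteq> D" for n
        using split[of "E n"] E(2) A(1)[of "r n"] unfolding S_def by blast
      note ED = this
      obtain b where b: "b \<in> B" using NBD(2)[OF BminD(1)[OF B(1)]] by blast
      have "E n \<noteq> {}" for n using NBD(2)[OF BminD(1)] E(2) by blast
      from hlim_lower[OF E(3) b this] obtain es where es: "\<forall>n. es n \<in> E n" "es \<longlonglongrightarrow> b" by (elim exE conjE)
      have "es n \<in> D" for n using es(1) ED[of n] by blast
      from closed_sequentially[OF CD(2) this es(2)] have "b \<in> D" .
      then show False using b B(3) CD(6) by blast
    qed
  qed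
  moreover obtain e where "e \<in> D" using CD(4) by blast
  then obtain B where B: "B \<in> Bmin" "e \<in> B" using CD(5) unfolding Bmin_union_def by blast
  ultimately have "B \<in> S" using BminD(1) by blast
  then obtain B' where "B' \<in> Bmin" "B' \<subseteq> B" "B' \<subseteq> C" unfolding S_def by blast
  then have "B \<subseteq> C" using BminD[OF B(1)] BminD(1) by blast
  then show False using B(2) \<open>e \<in> D\<close> CD(6) by blast
qed

lemma Bmin_union_cont: "cont Bmin_union"
  unfolding cont_def using Bmin_union_sub Bmin_union_nonempty Bmin_union_connected compact_closed_subset[OF Bmin_union_closed Bmin_union_sub] by (intro conjI)

text \<open>Cutting \<open>Z\<close> between \<open>T\<close> and the points at distance at least
  \<open>1 / real (Suc n)\<close> from it gives a far piece \<open>F\<close>. Then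
  \<open>P \<union> F\<close> is a fat continuum omitting \<open>t\<close>, and a minimal nonblocker
  disjoint from it is trapped near \<open>T\<close>. A limit of such sets lies in
  \<open>T\<close>.\<close>

lemma Bmin_in_component:
  assumes "fat P" "T \<in> components (closure (X - P))" "t \<in> T" "t \<notin> P"
  shows "\<exists>B\<in>Bmin. B \<subseteq> T"
proof -
  note P = fat_cont[OF assms(1)]
  define Z where "Z = closure (X - P)"
  have ZX: "Z \<subseteq> X" unfolding Z_def using closedX by (simp add: closure_minimal)
  have cZ: "compact Z" using ZX unfolding Z_def by (intro compact_closed_subset) auto
  have TZ: "T \<in> components Z" using assms(2) unfolding Z_def .
  have T: "cont T" using cont_component[OF cZ ZX TZ] .
  have "\<exists>B. B \<in> Bmin \<and> (\<forall>b\<in>B. infdist b T < 1 / real (Suc n))" for n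
  proof -
    define T' where "T' = Z \<inter> {y. 1 / real (Suc n) \<le> infdist y T}"
    have "closed {y. 1 / real (Suc n) \<le> infdist y T}" by (intro closed_Collect_le continuous_intros)
    then have clT': "closed T'" unfolding T'_def using compact_imp_closed[OF cZ] by (rule closed_Int[rotated])
    have dis: "\<forall>C. connected C \<and> C \<subseteq> Z \<longrightarrow> C \<inter> T = {} \<or> C \<inter> T' = {}"
    proof (intro allI impI, elim conjE)
      fix C assume C: "connected C" "C \<subseteq> Z"
      show "C \<inter> T = {} \<or> C \<inter> T' = {}"
      proof (cases "C \<inter> T = {}")
        case False
        then have "C \<subseteq> T" using components_maximal[OF TZ C] by blast
        have "C \<inter> T' = {}"
        proof (rule ccontr)
          assume "C \<inter> T' \<noteq> {}"
          then obtain y where y: "y \<in> C" "y \<in> T'" by blast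
          then have "infdist y T = 0" using \<open>C \<subseteq> T\<close> by (intro infdist_zero) blast
          then show False using y(2) unfolding T'_def by simp
        qed
        then show ?thesis by simp
      qed simp
    qed
    have sub: "T \<subseteq> Z" "T' \<subseteq> Z" using in_components_subset[OF TZ] unfolding T'_def by blast+
    from cut_wire_metric[OF cZ contD(5)[OF T] clT' sub dis]
    obtain E F where EF: "closed E" "closed F" "E \<inter> F = {}" "E \<union> F = Z" "T \<subseteq> E" "T' \<subseteq> F"
      by (elim exE conjE)
    define R where "R = P \<union> F"
    have RX: "R \<subseteq> X" unfolding R_def using contD(1)[OF P] EF(4) ZX by blast
    have "closed R" unfolding R_def using contD(5)[OF P] EF(2) by (rule closed_Un)
    then have cR: "compact R" using RX by (rule compact_closed_subset)
    obtain p where p: "p \<in> P" using contD(2)[OF P] by blast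
    \<comment> \<open>A point of \<open>F\<close> is joined to \<open>P\<close> by a continuum
      inside \<open>Z\<close>. Since \<open>E\<close> and \<open>F\<close> are separated, this
      continuum stays in \<open>F\<close>, so \<open>P \<union> F\<close> is connected.\<close>
    have "\<exists>M. connected M \<and> p \<in> M \<and> v \<in> M \<and> M \<subseteq> R" if v: "v \<in> R" for v
    proof (cases "v \<in> P")
      case True
      then show ?thesis using contD(4)[OF P] p unfolding R_def by (intro exI[of _ P]) blast
    next
      case False
      then have vF: "v \<in> F" using v unfolding R_def by blast
      then have "v \<in> closure (X - P)" using EF(4) Z_def by blast
      from joins_boundary[OF P this]
      obtain M where M: "cont M" "v \<in> M" "M \<subseteq> closure (X - P)" "M \<inter> P \<noteq> {}" by (elim exE conjE)
      have ME: "M \<subseteq> E \<union> F" using M(3) EF(4) Z_def by simp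
      have "E \<inter> F \<inter> M = {}" using EF(3) by blast
      from connected_closedD[OF contD(4)[OF M(1)] this ME EF(1,2)]
      have "M \<subseteq> F" using ME M(2) vF by blast
      moreover have "connected (P \<union> M)"
        using contD(4)[OF P] contD(4)[OF M(1)] M(4) by (intro connected_Un) blast+
      ultimately show ?thesis using p M(2) unfolding R_def by (intro exI[of _ "P \<union> M"]) blast
    qed
    then have "\<forall>v\<in>R. \<exists>M. connected M \<and> p \<in> M \<and> v \<in> M \<and> M \<subseteq> R" by blast
    from connected_from_point[OF this] have "connected R" .
    moreover have "p \<in> R" unfolding R_def using p by blast
    ultimately have contR: "cont R" using contI[OF RX _ cR] by blast
    have fR: "fat R" using fat_mono[OF assms(1) _ contR] unfolding R_def by blast
    have "t \<in> X - R" using assms(3,4) EF(3,5) sub(1) ZX unfolding R_def by blast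
    from exists_Bmin[OF fR this] obtain B where B: "B \<in> Bmin" "B \<inter> R = {}" by blast
    have "infdist b T < 1 / real (Suc n)" if b: "b \<in> B" for b
    proof (rule ccontr)
      assume neg: "\<not> ?thesis"
      have "b \<in> X" "b \<notin> P" "b \<notin> F" using b B NBD(1)[OF BminD(1)[OF B(1)]] unfolding R_def by blast+
      then have "b \<in> Z" unfolding Z_def using closure_subset[of "X - P"] by blast
      then have "b \<in> T'" unfolding T'_def using neg by simp
      then show False using EF(6) \<open>b \<notin> F\<close> by blast
    qed
    then show ?thesis using B(1) by blast
  qed
  then obtain B where B: "\<And>n. B n \<in> Bmin" "\<And>n. \<forall>b\<in>B n. infdist b T < 1 / real (Suc n)" by metis
  from Bmin_seq[of B, OF B(1)] obtain C r where C: "C \<in> Bmin" "strict_mono r" "hlim (\<lambda>n. B (r n)) C"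
    by (elim exE conjE)
  have "C \<subseteq> T"
  proof
    fix c assume c: "c \<in> C"
    have "B (r n) \<noteq> {}" for n using NBD(2)[OF BminD(1)[OF B(1)]] .
    from hlim_lower[OF C(3) c this] obtain cs where cs: "\<forall>n. cs n \<in> B (r n)" "cs \<longlonglongrightarrow> c" by (elim exE conjE)
    have "infdist c T \<le> 1 / real (Suc m)" for m
    proof -
      have "closed {y. infdist y T \<le> 1 / real (Suc m)}" by (intro closed_Collect_le continuous_intros)
      moreover have "cs (n + m) \<in> {y. infdist y T \<le> 1 / real (Suc m)}" for n
      proof -
        have "infdist (cs (n + m)) T < 1 / real (Suc (r (n + m)))" using B(2) cs(1) by blast
        moreover have "r (n + m) \<ge> m" using seq_suble[OF C(2), of "n + m"] by simp
        then have "1 / real (Suc (r (n + m))) \<le> 1 / real (Suc m)" by (intro frac_le) auto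
        ultimately show ?thesis by simp
      qed
      moreover have "(\<lambda>n. cs (n + m)) \<longlonglongrightarrow> c" using cs(2) by (rule LIMSEQ_ignore_initial_segment)
      ultimately have "c \<in> {y. infdist y T \<le> 1 / real (Suc m)}" by (rule closed_sequentially)
      then show ?thesis by simp
    qed
    have "infdist c T = 0"
    proof (rule ccontr)
      assume "infdist c T \<noteq> 0"
      then have "infdist c T > 0" using infdist_nonneg[of c T] by simp
      then obtain m where "1 / real (Suc m) < infdist c T" by (rule nat_approx_posE)
      then show False using \<open>\<And>m. infdist c T \<le> 1 / real (Suc m)\<close>[of m] by simp
    qed
    then show "c \<in> T" using in_closed_iff_infdist_zero[OF contD(5)[OF T] contD(2)[OF T]] by blast
  qed
  then show ?thesis using C(1) by blast
qed

lemma Bmin_proper: "B \<in> Bmin \<Longrightarrow> B \<noteq> X" using NBD(5) BminD(1) by blast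

text \<open>For \<open>p\<close> outside the union there is a fat continuum \<open>T\<close> that
  misses \<open>p\<close> but contains a minimal nonblocker. The union is then a continuum off
  \<open>p\<close> meeting \<open>T\<close>, so it lies in \<open>reach T {p}\<close>. But some
  minimal nonblocker lies in the complement of \<open>reach T {p}\<close>.\<close>

lemma Bmin_union_eq_X: "Bmin_union = X"
proof (rule ccontr)
  assume "Bmin_union \<noteq> X"
  then obtain p where p: "p \<in> X" "p \<notin> Bmin_union" using Bmin_union_sub by blast
  obtain B where B: "B \<in> Bmin" using Bmin_union_nonempty unfolding Bmin_union_def by blast
  obtain b where b: "b \<in> B" using NBD(2)[OF BminD(1)[OF B]] by blast
  have bX: "b \<in> X" using b NBD(1)[OF BminD(1)[OF B]] by blast
  obtain P where P: "fat P" "b \<notin> P" using fat_avoiding_point[OF bX] by blast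
  have Pb: "P \<inter> {b} = {}" using P(2) by blast
  have "p \<notin> B" using p(2) B unfolding Bmin_union_def by blast
  then have "p \<in> reach P {b}" using Bmin_hull[OF B b P] p(1) by blast
  from reach_nbhd[OF P(1) closed_singleton Pb this]
  obtain R d where R: "cont R" "P \<subseteq> R" "R \<inter> {b} = {}" "0 < d" "ball p d \<inter> X \<subseteq> R" by (elim exE conjE)
  have fR: "fat R" using fat_mono[OF P(1) R(2,1)] .
  have opR: "open (- R)" using contD(5)[OF R(1)] by auto
  have "- R \<inter> X \<noteq> {}" "- R \<inter> X \<inter> R = {}" using bX R(3) by blast+
  from fat_component[OF fR opR this] obtain T where
    T: "T \<in> components (closure (X - R))" "fat T" "T \<inter> - R \<noteq> {}" by blast
  have "T \<subseteq> closure (X - R)" using in_components_subset[OF T(1)] .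
  moreover have "X - R \<subseteq> - ball p d" using R(5) by blast
  then have "closure (X - R) \<subseteq> - ball p d" by (intro closure_minimal) (auto simp: closed_Compl)
  ultimately have pT: "p \<notin> T" using R(4) by auto
  obtain t where "t \<in> T" "t \<notin> R" using T(3) by blast
  from Bmin_in_component[OF fR T(1) this] obtain C where C: "C \<in> Bmin" "C \<subseteq> T" by blast
  have Tp: "T \<inter> {p} = {}" using pT by blast
  have TY: "Bmin_union \<inter> T \<noteq> {}" using C NBD(2)[OF BminD(1)[OF C(1)]] unfolding Bmin_union_def by blast
  have "Bmin_union \<inter> {p} = {}" using p(2) by blast
  then have YW: "Bmin_union \<subseteq> reach T {p}" using reachI[OF Bmin_union_cont _ TY] by blast
  have avoid: False if "B' \<in> Bmin" "B' \<inter> Bmin_union = {}" for B'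
    using that NBD(2)[OF BminD(1)[OF that(1)]] unfolding Bmin_union_def by blast
  have "p \<in> X - T" using p pT by blast
  from exists_Bmin[OF T(2) this] obtain B' where B': "B' \<in> Bmin" "B' \<subseteq> X - reach T {p}" by blast
  then show False using avoid[of B'] YW by blast
qed

section \<open>The continuous decomposition into minimal nonblockers\<close>

definition fibre :: "'a \<Rightarrow> 'a set" where "fibre x = (SOME B. B \<in> Bmin \<and> x \<in> B)"

lemma fibre:
  assumes "x \<in> X"
  shows "fibre x \<in> Bmin" "x \<in> fibre x"
proof -
  have "\<exists>B. B \<in> Bmin \<and> x \<in> B" using assms Bmin_union_eq_X unfolding Bmin_union_def by blast
  from someI_ex[OF this] show "fibre x \<in> Bmin" "x \<in> fibre x" unfolding fibre_def by blast+
qed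

lemma fibre_sub: "x \<in> X \<Longrightarrow> fibre x \<subseteq> X" using NBD(1) BminD(1) fibre(1) by blast

lemma fibre_cont: "x \<in> X \<Longrightarrow> cont (fibre x)" using Bmin_cont fibre(1) by blast

lemma fibre_eq:
  assumes "x \<in> X" "y \<in> fibre x"
  shows "fibre y = fibre x"
proof -
  have "y \<in> X" using assms fibre_sub by blast
  then show ?thesis using Bmin_disjoint[OF fibre(1) fibre(1)[OF assms(1)]] fibre(2) assms(2) by blast
qed

text \<open>A limit of fibres is a minimal nonblocker containing \<open>p\<close>, and disjointness
  identifies it with \<open>fibre p\<close>. A subsequence suffices for proving that conditions on
  fibres are closed.\<close>

lemma fibre_seq:
  assumes "\<And>n::nat. x n \<in> X" "x \<longlonglongrightarrow> p"
  shows "\<exists>r. strict_mono (r::nat\<Rightarrow>nat) \<and> hlim (\<lambda>n. fibre (x (r n))) (fibre p)"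
proof -
  have pX: "p \<in> X" using closed_sequentially[OF closedX assms] .
  from Bmin_seq[of "\<lambda>n. fibre (x n)", OF fibre(1)[OF assms(1)]]
  obtain C r where C: "C \<in> Bmin" "strict_mono r" "hlim (\<lambda>n. fibre (x (r n))) C" by (elim exE conjE)
  have "(\<lambda>n. x (r n)) \<longlonglongrightarrow> p" using LIMSEQ_subseq_LIMSEQ[OF assms(2) C(2)] by (simp add: o_def)
  from hlim_upper[OF C(3) NBD(4)[OF BminD(1)[OF C(1)]] fibre(2)[OF assms(1)] this] have "p \<in> C" .
  then have "C = fibre p" using Bmin_disjoint[OF C(1) fibre(1)[OF pX]] fibre(2)[OF pX] by blast
  then show ?thesis using C by blast
qed

lemma fibre_ne: "x \<in> X \<Longrightarrow> fibre x \<noteq> {}" using contD(2) fibre_cont by blast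

lemma closed_fibre_Collect:
  assumes "\<And>x p r. (\<And>n::nat. x n \<in> X) \<Longrightarrow> (\<And>n. S (fibre (x n))) \<Longrightarrow> p \<in> X \<Longrightarrow> hlim (\<lambda>n. fibre (x n)) (fibre p) \<Longrightarrow> S (fibre p)"
  shows "closed {x\<in>X. S (fibre x)}"
  unfolding closed_sequential_limits
proof (intro allI impI, elim conjE)
  fix x p assume x: "\<forall>n. x n \<in> {x\<in>X. S (fibre x)}" "x \<longlonglongrightarrow> p"
  have xX: "x n \<in> X" and S: "S (fibre (x n))" for n using x(1) by blast+
  have pX: "p \<in> X" using closed_sequentially[OF closedX xX x(2)] .
  from fibre_seq[OF xX x(2)] obtain r where r: "strict_mono r" "hlim (\<lambda>n. fibre (x (r n))) (fibre p)" by (elim exE conjE)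
  have "S (fibre p)" using assms[of "\<lambda>n. x (r n)", OF xX S pX r(2)] .
  then show "p \<in> {x\<in>X. S (fibre x)}" using pX by blast
qed

text \<open>No closed separation of \<open>B - V\<close> splits \<open>B \<inter> U\<close>: this holds when \<open>B\<close> is the union of a
  continuum missing \<open>V\<close> and one missing \<open>U\<close>, and unlike that property it is
  easily seen to pass to limits.\<close>

definition unsplit :: "'a set \<Rightarrow> 'a set \<Rightarrow> 'a set \<Rightarrow> bool" where
  "unsplit U V B \<longleftrightarrow> (\<forall>E F. closed E \<longrightarrow> closed F \<longrightarrow> E \<inter> F = {} \<longrightarrow> B - V \<subseteq> E \<union> F \<longrightarrow>
     B \<inter> U \<subseteq> E \<or> B \<inter> U \<subseteq> F)"

text \<open>By normality a separation that splits the limit is thickened to disjoint open sets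
  \<open>G\<close> and \<open>H\<close>. Eventually \<open>B n\<close> is covered by
  \<open>V\<close>, \<open>G\<close> and \<open>H\<close>, so \<open>B n - V\<close> inherits a
  separation, and it splits points of \<open>B n\<close> near \<open>u\<close> and
  \<open>v\<close>.\<close>

lemma unsplit_limit:
  assumes "open U" "open V" "U \<inter> V = {}" "\<And>n. unsplit U V (B n)" "\<And>n. B n \<noteq> {}" "\<And>n. closed (B n)"
    "hlim B A" "compact A"
  shows "unsplit U V A"
  unfolding unsplit_def
proof (intro allI impI)
  fix E F assume EF: "closed E" "closed F" "E \<inter> F = {}" "A - V \<subseteq> E \<union> F"
  show "A \<inter> U \<subseteq> E \<or> A \<inter> U \<subseteq> F"
  proof (rule ccontr)
    assume "\<not> ?thesis"
    then obtain u v where u: "u \<in> A" "u \<in> U" "u \<notin> E" and v: "v \<in> A" "v \<in> U" "v \<notin> F" by blast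
    have uF: "u \<in> F" and vE: "v \<in> E" using u v EF(4) assms(3) by blast+
    obtain G H where GH: "open G" "open H" "E \<subseteq> G" "F \<subseteq> H" "G \<inter> H = {}"
      using t4_space[OF EF(1,2,3)] by blast
    have "closed (- (V \<union> G \<union> H))" using assms(2) GH by (intro closed_Compl open_Un)
    moreover have "A \<inter> - (V \<union> G \<union> H) = {}" using EF(4) GH(3,4) by blast
    ultimately obtain N where N: "\<forall>n\<ge>N. B n \<inter> - (V \<union> G \<union> H) = {}"
      using hlim_avoid[OF assms(7,8)] by blast
    from hlim_lower[OF assms(7) u(1) assms(5)] obtain us where us: "\<forall>n. us n \<in> B n" "us \<longlonglongrightarrow> u" by (elim exE conjE)
    from hlim_lower[OF assms(7) v(1) assms(5)] obtain vs where vs: "\<forall>n. vs n \<in> B n" "vs \<longlonglongrightarrow> v" by (elim exE conjE)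
    have "open (U \<inter> H)" "u \<in> U \<inter> H" using assms(1) GH u uF by auto
    from LIMSEQ_eventually_in[OF us(2) this] obtain N1 where N1: "\<forall>n\<ge>N1. us n \<in> U \<inter> H" ..
    have "open (U \<inter> G)" "v \<in> U \<inter> G" using assms(1) GH v vE by auto
    from LIMSEQ_eventually_in[OF vs(2) this] obtain N2 where N2: "\<forall>n\<ge>N2. vs n \<in> U \<inter> G" ..
    define n where "n = max N (max N1 N2)"
    have n: "n \<ge> N" "n \<ge> N1" "n \<ge> N2" unfolding n_def by auto
    define E' where "E' = B n - (V \<union> H)"
    define F' where "F' = B n - (V \<union> G)"
    have cl: "closed E'" "closed F'" unfolding E'_def F'_def
      using assms(2,6) GH by (auto intro!: closed_Diff)
    have cov: "B n \<subseteq> V \<union> G \<union> H" using N n(1) by blast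
    have "E' \<inter> F' = {}" "B n - V \<subseteq> E' \<union> F'" unfolding E'_def F'_def using cov GH(5) by blast+
    then have "B n \<inter> U \<subseteq> E' \<or> B n \<inter> U \<subseteq> F'" using assms(4)[of n] cl unfolding unsplit_def by blast
    moreover have "us n \<in> B n \<inter> U" "us n \<notin> E'" using us(1) N1 n unfolding E'_def by blast+
    moreover have "vs n \<in> B n \<inter> U" "vs n \<notin> F'" using vs(1) N2 n unfolding F'_def by blast+
    ultimately show False by blast
  qed
qed

lemma closed_meets_fibre:
  assumes "closed R"
  shows "closed {x\<in>X. fibre x \<inter> R \<noteq> {}}"
proof (rule closed_fibre_Collect)
  fix x p r assume x: "\<And>n::nat. x n \<in> X" "\<And>n. fibre (x n) \<inter> R \<noteq> {}" "p \<in> X" "hlim (\<lambda>n. fibre (x n)) (fibre p)"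
  show "fibre p \<inter> R \<noteq> {}"
  proof
    assume "fibre p \<inter> R = {}"
    from hlim_avoid[OF x(4) contD(3)[OF fibre_cont[OF x(3)]] assms this] show False using x(2) by blast
  qed
qed

lemma closed_fibre_sub:
  assumes "closed R"
  shows "closed {x\<in>X. fibre x \<subseteq> R}"
proof (rule closed_fibre_Collect)
  fix x p r assume x: "\<And>n::nat. x n \<in> X" "\<And>n. fibre (x n) \<subseteq> R" "p \<in> X" "hlim (\<lambda>n. fibre (x n)) (fibre p)"
  show "fibre p \<subseteq> R"
  proof
    fix a assume "a \<in> fibre p"
    from hlim_lower[OF x(4) this fibre_ne[OF x(1)]] obtain as where as: "\<forall>n. as n \<in> fibre (x n)" "as \<longlonglongrightarrow> a"
      by (elim exE conjE)
    have "as n \<in> R" for n using as(1) x(2) by blast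
    from closed_sequentially[OF assms this as(2)] show "a \<in> R" .
  qed
qed

lemma closed_fibre_singleton: "closed {x\<in>X. \<forall>y\<in>fibre x. \<forall>z\<in>fibre x. y = z}"
proof (rule closed_fibre_Collect)
  fix x p r assume x: "\<And>n::nat. x n \<in> X" "\<And>n. \<forall>y\<in>fibre (x n). \<forall>z\<in>fibre (x n). y = z" "p \<in> X"
    "hlim (\<lambda>n. fibre (x n)) (fibre p)"
  show "\<forall>y\<in>fibre p. \<forall>z\<in>fibre p. y = z"
  proof (intro ballI)
    fix y z assume y: "y \<in> fibre p" and z: "z \<in> fibre p"
    from hlim_lower[OF x(4) y fibre_ne[OF x(1)]] obtain ys where ys: "\<forall>n. ys n \<in> fibre (x n)" "ys \<longlonglongrightarrow> y"
      by (elim exE conjE)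
    from hlim_lower[OF x(4) z fibre_ne[OF x(1)]] obtain zs where zs: "\<forall>n. zs n \<in> fibre (x n)" "zs \<longlonglongrightarrow> z"
      by (elim exE conjE)
    have "ys = zs" using ys(1) zs(1) x(2) by blast
    then show "y = z" using ys(2) zs(2) LIMSEQ_unique by blast
  qed
qed

end

section \<open>Singletons are nonblockers\<close>

locale hereditary_kelley = kelley_nonblockers +
  assumes hered: "\<And>K. cont K \<Longrightarrow> \<exists>x\<in>K. \<exists>y\<in>K. x \<noteq> y \<Longrightarrow>
      \<exists>P Q. cont P \<and> cont Q \<and> P \<noteq> K \<and> Q \<noteq> K \<and> K = P \<union> Q"
begin

text \<open>Near a point \<open>c\<close> of \<open>P - Q\<close> the continuum \<open>K\<close>
  coincides with \<open>P\<close>, and \<open>P\<close> misses a neighbourhood of a point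
  \<open>d\<close> of \<open>Q - P\<close>. Connectedness of \<open>P\<close> then keeps
  \<open>K \<inter> U\<close> on one side of any separation of \<open>K - V\<close>.\<close>

lemma decomposable_unsplit:
  assumes "cont P" "cont Q" "P \<noteq> K" "Q \<noteq> K" "K = P \<union> Q"
  shows "\<exists>c d e. c \<in> K \<and> d \<in> K \<and> 0 < e \<and> e \<le> dist c d \<and>
    (\<forall>U V. U \<subseteq> ball c e \<longrightarrow> V \<subseteq> ball d e \<longrightarrow> unsplit U V K)"
proof -
  obtain c where c: "c \<in> P" "c \<notin> Q" using assms by blast
  obtain d where d: "d \<in> Q" "d \<notin> P" using assms by blast
  have "open (- Q)" "c \<in> - Q" using contD(5)[OF assms(2)] c by auto
  then obtain e1 where e1: "e1 > 0" "ball c e1 \<subseteq> - Q" using openE by metis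
  have "open (- P)" "d \<in> - P" using contD(5)[OF assms(1)] d by auto
  then obtain e2 where e2: "e2 > 0" "ball d e2 \<subseteq> - P" using openE by metis
  define e where "e = min e1 e2"
  have e: "e > 0" "e \<le> e1" "e \<le> e2" using e1 e2 unfolding e_def by auto
  have "d \<notin> ball c e1" using e1(2) d(1) by blast
  then have "e \<le> dist c d" using e(2) by simp
  moreover have "unsplit U V K" if UV: "U \<subseteq> ball c e" "V \<subseteq> ball d e" for U V
    unfolding unsplit_def
  proof (intro allI impI)
    fix E F assume EF: "closed E" "closed F" "E \<inter> F = {}" "K - V \<subseteq> E \<union> F"
    have "ball c e \<subseteq> ball c e1" "ball d e \<subseteq> ball d e2" using e by (simp_all add: subset_ball)
    then have "U \<inter> Q = {}" "V \<inter> P = {}" using UV e1(2) e2(2) by blast+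
    then have sub: "P \<subseteq> E \<union> F" "K \<inter> U \<subseteq> P" using EF(4) assms(5) by blast+
    have "E \<inter> F \<inter> P = {}" using EF(3) by blast
    from connected_closedD[OF contD(4)[OF assms(1)] this sub(1) EF(1,2)]
    show "K \<inter> U \<subseteq> E \<or> K \<inter> U \<subseteq> F" using sub by blast
  qed
  ultimately show ?thesis using c d assms(5) e(1) by blast
qed

text \<open>The argument is that of Dyer's theorem on continuous decompositions: by Baire's theorem a
  splitting of the members into two proper subcontinua can be chosen uniformly on an open set, and
  then some continuum crosses several members without containing one of them.\<close>

lemma fibre_eq_singleton:
  assumes "x \<in> X"
  shows "fibre x = {x}"
proof (rule ccontr)
  assume neg: "fibre x \<noteq> {x}"
  define Sng where "Sng = {x\<in>X. \<forall>y\<in>fibre x. \<forall>z\<in>fibre x. y = z}"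
  have clS: "closed Sng" unfolding Sng_def by (rule closed_fibre_singleton)
  have xS: "x \<notin> Sng" unfolding Sng_def using neg fibre(2)[OF assms] by blast
  have "\<exists>N. finite N \<and> N \<subseteq> X \<and> X \<subseteq> (\<Union>f\<in>N. ball f (1 / (2 * real (Suc k))))" for k
    by (rule finite_net[OF cpt]) auto
  then obtain net where net: "\<And>k. finite (net k) \<and> net k \<subseteq> X \<and> X \<subseteq> (\<Union>f\<in>net k. ball f (1 / (2 * real (Suc k))))"
    by metis
  define D where "D = (\<Union>k. net k)"
  have cD: "countable D" unfolding D_def using net by (intro countable_UN) (auto intro: countable_finite)
  \<comment> \<open>The centres will range over a countable dense set and the radii over a sequence,
    so only countably many conditions arise. Closed balls of half the radius make the meeting
    conditions closed, and they still force the open balls to be met.\<close>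
  define Q where "Q a b k = {x\<in>X. unsplit (ball a (1 / real (Suc k))) (ball b (1 / real (Suc k))) (fibre x)} \<inter>
      {x\<in>X. fibre x \<inter> cball a (1 / (2 * real (Suc k))) \<noteq> {}} \<inter>
      {x\<in>X. fibre x \<inter> cball b (1 / (2 * real (Suc k))) \<noteq> {}}" for a b and k :: nat
  define G where "G = {Q a b k | a b k. a \<in> D \<and> b \<in> D \<and> ball a (1 / real (Suc k)) \<inter> ball b (1 / real (Suc k)) = {}}"
  have cG: "countable G"
  proof -
    have "G \<subseteq> (\<lambda>(a,b,k). Q a b k) ` (D \<times> D \<times> UNIV)" unfolding G_def by force
    moreover have "countable ((\<lambda>(a,b,k). Q a b k) ` (D \<times> D \<times> (UNIV::nat set)))"
      using cD by (intro countable_image countable_SIGMA) auto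
    ultimately show ?thesis using countable_subset by blast
  qed
  have cover: "X - Sng \<subseteq> \<Union>G"
  proof
    fix y assume y: "y \<in> X - Sng"
    then have yX: "y \<in> X" by blast
    have "\<exists>u\<in>fibre y. \<exists>v\<in>fibre y. u \<noteq> v" using y unfolding Sng_def by blast
    from hered[OF fibre_cont[OF yX] this] obtain P1 P2 where
      PQ: "cont P1" "cont P2" "P1 \<noteq> fibre y" "P2 \<noteq> fibre y" "fibre y = P1 \<union> P2" by (elim exE conjE)
    from decomposable_unsplit[OF PQ] obtain c d e where
      cd: "c \<in> fibre y" "d \<in> fibre y" "0 < e" "e \<le> dist c d"
        "\<forall>U V. U \<subseteq> ball c e \<longrightarrow> V \<subseteq> ball d e \<longrightarrow> unsplit U V (fibre y)" by (elim exE conjE)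
    \<comment> \<open>Let \<open>q\<close> be \<open>1 / real (Suc k)\<close>. A ball of radius
      \<open>q\<close> whose centre is within \<open>q/2\<close> of \<open>c\<close> lies in
      \<open>ball c (e/2)\<close>, as \<open>3 * q / 2 < e/2\<close>. The balls of radius
      \<open>e/2\<close> about \<open>c\<close> and \<open>d\<close> are disjoint since
      \<open>e \<le> dist c d\<close>.\<close>
    have "e/4 > 0" using cd(3) by simp
    then obtain k where k: "1 / real (Suc k) < e/4" by (rule nat_approx_posE)
    have cX: "c \<in> X" "d \<in> X" using cd fibre_sub[OF yX] by blast+
    obtain a where a: "a \<in> net k" "dist a c < 1 / (2 * real (Suc k))" using net[of k] cX(1) by auto
    obtain b where b: "b \<in> net k" "dist b d < 1 / (2 * real (Suc k))" using net[of k] cX(2) by auto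
    have half: "1 / (2 * real (Suc k)) = (1 / real (Suc k)) / 2" by simp
    have near: "ball a (1 / real (Suc k)) \<subseteq> ball c (e/2)" if "dist a c < 1 / (2 * real (Suc k))" for a c
    proof
      fix z assume "z \<in> ball a (1 / real (Suc k))"
      then have "dist a z < 1 / real (Suc k)" by simp
      moreover have "dist c z \<le> dist a c + dist a z" by (metis dist_commute dist_triangle)
      moreover have "dist a c < (1 / real (Suc k)) / 2" using that by (simp only: half)
      moreover have "t < e/2" if "s < q" "t \<le> u + s" "u < q/2" "q < e/4" "0 < e" for s t u q :: real
        using that by linarith
      ultimately have "dist c z < e/2" using k cd(3) by blast
      then show "z \<in> ball c (e/2)" by simp
    qed
    have dj: "ball c (e/2) \<inter> ball d (e/2) = {}"
    proof (rule ccontr)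
      assume "\<not> ?thesis"
      then obtain z where "dist c z < e/2" "dist d z < e/2" by auto
      then have "dist c d < e" by (metis dist_commute dist_triangle_half_l)
      then show False using cd(4) by simp
    qed
    have sb: "ball c (e/2) \<subseteq> ball c e" "ball d (e/2) \<subseteq> ball d e" using cd(3) by (auto intro!: subset_ball)
    have "ball a (1 / real (Suc k)) \<inter> ball b (1 / real (Suc k)) = {}"
      using near[OF a(2)] near[OF b(2)] dj by blast
    moreover have "a \<in> D" "b \<in> D" unfolding D_def using a b by blast+
    ultimately have "Q a b k \<in> G" unfolding G_def by blast
    moreover have "y \<in> Q a b k"
    proof -
      have "ball a (1 / real (Suc k)) \<subseteq> ball c e" "ball b (1 / real (Suc k)) \<subseteq> ball d e"
        using near[OF a(2)] near[OF b(2)] sb by blast+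
      then have "unsplit (ball a (1 / real (Suc k))) (ball b (1 / real (Suc k))) (fibre y)" using cd(5) by blast
      moreover have "c \<in> cball a (1 / (2 * real (Suc k)))" "d \<in> cball b (1 / (2 * real (Suc k)))"
        using a b by (simp_all add: less_imp_le)
      ultimately show ?thesis unfolding Q_def using yX cd(1,2) by blast
    qed
    ultimately show "y \<in> \<Union>G" by blast
  qed
  have clQ: "closed (Q a b k)" if dj: "ball a (1 / real (Suc k)) \<inter> ball b (1 / real (Suc k)) = {}" for a b k
  proof -
    have "closed {x\<in>X. unsplit (ball a (1 / real (Suc k))) (ball b (1 / real (Suc k))) (fibre x)}"
    proof (rule closed_fibre_Collect)
      fix z p r assume z: "\<And>n::nat. z n \<in> X"
        "\<And>n. unsplit (ball a (1 / real (Suc k))) (ball b (1 / real (Suc k))) (fibre (z n))"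
        "p \<in> X" "hlim (\<lambda>n. fibre (z n)) (fibre p)"
      show "unsplit (ball a (1 / real (Suc k))) (ball b (1 / real (Suc k))) (fibre p)"
        by (rule unsplit_limit[OF open_ball open_ball dj z(2) fibre_ne[OF z(1)]
              contD(5)[OF fibre_cont[OF z(1)]] z(4) contD(3)[OF fibre_cont[OF z(3)]]])
    qed
    then show ?thesis unfolding Q_def by (intro closed_Int closed_meets_fibre closed_cball)
  qed
  \<comment> \<open>Baire's theorem: the complement of \<open>Sng\<close> is open, contains
    \<open>x\<close>, and is covered by countably many closed sets, so one of them has
    interior.\<close>
  have "\<exists>T\<in>G. (top_of_set X) interior_of T \<noteq> {}"
  proof (rule ccontr)
    assume none: "\<not> ?thesis"
    have "(top_of_set X) interior_of \<Union>G = {}"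
    proof (rule Baire_category_alt)
      have "compact_space (top_of_set X)" using cpt by (simp add: compact_space_subtopology)
      moreover have "regular_space (top_of_set X)"
        by (intro metrizable_imp_regular_space metrizable_space_subtopology metrizable_space_euclidean)
      ultimately show "completely_metrizable_space (top_of_set X) \<or>
          locally_compact_space (top_of_set X) \<and> regular_space (top_of_set X)"
        by (simp add: compact_imp_locally_compact_space)
      show "countable G" by (rule cG)
      fix T assume T: "T \<in> G"
      then obtain a b k where "T = Q a b k" "ball a (1 / real (Suc k)) \<inter> ball b (1 / real (Suc k)) = {}"
        unfolding G_def by blast
      then have "closed T" using clQ by simp
      moreover have "T \<subseteq> X" using \<open>T = Q a b k\<close> unfolding Q_def by blast
      ultimately show "closedin (top_of_set X) T \<and> (top_of_set X) interior_of T = {}"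
        using none T by (simp add: closed_subset)
    qed
    moreover have "openin (top_of_set X) (X - Sng)"
      using clS by (metis Diff_eq Int_commute open_Compl openin_open)
    then have "X - Sng \<subseteq> (top_of_set X) interior_of \<Union>G" using cover by (rule interior_of_maximal[rotated])
    ultimately show False using assms xS by blast
  qed
  then obtain a b k where dj: "ball a (1 / real (Suc k)) \<inter> ball b (1 / real (Suc k)) = {}"
    and int: "(top_of_set X) interior_of (Q a b k) \<noteq> {}" unfolding G_def by blast
  define U where "U = ball a (1 / real (Suc k))"
  define V where "V = ball b (1 / real (Suc k))"
  have UV: "open U" "open V" "U \<inter> V = {}" unfolding U_def V_def using dj by auto
  have Q: "unsplit U V (fibre y)" "fibre y \<inter> U \<noteq> {}" "fibre y \<inter> V \<noteq> {}" if y: "y \<in> Q a b k" for y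
  proof -
    have "cball z (1 / (2 * real (Suc k))) \<subseteq> ball z (1 / real (Suc k))" for z :: 'a
      by (auto simp: field_simps)
    then show "fibre y \<inter> U \<noteq> {}" "fibre y \<inter> V \<noteq> {}" using y unfolding Q_def U_def V_def by blast+
    show "unsplit U V (fibre y)" using y unfolding Q_def U_def V_def by blast
  qed
  have "openin (top_of_set X) ((top_of_set X) interior_of (Q a b k))" by (rule openin_interior_of)
  then obtain N0 where N0: "open N0" "(top_of_set X) interior_of (Q a b k) = X \<inter> N0"
    unfolding openin_open by blast
  then have N0Q: "X \<inter> N0 \<subseteq> Q a b k" using interior_of_subset by metis
  obtain x0 where x0: "x0 \<in> X" "x0 \<in> N0" using int N0(2) by blast
  \<comment> \<open>Membership in \<open>Q a b k\<close> depends on the fibre only. Hence it holds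
    at every point whose fibre meets \<open>N0\<close>, that is, at every point off the closed set
    \<open>R\<close>.\<close>
  define R where "R = {y\<in>X. fibre y \<subseteq> - N0}"
  have clR: "closed R" unfolding R_def using N0(1) by (intro closed_fibre_sub closed_Compl)
  have notR: "y \<in> Q a b k" if y: "y \<in> X" "y \<notin> R" for y
  proof -
    obtain z where z: "z \<in> fibre y" "z \<in> N0" using y unfolding R_def by blast
    then have "z \<in> Q a b k" using N0Q fibre_sub[OF y(1)] by blast
    moreover have "fibre z = fibre y" using fibre_eq[OF y(1) z(1)] .
    ultimately show ?thesis unfolding Q_def using y(1) by simp
  qed
  define B0 where "B0 = fibre x0"
  have B0: "B0 \<in> Bmin" "x0 \<in> B0" unfolding B0_def using fibre[OF x0(1)] by blast+
  have B0R: "B0 \<inter> R = {}"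
  proof (rule ccontr)
    assume "\<not> ?thesis"
    then obtain y where "y \<in> fibre x0" "y \<in> R" unfolding B0_def by blast
    then have "fibre x0 \<subseteq> - N0" using fibre_eq[OF x0(1)] unfolding R_def by auto
    then show False using x0 fibre(2) by blast
  qed
  \<comment> \<open>The continuum \<open>J\<close> leaves \<open>B0\<close> but has only points
    whose fibres satisfy the uniform condition. By terminality it will turn out to be a union of
    fibres.\<close>
  have "\<exists>J w. cont J \<and> x0 \<in> J \<and> J \<inter> R = {} \<and> w \<in> J \<and> w \<notin> B0"
  proof (cases "R = {}")
    case True
    obtain w where w: "w \<in> X" "w \<notin> B0" using Bmin_proper[OF B0(1)] fibre_sub[OF x0(1)] unfolding B0_def by blast
    have "cont X" using contI[OF subset_refl x0(1) cpt conn] .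
    then show ?thesis using w x0 True by blast
  next
    case False
    obtain e where e: "e > 0" "\<forall>x\<in>B0. \<forall>y\<in>R. e \<le> dist x y"
      using dist_pos_compact_closed[OF contD(3)[OF Bmin_cont[OF B0(1)]] clR B0R] by blast
    have XR: "X \<inter> R \<noteq> {}" "x0 \<notin> R" using False B0R B0(2) unfolding R_def by blast+
    from boundary_bumping_near[OF cpt conn x0(1) clR XR e(1)]
    obtain J w where J: "compact J" "connected J" "J \<subseteq> X" "x0 \<in> J" "J \<inter> R = {}" "w \<in> J" "infdist w R < e"
      by (elim exE conjE)
    have "w \<notin> B0"
    proof
      assume "w \<in> B0"
      then have "e \<le> infdist w R" unfolding infdist_notempty[OF False] using e(2) False
        by (intro cINF_greatest) auto
      then show False using J(7) by simp
    qed
    then show ?thesis using contI[OF J(3,4,1,2)] J by blast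
  qed
  then obtain J w where J: "cont J" "x0 \<in> J" "J \<inter> R = {}" "w \<in> J" "w \<notin> B0" by (elim exE conjE)
  have JX: "J \<subseteq> X" using contD(1)[OF J(1)] .
  have JQ: "y \<in> Q a b k" if "y \<in> J" for y using notR JX J(3) that by blast
  have B0J: "B0 \<subseteq> J" using Bmin_terminal[OF B0(1) J(1)] J B0(2) by blast
  have sat: "fibre y \<subseteq> J" if y: "y \<in> J" for y
  proof (rule ccontr)
    assume n: "\<not> fibre y \<subseteq> J"
    have yX: "y \<in> X" using y JX by blast
    have "J \<subseteq> fibre y" using Bmin_terminal[OF fibre(1)[OF yX] J(1)] n fibre(2)[OF yX] y by blast
    then have "fibre y = B0" using fibre_eq[OF yX] J(2) unfolding B0_def by blast
    then show False using n B0J by simp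
  qed
  have wX: "w \<in> X" using J(4) JX by blast
  obtain u1 where u1: "u1 \<in> B0" "u1 \<in> U" using Q(2)[OF JQ[OF J(2)]] unfolding B0_def by blast
  obtain u2 where u2: "u2 \<in> fibre w" "u2 \<in> U" using Q(2)[OF JQ[OF J(4)]] by blast
  have dis: "u2 \<notin> B0"
  proof
    assume "u2 \<in> B0"
    then have "fibre w = B0" using fibre_eq[OF x0(1)] fibre_eq[OF wX u2(1)] unfolding B0_def by simp
    then show False using J(5) fibre(2)[OF wX] by simp
  qed
  define Z where "Z = J - V"
  have ZX: "Z \<subseteq> X" unfolding Z_def using JX by blast
  have clZ: "closed Z" unfolding Z_def using contD(5)[OF J(1)] UV(2) by (rule closed_Diff)
  have cZ: "compact Z" using compact_closed_subset[OF clZ ZX] .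
  have uZ: "{u1} \<subseteq> Z" "{u2} \<subseteq> Z" unfolding Z_def using u1 u2 B0J sat[OF J(4)] UV(3) by blast+
  \<comment> \<open>If \<open>u1\<close> and \<open>u2\<close> were separated in
    \<open>J - V\<close>, each fibre in \<open>J\<close> would have its nonempty part in
    \<open>U\<close> on exactly one side, because fibres are unsplit. The two kinds of fibres would
    form two disjoint closed sets covering \<open>J\<close>.\<close>
  have "\<exists>C. connected C \<and> C \<subseteq> Z \<and> C \<inter> {u1} \<noteq> {} \<and> C \<inter> {u2} \<noteq> {}"
  proof (rule ccontr)
    assume "\<not> ?thesis"
    then have nc: "\<forall>C. connected C \<and> C \<subseteq> Z \<longrightarrow> C \<inter> {u1} = {} \<or> C \<inter> {u2} = {}" by blast
    from cut_wire_metric[OF cZ closed_singleton closed_singleton uZ nc]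
    obtain E F where EF: "closed E" "closed F" "E \<inter> F = {}" "E \<union> F = Z" "{u1} \<subseteq> E" "{u2} \<subseteq> F"
      by (elim exE conjE)
    define E' where "E' = J \<inter> {y\<in>X. fibre y \<subseteq> E \<union> - U}"
    define F' where "F' = J \<inter> {y\<in>X. fibre y \<subseteq> F \<union> - U}"
    have "closed (E \<union> - U)" "closed (F \<union> - U)" using EF UV by (auto intro!: closed_Un closed_Compl)
    then have cl: "closed E'" "closed F'" unfolding E'_def F'_def
      using contD(5)[OF J(1)] by (auto intro!: closed_Int closed_fibre_sub)
    have cov: "J \<subseteq> E' \<union> F'"
    proof
      fix y assume y: "y \<in> J"
      have "fibre y - V \<subseteq> E \<union> F" using sat[OF y] EF(4) unfolding Z_def by blast
      then have "fibre y \<inter> U \<subseteq> E \<or> fibre y \<inter> U \<subseteq> F"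
        using Q(1)[OF JQ[OF y]] EF(1-3) unfolding unsplit_def by blast
      then show "y \<in> E' \<union> F'" unfolding E'_def F'_def using y JX by blast
    qed
    have dj': "E' \<inter> F' \<inter> J = {}"
    proof (rule ccontr)
      assume "\<not> ?thesis"
      then obtain y where y: "y \<in> J" "fibre y \<subseteq> E \<union> - U" "fibre y \<subseteq> F \<union> - U" unfolding E'_def F'_def by blast
      obtain z where "z \<in> fibre y" "z \<in> U" using Q(2)[OF JQ[OF y(1)]] by blast
      then show False using y EF(3) by blast
    qed
    from connected_closedD[OF contD(4)[OF J(1)] dj' cov cl]
    have "E' \<inter> J = {} \<or> F' \<inter> J = {}" .
    moreover have "x0 \<notin> F'" unfolding F'_def using u1 EF(3,5) unfolding B0_def by blast
    moreover have "w \<notin> E'" unfolding E'_def using u2 EF(3,6) by blast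
    ultimately show False using cov J(2,4) by blast
  qed
  then obtain C where C: "connected C" "C \<subseteq> Z" "u1 \<in> C" "u2 \<in> C" by blast
  \<comment> \<open>The closure of \<open>C\<close> joins \<open>B0\<close> to a point of another
    fibre, so it contains \<open>B0\<close> by terminality. But it misses \<open>V\<close>, whereas
    \<open>B0\<close> meets \<open>V\<close>.\<close>
  have CZ: "closure C \<subseteq> Z" using C(2) clZ by (rule closure_minimal)
  have uC: "u1 \<in> closure C" "u2 \<in> closure C" using C(3,4) closure_subset[of C] by blast+
  have "compact (closure C)" using CZ ZX by (intro compact_closed_subset) auto
  then have cC: "cont (closure C)"
    using contI[OF order_trans[OF CZ ZX] uC(1) _ connected_imp_connected_closure[OF C(1)]] by blast
  have "B0 \<subseteq> closure C" using Bmin_terminal[OF B0(1) cC] uC u1(1) dis by blast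
  then have "B0 \<inter> V = {}" using CZ unfolding Z_def by blast
  then show False using Q(3)[OF JQ[OF J(2)]] unfolding B0_def by blast
qed

lemma singleton_Bmin: "x \<in> X \<Longrightarrow> {x} \<in> Bmin"
  using fibre(1)[of x] fibre_eq_singleton[of x] by simp

lemma singleton_NB: "x \<in> X \<Longrightarrow> {x} \<in> nonblockers X"
  using BminD(1)[OF singleton_Bmin] .

lemma reach_singleton:
  assumes "x \<in> X" "fat P" "x \<notin> P"
  shows "reach P {x} = X - {x}"
  using Bmin_hull[OF singleton_Bmin[OF assms(1)] _ assms(2,3)] reach_sub[of P "{x}"] by blast

text \<open>For \<open>y\<close> off \<open>F\<close>, the set \<open>reach P {y}\<close> is now all
  of \<open>X - {y}\<close>, so some fat continuum is a neighbourhood of \<open>F\<close> and misses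
  \<open>y\<close>. A fat component of the closure of its complement is disjoint from
  \<open>F\<close>.\<close>

lemma fat_avoiding:
  assumes "closed F" "F \<subseteq> X" "F \<noteq> X"
  shows "\<exists>T. fat T \<and> T \<inter> F = {}"
proof -
  obtain y where y: "y \<in> X" "y \<notin> F" using assms by blast
  obtain P where P: "fat P" "y \<notin> P" using fat_avoiding_point[OF y(1)] by blast
  have Py: "P \<inter> {y} = {}" using P by blast
  have "F \<subseteq> reach P {y}" using reach_singleton[OF y(1) P] assms(2) y by blast
  from reach_nbhd_compact[OF P(1) closed_singleton Py compact_closed_subset[OF assms(1,2)] this]
  obtain R U where R: "cont R" "P \<subseteq> R" "R \<inter> {y} = {}" "open U" "F \<subseteq> U" "U \<inter> X \<subseteq> R" by (elim exE conjE)
  have fR: "fat R" using fat_mono[OF P(1) R(2,1)] .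
  have opR: "open (- R)" using contD(5)[OF R(1)] by auto
  have "- R \<inter> X \<noteq> {}" "- R \<inter> X \<inter> R = {}" using y R(3) by blast+
  from fat_component[OF fR opR this] obtain T where T: "T \<in> components (closure (X - R))" "fat T" by blast
  have "X - R \<subseteq> - U" using R(6) by blast
  then have "closure (X - R) \<subseteq> - U" using R(4) by (intro closure_minimal) (auto simp: closed_Compl)
  then have "T \<inter> F = {}" using in_components_subset[OF T(1)] R(5) by blast
  then show ?thesis using T(2) by blast
qed

lemma finite_not_dense:
  assumes "finite F" "open U" "U \<inter> X \<noteq> {}" "F \<subseteq> X"
  shows "\<not> U \<inter> X \<subseteq> F"
proof -
  have "\<not> U \<inter> X \<subseteq> \<Union>((\<lambda>x. {x}) ` F)"
  proof (rule dense_set_finite_Union[OF _ _ assms(2,3)])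
    show "finite ((\<lambda>x. {x}) ` F)" using assms(1) by simp
    fix T assume "T \<in> (\<lambda>x. {x}) ` F"
    then obtain x where x: "x \<in> F" "T = {x}" by blast
    have "dense_set (X - {x})" using NB_dense_set[OF singleton_NB] x assms(4) by blast
    then show "closed T \<and> (\<forall>U. open U \<longrightarrow> U \<inter> X \<noteq> {} \<longrightarrow> \<not> U \<inter> X \<subseteq> T)"
      unfolding x(2) dense_set_def by blast
  qed
  then show ?thesis by simp
qed

lemma X_ne: "X \<noteq> {}" using exists_fat_proper contD(1,2) fat_cont by blast

lemma finite_proper: "finite F \<Longrightarrow> F \<subseteq> X \<Longrightarrow> F \<noteq> X"
  using finite_not_dense[of F UNIV] X_ne by auto

section \<open>Finite sets with continuumwise connected complement\<close>

definition nonsep :: "'a set \<Rightarrow> bool" where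
  "nonsep F \<longleftrightarrow> (\<forall>u\<in>X - F. \<forall>v\<in>X - F. \<exists>L. cont L \<and> u \<in> L \<and> v \<in> L \<and> L \<inter> F = {})"

lemma nonsepD:
  "nonsep F \<Longrightarrow> u \<in> X \<Longrightarrow> u \<notin> F \<Longrightarrow> v \<in> X \<Longrightarrow> v \<notin> F \<Longrightarrow> \<exists>L. cont L \<and> u \<in> L \<and> v \<in> L \<and> L \<inter> F = {}"
  unfolding nonsep_def by blast

lemma nonsep_NB:
  assumes "finite F" "F \<noteq> {}" "F \<subseteq> X" "nonsep F"
  shows "F \<in> nonblockers X"
  unfolding NB_iff
proof (intro conjI ballI allI impI)
  show "compact F" using assms(1) by (rule finite_imp_compact)
  show "F \<noteq> X" using finite_proper[OF assms(1,3)] .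
  fix x U assume x: "x \<in> X - F" and U: "open U" "U \<inter> X \<noteq> {}"
  obtain y where y: "y \<in> U" "y \<in> X" "y \<notin> F" using finite_not_dense[OF assms(1) U assms(3)] by blast
  then show "\<exists>L. cont L \<and> x \<in> L \<and> L \<inter> F = {} \<and> L \<inter> U \<noteq> {}"
    using nonsepD[OF assms(4), of x y] x by blast
qed (use assms in auto)

lemma reach_nonsep:
  assumes "cont P" "P \<inter> F = {}" "X - F \<subseteq> reach P F"
  shows "nonsep F"
  unfolding nonsep_def using reach_join[OF assms(1,2)] assms(3) by blast

lemma nonsep_reach:
  assumes "nonsep F" "cont P" "P \<inter> F = {}"
  shows "reach P F = X - F"
proof
  show "X - F \<subseteq> reach P F"
  proof
    fix u assume u: "u \<in> X - F"
    obtain p where p: "p \<in> P" using contD(2)[OF assms(2)] by blast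
    then have "p \<in> X" "p \<notin> F" using contD(1)[OF assms(2)] assms(3) by blast+
    then obtain L where L: "cont L" "u \<in> L" "p \<in> L" "L \<inter> F = {}" using nonsepD[OF assms(1), of u p] u by blast
    then have "L \<inter> P \<noteq> {}" using p by blast
    then show "u \<in> reach P F" using reachI[OF L(1,2) _ L(4)] by blast
  qed
qed (rule reach_sub)

text \<open>Density of the \<open>kappa\<close> sets improves to joining any two points: a fat
  continuum disjoint from \<open>F\<close> is reached from every point off \<open>F\<close> and
  serves as a common hub.\<close>

lemma NB_nonsep:
  assumes "F \<in> nonblockers X"
  shows "nonsep F"
proof -
  obtain T where T: "fat T" "T \<inter> F = {}" using fat_avoiding[OF NBD(4,1,5)[OF assms]] by blast
  show ?thesis by (rule reach_nonsep[OF fat_cont[OF T(1)] T(2) reach_supset_NB[OF assms subset_refl T(1)]])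
qed

lemma nonsep_singleton: "x \<in> X \<Longrightarrow> nonsep {x}"
  using NB_nonsep[OF singleton_NB] .

lemma nonsep_connected:
  assumes "nonsep F"
  shows "connected (X - F)"
proof (cases "X - F = {}")
  case False
  then obtain p where p: "p \<in> X" "p \<notin> F" by blast
  have "\<exists>M. connected M \<and> p \<in> M \<and> v \<in> M \<and> M \<subseteq> X - F" if v: "v \<in> X - F" for v
  proof -
    obtain L where L: "cont L" "p \<in> L" "v \<in> L" "L \<inter> F = {}" using nonsepD[OF assms p, of v] v by blast
    then show ?thesis using contD(1,4)[OF L(1)] by (intro exI[of _ L]) blast
  qed
  then show ?thesis by (intro connected_from_point[of _ p]) blast
qed (simp only: connected_empty)

text \<open>A continuum \<open>R\<close> that misses \<open>A \<union> {x}\<close> and contains all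
  points not too close to it also misses \<open>x'\<close> near \<open>x\<close>. A point close to
  some \<open>z\<close> is led to \<open>R\<close> by a short continuum near \<open>z\<close>. For
  \<open>z = x\<close> that continuum only has to avoid \<open>x'\<close>, which is possible because
  single points do not cut. Otherwise it comes from one avoiding all of
  \<open>A \<union> {x}\<close>.\<close>

lemma nonsep_replace_near:
  assumes "finite A" "A \<subseteq> X" "x \<in> X" "x \<notin> A" "nonsep (A \<union> {x})"
  shows "\<exists>d>0. \<forall>x'\<in>X. dist x' x < d \<longrightarrow> nonsep (A \<union> {x'})"
proof -
  define F where "F = A \<union> {x}"
  have F: "finite F" "F \<subseteq> X" "closed F" "nonsep F" unfolding F_def using assms by (auto intro: finite_imp_closed)
  obtain P where P: "fat P" "P \<inter> F = {}" using fat_avoiding[OF F(3,2) finite_proper[OF F(1,2)]] by blast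
  have cP: "cont P" using fat_cont[OF P(1)] .
  obtain p0 where p0: "p0 \<in> P" using contD(2)[OF cP] by blast
  obtain d1 where d1: "d1 > 0" "\<forall>p\<in>P. \<forall>z\<in>F. d1 \<le> dist p z"
    using dist_pos_compact_closed[OF contD(3)[OF cP] F(3) P(2)] by blast
  have "\<exists>d>0. \<forall>y\<in>F. y \<noteq> z \<longrightarrow> d \<le> dist z y" for z using finite_set_avoid[OF F(1), of z] by blast
  then obtain dd where dd: "\<And>z. dd z > 0" "\<And>z y. y \<in> F \<Longrightarrow> y \<noteq> z \<Longrightarrow> dd z \<le> dist z y" by metis
  \<comment> \<open>The points of \<open>F\<close> are at least \<open>3 * e\<close> apart and
    \<open>P\<close> is at least \<open>e\<close> away from them. So the sphere of radius
    \<open>e\<close> in \<open>X\<close> around \<open>z\<close> lies in \<open>K\<close>, the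
    closed ball contains no other point of \<open>F\<close>, and for \<open>z\<close> in
    \<open>A\<close> it misses \<open>x'\<close>, which is within \<open>e\<close> of
    \<open>x\<close>.\<close>
  define e where "e = min d1 (Min (dd ` F) / 3)"
  have Fne: "F \<noteq> {}" unfolding F_def by blast
  have "Min (dd ` F) > 0" using F(1) Fne dd(1) by (simp add: Min_gr_iff)
  then have e: "e > 0" "e \<le> d1" "3 * e \<le> Min (dd ` F)" using d1(1) unfolding e_def by auto
  have e3: "3 * e \<le> dist z y" if zy: "z \<in> F" "y \<in> F" "z \<noteq> y" for z y
  proof -
    have "Min (dd ` F) \<le> dd z" using F(1) zy(1) by simp
    also have "\<dots> \<le> dist z y" by (rule dd(2)[OF zy(2)]) (use zy(3) in blast)
    finally show ?thesis using e(3) by linarith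
  qed
  define K where "K = X \<inter> (\<Inter>z\<in>F. {y. e \<le> dist z y})"
  have "closed (\<Inter>z\<in>F. {y. e \<le> dist z y})" by (intro closed_INT ballI closed_Collect_le continuous_intros)
  then have clK: "closed K" unfolding K_def using closedX by (intro closed_Int)
  have KX: "K \<subseteq> X" unfolding K_def by blast
  have KI: "y \<in> K" if "y \<in> X" "\<And>z. z \<in> F \<Longrightarrow> e \<le> dist z y" for y using that unfolding K_def by blast
  have KF: "K \<inter> F = {}"
  proof (rule ccontr)
    assume "\<not> ?thesis"
    then obtain z where "z \<in> K" "z \<in> F" by blast
    then have "e \<le> dist z z" unfolding K_def by blast
    then show False using e(1) by simp
  qed
  have "K \<subseteq> reach P F" using nonsep_reach[OF F(4) cP P(2)] KX KF by blast
  from reach_nbhd_compact[OF P(1) F(3) P(2) compact_closed_subset[OF clK KX] this]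
  obtain R U where R: "cont R" "P \<subseteq> R" "R \<inter> F = {}" "open U" "K \<subseteq> U" "U \<inter> X \<subseteq> R" by (elim exE conjE)
  have KR: "K \<subseteq> R" using R(5,6) KX by blast
  have "open (- R)" "x \<in> - R" using contD(5)[OF R(1)] R(3) unfolding F_def by auto
  then obtain d0 where d0: "d0 > 0" "ball x d0 \<subseteq> - R" using openE by metis
  define d where "d = min d0 e"
  have d: "d > 0" "d \<le> d0" "d \<le> e" unfolding d_def using d0 e by auto
  have "nonsep (A \<union> {x'})" if x': "x' \<in> X" "dist x' x < d" for x'
  proof -
    have xx': "dist x x' < d" using x'(2) by (simp add: dist_commute)
    have "x' \<in> ball x d0" using xx' d(2) by simp
    then have xR: "x' \<notin> R" using d0(2) by blast
    have RA: "R \<inter> (A \<union> {x'}) = {}" using xR R(3) unfolding F_def by blast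
    have "v \<in> reach R (A \<union> {x'})" if v: "v \<in> X" "v \<notin> A" "v \<noteq> x'" for v
    proof (cases "v \<in> R")
      case True
      then show ?thesis using reach_base[OF R(1) RA] by blast
    next
      case False
      then have "v \<notin> K" using KR by blast
      then obtain z where z: "z \<in> F" "dist z v < e" using KI[OF v(1)] not_le by blast
      have p0X: "p0 \<in> X" "p0 \<in> R" using p0 R(1,2) contD(1) by blast+
      have far: "e \<le> dist z p0" using d1(2) p0 z(1) e(2) by (metis dist_commute order_trans)
      have fin: ?thesis if L: "cont L" "v \<in> L" "p0 \<in> L"
        and av: "\<And>y. y \<in> L \<Longrightarrow> dist z y \<le> e \<Longrightarrow> y \<notin> A \<union> {x'}" for L
      proof -
        from boundary_bumping_ball[OF contD(3,4)[OF L(1)] L(2,3) z(2) far]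
        obtain J w where J: "compact J" "connected J" "J \<subseteq> L" "v \<in> J" "J \<subseteq> cball z e" "w \<in> J" "dist z w = e"
          by (elim exE conjE)
        have JX: "J \<subseteq> X" using J(3) contD(1)[OF L(1)] by blast
        have cJ: "cont J" using contI[OF JX J(4,1,2)] .
        have "w \<in> K"
        proof (rule KI)
          show "w \<in> X" using J(6) JX by blast
          fix y assume y: "y \<in> F"
          show "e \<le> dist y w"
          proof (cases "y = z")
            case False
            then have "3 * e \<le> dist y z" using e3[OF y z(1)] by blast
            moreover have "dist y z \<le> dist y w + dist w z" by (rule dist_triangle)
            ultimately show ?thesis using J(7) e(1) by (simp add: dist_commute[of w z])
          qed (use J(7) in simp)
        qed
        then have "J \<inter> R \<noteq> {}" using KR J(6) by blast
        moreover have "J \<inter> (A \<union> {x'}) = {}" using av J(3,5) by fastforce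
        ultimately show ?thesis using reachI[OF cJ J(4)] by blast
      qed
      show ?thesis
      proof (cases "z = x")
        case True
        obtain L where L: "cont L" "v \<in> L" "p0 \<in> L" "L \<inter> {x'} = {}"
          using nonsepD[OF nonsep_singleton[OF x'(1)], of v p0] v p0X xR by blast
        show ?thesis
        proof (rule fin[OF L(1-3)])
          fix y assume y: "y \<in> L" "dist z y \<le> e"
          have "y \<notin> A"
          proof
            assume "y \<in> A"
            then have "3 * e \<le> dist x y" using e3[of x y] assms(4) unfolding F_def by blast
            then show False using y(2) True e(1) by simp
          qed
          then show "y \<notin> A \<union> {x'}" using y(1) L(4) by blast
        qed
      next
        case False
        then have zA: "z \<in> A" using z(1) unfolding F_def by blast
        have zx: "3 * e \<le> dist z x" using e3[OF z(1) _ False] unfolding F_def by blast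
        have "v \<noteq> x" using zx z(2) e(1) by auto
        then obtain L where L: "cont L" "v \<in> L" "p0 \<in> L" "L \<inter> F = {}"
          using nonsepD[OF F(4), of v p0] v p0 p0X P(2) unfolding F_def by blast
        show ?thesis
        proof (rule fin[OF L(1-3)])
          fix y assume y: "y \<in> L" "dist z y \<le> e"
          have "y \<noteq> x'"
          proof
            assume "y = x'"
            then have "dist z x \<le> e + d" using y(2) x'(2) dist_triangle[of z x x'] by simp
            then show False using zx d e(1) by simp
          qed
          then show "y \<notin> A \<union> {x'}" using y(1) L(4) unfolding F_def by blast
        qed
      qed
    qed
    then show ?thesis using reach_nonsep[OF R(1) RA] by blast
  qed
  then show ?thesis using d(1) by blast
qed

text \<open>The finite sets in question are nonblockers, and compactness of the family of
  nonblockers makes their limit a nonblocker as well.\<close>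

lemma nonsep_limit:
  assumes "finite A" "A \<subseteq> X" "\<And>n. y n \<in> X" "\<And>n. nonsep (A \<union> {y n})" "y \<longlonglongrightarrow> x"
  shows "nonsep (A \<union> {x})"
proof -
  have "A \<union> {y n} \<in> nonblockers X" for n using nonsep_NB[OF _ _ _ assms(4)] assms(1-3) by auto
  from nb_compact[of "\<lambda>n. A \<union> {y n}", OF this] obtain B r where
    B: "B \<in> nonblockers X" "strict_mono r" "hlim (\<lambda>n. A \<union> {y (r n)}) B" by (elim exE conjE)
  have lim: "(\<lambda>n. y (r n)) \<longlonglongrightarrow> x" using LIMSEQ_subseq_LIMSEQ[OF assms(5) B(2)] by (simp add: o_def)
  have "hlim (\<lambda>n. A \<union> {y (r n)}) (A \<union> {x})"
    unfolding hlim_def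
  proof (intro allI impI)
    fix e :: real assume "e > 0"
    then obtain N where N: "\<forall>n\<ge>N. dist (y (r n)) x < e" using metric_LIMSEQ_D[OF lim] by blast
    have "hclose e (A \<union> {y (r n)}) (A \<union> {x})" if n: "n \<ge> N" for n
    proof -
      have d: "dist (y (r n)) x < e" using N n by blast
      have s: "dist a a < e" for a :: 'a using \<open>e > 0\<close> by simp
      show ?thesis unfolding hclose_def using d s by blast
    qed
    then show "\<exists>N. \<forall>n\<ge>N. hclose e (A \<union> {y (r n)}) (A \<union> {x})" by blast
  qed
  moreover have "closed (A \<union> {x})" using assms(1) by (simp add: finite_imp_closed)
  ultimately have "B = A \<union> {x}" using hlim_unique[OF B(3) _ NBD(4)[OF B(1)]] by blast
  then show ?thesis using NB_nonsep[OF B(1)] by simp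
qed

text \<open>The admissible points form a subset of the connected set \<open>X - A\<close> that is
  open by perturbing the added point and closed by passing to limits.\<close>

lemma nonsep_all_or_none:
  assumes "finite A" "A \<subseteq> X" "nonsep A" "x \<in> X" "x \<notin> A" "nonsep (A \<union> {x})" "y \<in> X" "y \<notin> A"
  shows "nonsep (A \<union> {y})"
proof -
  define S where "S = {z \<in> X - A. nonsep (A \<union> {z})}"
  have op: "openin (top_of_set (X - A)) S"
    unfolding openin_euclidean_subtopology_iff
  proof (intro conjI ballI)
    fix z assume z: "z \<in> S"
    then have "z \<in> X" "z \<notin> A" "nonsep (A \<union> {z})" unfolding S_def by blast+
    from nonsep_replace_near[OF assms(1,2) this] obtain d where
      d: "d > 0" "\<forall>x'\<in>X. dist x' z < d \<longrightarrow> nonsep (A \<union> {x'})" by blast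
    then show "\<exists>e>0. \<forall>x'\<in>X - A. dist x' z < e \<longrightarrow> x' \<in> S" unfolding S_def by blast
  qed (auto simp: S_def)
  have cl: "closedin (top_of_set (X - A)) S"
    unfolding closedin_closed
  proof (intro exI conjI)
    show "closed (closure S)" by simp
    have "l \<in> S" if l: "l \<in> X - A" "l \<in> closure S" for l
    proof -
      obtain z where z: "\<forall>n. z n \<in> S" "z \<longlonglongrightarrow> l" using l(2) unfolding closure_sequential by blast
      have zX: "z n \<in> X" and zc: "nonsep (A \<union> {z n})" for n using z(1) unfolding S_def by blast+
      have "nonsep (A \<union> {l})" by (rule nonsep_limit[OF assms(1,2) zX zc z(2)])
      then show ?thesis unfolding S_def using l by blast
    qed
    then show "S = (X - A) \<inter> closure S" using closure_subset[of S] unfolding S_def by blast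
  qed
  have "S = {} \<or> S = X - A" using nonsep_connected[OF assms(3)] op cl unfolding connected_clopen by blast
  moreover have "x \<in> S" unfolding S_def using assms by blast
  ultimately have "y \<in> S" using assms by blast
  then show ?thesis unfolding S_def by blast
qed

section \<open>Finite cut sets\<close>

definition all_nonsep :: "nat \<Rightarrow> bool" where
  "all_nonsep k \<longleftrightarrow> (\<forall>F. finite F \<longrightarrow> F \<subseteq> X \<longrightarrow> card F \<le> k \<longrightarrow> nonsep F)"

lemma all_nonsepD: "all_nonsep k \<Longrightarrow> finite F \<Longrightarrow> F \<subseteq> X \<Longrightarrow> card F \<le> k \<Longrightarrow> nonsep F"
  unfolding all_nonsep_def by blast

lemma nonsep_empty: "nonsep {}"
proof -
  obtain x where "x \<in> X" using X_ne by blast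
  then have "cont X" using contI[OF subset_refl _ cpt conn] by blast
  then show ?thesis unfolding nonsep_def by blast
qed

lemma all_nonsep_1: "all_nonsep 1"
  unfolding all_nonsep_def
proof (intro allI impI)
  fix F assume F: "finite F" "F \<subseteq> X" "card F \<le> 1"
  show "nonsep F"
  proof (cases "F = {}")
    case False
    then have "card F = 1" using F by (simp add: card_gt_0_iff le_antisym Suc_leI)
    then obtain x where "F = {x}" by (rule card_1_singletonE)
    then show ?thesis using nonsep_singleton F(2) by simp
  qed (simp add: nonsep_empty)
qed

text \<open>\<open>F\<close> is turned into \<open>G\<close> by exchanging one point at a time.
  After a point is removed, \<open>k\<close> points remain, so the all-or-none alternative applies
  to the one to be added. The induction counts the points of \<open>G\<close> still missing from
  \<open>F\<close>.\<close>

lemma all_nonsep_swap: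
  assumes "all_nonsep k" "finite G" "G \<subseteq> X" "card G = Suc k"
  shows "finite F \<Longrightarrow> F \<subseteq> X \<Longrightarrow> card F = Suc k \<Longrightarrow> nonsep F \<Longrightarrow> card (G - F) = n \<Longrightarrow> nonsep G"
proof (induction n arbitrary: F)
  case 0
  then have "G - F = {}" using assms(2) by simp
  then have "G = F" using card_seteq[of F G] 0 assms(4) by auto
  then show ?case using 0 by simp
next
  case (Suc n)
  have "G - F \<noteq> {}" using Suc.prems(5) by (metis card.empty nat.distinct(1))
  then obtain y where y: "y \<in> G" "y \<notin> F" by blast
  have "\<not> F \<subseteq> G"
  proof
    assume "F \<subseteq> G"
    then have "F = G" using card_seteq[OF assms(2), of F] Suc.prems assms(4) by auto
    then show False using y by blast
  qed
  then obtain x where x: "x \<in> F" "x \<notin> G" by blast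
  define A where "A = F - {x}"
  have A: "finite A" "A \<subseteq> X" "x \<notin> A" "y \<notin> A" "F = A \<union> {x}" "card A = k"
    unfolding A_def using Suc.prems x y by auto
  have ccA: "nonsep A" using all_nonsepD[OF assms(1) A(1,2)] A(6) by simp
  have xy: "x \<in> X" "y \<in> X" using x y Suc.prems assms(3) by blast+
  have "nonsep (A \<union> {y})"
    by (rule nonsep_all_or_none[OF A(1,2) ccA xy(1) A(3) _ xy(2) A(4)]) (use Suc.prems(4) A(5) in simp)
  moreover have "card (A \<union> {y}) = Suc k" using A by simp
  moreover have "G - (A \<union> {y}) = (G - F) - {y}" using x A(5) by blast
  then have "card (G - (A \<union> {y})) = n" using Suc.prems(5) y assms(2) by simp
  ultimately show ?case using Suc.IH[of "A \<union> {y}"] A(1,2) xy(2) by simp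
qed

lemma all_nonsep_Suc:
  assumes "all_nonsep k" "finite F" "F \<subseteq> X" "card F = Suc k" "nonsep F"
  shows "all_nonsep (Suc k)"
  unfolding all_nonsep_def
proof (intro allI impI)
  fix G assume G: "finite G" "G \<subseteq> X" "card G \<le> Suc k"
  show "nonsep G"
  proof (cases "card G = Suc k")
    case True
    show ?thesis by (rule all_nonsep_swap[OF assms(1) G(1,2) True assms(2-5) refl])
  next
    case False
    then show ?thesis using all_nonsepD[OF assms(1) G(1,2)] G(3) by simp
  qed
qed

text \<open>Otherwise every nonempty finite set is a nonblocker, and finite nets of \<open>X\<close>
  with mesh tending to zero would have the nonblocker limit \<open>X\<close>.\<close>

lemma exists_critical:
  "\<exists>k\<ge>1. all_nonsep k \<and> (\<forall>F. finite F \<longrightarrow> F \<subseteq> X \<longrightarrow> card F = Suc k \<longrightarrow> \<not> nonsep F)"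
proof (rule ccontr)
  assume neg: "\<not> ?thesis"
  have step: "all_nonsep (Suc k)" if k: "k \<ge> 1" "all_nonsep k" for k
  proof -
    obtain F where "finite F" "F \<subseteq> X" "card F = Suc k" "nonsep F" using neg k by blast
    then show ?thesis by (rule all_nonsep_Suc[OF k(2)])
  qed
  have all: "all_nonsep (Suc k)" for k
  proof (induction k)
    case 0
    then show ?case using all_nonsep_1 by simp
  next
    case (Suc k)
    then show ?case using step[of "Suc k"] by simp
  qed
  have nb: "F \<in> nonblockers X" if F: "finite F" "F \<noteq> {}" "F \<subseteq> X" for F
    using nonsep_NB[OF F] all_nonsepD[OF all[of "card F"] F(1,3)] by simp
  have "\<exists>F. finite F \<and> F \<subseteq> X \<and> X \<subseteq> (\<Union>f\<in>F. ball f (1 / real (Suc n)))" for n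
    by (rule finite_net[OF cpt]) auto
  then obtain F where F: "\<And>n. finite (F n) \<and> F n \<subseteq> X \<and> X \<subseteq> (\<Union>f\<in>F n. ball f (1 / real (Suc n)))"
    by metis
  have Fne: "F n \<noteq> {}" for n using F[of n] X_ne by auto
  have "F n \<in> nonblockers X" for n using nb[OF _ Fne] F[of n] by blast
  from nb_compact[of F, OF this] obtain B r where
    B: "B \<in> nonblockers X" "strict_mono r" "hlim (\<lambda>n. F (r n)) B" by (elim exE conjE)
  have "X \<subseteq> B"
  proof
    fix u assume u: "u \<in> X"
    have "\<exists>f\<in>F n. dist f u < 1 / real (Suc n)" for n using F[of n] u by fastforce
    then obtain f where f: "\<And>n. f n \<in> F n" "\<And>n. dist (f n) u < 1 / real (Suc n)" by metis
    have "f \<longlonglongrightarrow> u" using f(2) by (rule LIMSEQ_dist_Suc)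
    then have lim: "(\<lambda>n. f (r n)) \<longlonglongrightarrow> u" using LIMSEQ_subseq_LIMSEQ[OF _ B(2)] by (simp add: o_def)
    show "u \<in> B" by (rule hlim_upper[OF B(3) NBD(4)[OF B(1)] f(1) lim])
  qed
  then show False using NBD(1,5)[OF B(1)] by blast
qed

lemma reach_ball:
  assumes "fat P" "closed F" "P \<inter> F = {}" "x \<in> reach P F"
  shows "\<exists>e>0. ball x e \<inter> X \<subseteq> reach P F"
proof -
  from reach_open[OF assms(1-3)] obtain G where G: "open G" "reach P F = G \<inter> X" by blast
  then obtain e where "e > 0" "ball x e \<subseteq> G" using assms(4) openE by blast
  then show ?thesis using G(2) by blast
qed

lemma near_finite:
  assumes "infdist y D < e" "D \<noteq> {}"
  shows "\<exists>q\<in>D. dist q y < e"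
proof -
  have "\<exists>q\<in>D. dist y q < e"
    using assms cINF_less_iff[of D "dist y" e] by (simp add: infdist_notempty bdd_below_image_dist)
  then show ?thesis by (metis dist_commute)
qed

text \<open>Suppose a boundary point \<open>z\<close> of the piece \<open>reach P A\<close> of \<open>X - A\<close> is not in \<open>A\<close>.
  Pick \<open>s\<close> in the piece and \<open>w1, w2, w3\<close> outside it, all close to \<open>z\<close>.  The sets \<open>K w\<close> of
  points cut off by \<open>s\<close> and \<open>w\<close> are nonempty and disjoint for distinct \<open>w\<close>; since \<open>K w3\<close>
  bypasses \<open>K w1\<close> and \<open>K w2\<close>, a point from each of the latter two gives a set of two points
  that does not block.\<close>

lemma piece_boundary:
  assumes fin: "finite A0" "A0 \<subseteq> X"
    and one: "\<And>x. x \<in> X \<Longrightarrow> x \<notin> A0 \<Longrightarrow> nonsep (A0 \<union> {x})"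
    and two: "\<And>x y. x \<in> X \<Longrightarrow> x \<notin> A0 \<Longrightarrow> y \<in> X \<Longrightarrow> y \<notin> A0 \<Longrightarrow> x \<noteq> y \<Longrightarrow> \<not> nonsep (A0 \<union> {x,y})"
    and ab: "a \<in> X" "b \<in> X"
    and P: "fat P" "P \<inter> (A0 \<union> {a,b}) = {}"
  defines "A \<equiv> A0 \<union> {a,b}"
  shows "closure (reach P A) \<subseteq> reach P A \<union> A"
proof (rule ccontr)
  assume neg: "\<not> ?thesis"
  define W where "W = reach P A"
  have WX: "W \<subseteq> X - A" unfolding W_def by (rule reach_sub)
  have clA: "closed A" unfolding A_def using fin(1) by (simp add: finite_imp_closed)
  have PA: "P \<inter> A = {}" unfolding A_def using P(2) .
  have cP: "cont P" using fat_cont[OF P(1)] .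
  have PW: "P \<subseteq> W" unfolding W_def using reach_base[OF cP PA] .
  obtain z where z: "z \<in> closure W" "z \<notin> W" "z \<notin> A" using neg unfolding W_def by blast
  have "closure W \<subseteq> X" using WX closedX by (intro closure_minimal) auto
  then have zX: "z \<in> X" using z(1) by blast
  obtain p0 where p0: "p0 \<in> P" using contD(2)[OF cP] by blast
  have p0X: "p0 \<in> X" "p0 \<notin> A" using p0 contD(1)[OF cP] PA by blast+
  have "open (- (A \<union> P))" "z \<in> - (A \<union> P)" using clA contD(5)[OF cP] z PW by auto
  then obtain e0 where e0: "e0 > 0" "ball z e0 \<subseteq> - (A \<union> P)" using openE by metis
  define \<rho> where "\<rho> = e0 / 2"
  have \<rho>: "\<rho> > 0" unfolding \<rho>_def using e0 by simp
  have "cball z \<rho> \<subseteq> ball z e0" unfolding \<rho>_def using e0(1) by auto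
  then have cb: "cball z \<rho> \<inter> (A \<union> P) = {}" using e0(2) by blast
  \<comment> \<open>The exit sphere: a continuum from near \<open>z\<close> towards
    \<open>p0\<close> crosses it before it can meet \<open>A\<close> or \<open>P\<close>.\<close>
  define S where "S = X \<inter> {v. dist z v = \<rho>}"
  have "closed {v. dist z v = \<rho>}" by (intro closed_Collect_eq continuous_intros)
  then have clS: "closed S" unfolding S_def using closedX by (rule closed_Int[rotated])
  have SX: "S \<subseteq> X" unfolding S_def by blast
  have Scb: "S \<subseteq> cball z \<rho>" unfolding S_def by auto
  have A0A: "A0 \<subseteq> A" unfolding A_def by blast
  have zA0: "z \<notin> A0" using z(3) A0A by blast
  have clz: "closed (A0 \<union> {z})" using fin(1) by (simp add: finite_imp_closed)
  have Pz: "P \<inter> (A0 \<union> {z}) = {}" using PA A0A z(2) PW by blast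
  have okz: "reach P (A0 \<union> {z}) = X - (A0 \<union> {z})" using nonsep_reach[OF one[OF zX zA0] cP Pz] .
  have "z \<notin> S" unfolding S_def using \<rho> by simp
  then have "S \<subseteq> reach P (A0 \<union> {z})" unfolding okz using SX Scb cb A0A by blast
  \<comment> \<open>The continuum \<open>R\<close> contains \<open>P\<close> and the exit sphere but
    stays away from a ball around \<open>z\<close>. Arriving at the sphere thus counts as reaching
    \<open>R\<close>, and \<open>R\<close> remains disjoint from any points chosen later in that
    ball.\<close>
  from reach_nbhd_compact[OF P(1) clz Pz compact_closed_subset[OF clS SX] this]
  obtain R U where R: "cont R" "P \<subseteq> R" "R \<inter> (A0 \<union> {z}) = {}" "open U" "S \<subseteq> U" "U \<inter> X \<subseteq> R" by (elim exE conjE)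
  have SR: "S \<subseteq> R" using R(5,6) SX by blast
  have fR: "fat R" using fat_mono[OF P(1) R(2,1)] .
  have "open (- R)" "z \<in> - R" using contD(5)[OF R(1)] R(3) by auto
  then obtain d0 where d0: "d0 > 0" "ball z d0 \<subseteq> - R" using openE by metis
  define \<delta> where "\<delta> = min d0 \<rho>"
  have \<delta>: "\<delta> > 0" "\<delta> \<le> \<rho>" unfolding \<delta>_def using d0 \<rho> by auto
  have \<delta>R: "ball z \<delta> \<inter> R = {}" using d0(2) unfolding \<delta>_def by auto
  have \<delta>cb: "ball z \<delta> \<subseteq> cball z \<rho>" using \<delta>(2) by auto
  have \<delta>A: "ball z \<delta> \<inter> A = {}" "ball z \<delta> \<inter> P = {}" using \<delta>cb cb by blast+
  have okF: "R \<inter> (A0 \<union> F) = {}" "closed (A0 \<union> F)" if "F \<subseteq> ball z \<delta>" "finite F" for F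
    using \<delta>R R(3) that fin(1) by (auto intro: finite_imp_closed)
  have p0R: "p0 \<in> R" using p0 R(2) by blast
  \<comment> \<open>A continuum from \<open>v\<close> to \<open>p0\<close> avoiding
    \<open>A0\<close> and \<open>w\<close> is cut off at the sphere. Up to there it has not met
    \<open>A\<close>, so, starting outside the piece \<open>W\<close>, it cannot enter it.\<close>
  have escape: "\<exists>J. cont J \<and> v \<in> J \<and> J \<subseteq> X - W \<and> w \<notin> J \<and> J \<inter> A0 = {} \<and> J \<inter> S \<noteq> {}"
    if v: "v \<in> X" "v \<notin> W" "dist z v < \<rho>" and w: "w \<in> X" "w \<in> ball z \<delta>" "w \<noteq> v" for v w
  proof -
    have "v \<in> cball z \<rho>" using v(3) by simp
    then have vA: "v \<notin> A" using cb by blast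
    have wA: "w \<notin> A0" "p0 \<noteq> w" using \<delta>A w(2) A0A p0 by blast+
    obtain L where L: "cont L" "v \<in> L" "p0 \<in> L" "L \<inter> (A0 \<union> {w}) = {}"
      using nonsepD[OF one[OF w(1) wA(1)], of v p0] v(1) vA A0A w(3) p0X wA(2) by blast
    have "p0 \<notin> cball z \<rho>" using p0 cb by blast
    then have "\<rho> \<le> dist z p0" by simp
    from boundary_bumping_ball[OF contD(3,4)[OF L(1)] L(2,3) v(3) this]
    obtain J w' where J: "compact J" "connected J" "J \<subseteq> L" "v \<in> J" "J \<subseteq> cball z \<rho>" "w' \<in> J" "dist z w' = \<rho>"
      by (elim exE conjE)
    have JX: "J \<subseteq> X" using J(3) contD(1)[OF L(1)] by blast
    have cJ: "cont J" using contI[OF JX J(4,1,2)] .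
    have "J \<inter> A = {}" using J(5) cb by blast
    then have "J \<inter> W = {}" using reach_absorb[OF cJ, of A P] J(4) v(2) unfolding W_def by blast
    moreover have "w' \<in> S" unfolding S_def using J(6,7) JX by blast
    ultimately show ?thesis using cJ J(3,4,6) JX L(4) by blast
  qed
  obtain s where s: "s \<in> W" "dist s z < \<delta>" using z(1) \<delta>(1) unfolding closure_approachable by blast
  have sb: "s \<in> ball z \<delta>" using s(2) by (simp add: dist_commute)
  have sX: "s \<in> X" "s \<notin> A0" using s(1) WX A0A by blast+
  have C_reach: "v \<in> reach R (A0 \<union> F)"
    if v: "v \<in> X" "v \<notin> W" "dist z v < \<rho>" and w: "w \<in> X" "w \<in> ball z \<delta>" "w \<noteq> v"
      and F: "F \<subseteq> W \<union> {w}" for v w F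
  proof -
    obtain J where J: "cont J" "v \<in> J" "J \<subseteq> X - W" "w \<notin> J" "J \<inter> A0 = {}" "J \<inter> S \<noteq> {}"
      using escape[OF v w] by blast
    have "J \<inter> (A0 \<union> F) = {}" using J F by blast
    moreover have "J \<inter> R \<noteq> {}" using J(6) SR by blast
    ultimately show ?thesis using reachI[OF J(1,2)] by blast
  qed
  \<comment> \<open>The continuum by which \<open>z\<close> itself escapes outside \<open>W\<close>
    crosses every small sphere around \<open>z\<close>. Three different radii then give three
    different points.\<close>
  have "\<exists>w. w \<in> X \<and> w \<notin> W \<and> dist z w = c" if c: "0 < c" "c < \<delta>" for c
  proof -
    have "dist z z < \<rho>" "s \<noteq> z" using \<rho> s(1) z(2) by auto
    from escape[OF zX z(2) this(1) sX(1) sb this(2)]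
    obtain J where J: "cont J" "z \<in> J" "J \<subseteq> X - W" "J \<inter> S \<noteq> {}" by blast
    then obtain u where u: "u \<in> J" "dist z u = \<rho>" unfolding S_def by blast
    have "dist z z < c" "c \<le> dist z u" using c u \<delta>(2) by auto
    from boundary_bumping_ball[OF contD(3,4)[OF J(1)] J(2) u(1) this]
    obtain w where "w \<in> J" "dist z w = c" by blast
    then show ?thesis using J(3) by blast
  qed
  note exw = this
  have ex: "\<exists>w. w \<in> X \<and> w \<notin> W \<and> dist z w = \<delta> / 2" "\<exists>w. w \<in> X \<and> w \<notin> W \<and> dist z w = \<delta> / 3"
    "\<exists>w. w \<in> X \<and> w \<notin> W \<and> dist z w = \<delta> / 4" by (rule exw; use \<delta>(1) in simp)+
  obtain w1 where w1: "w1 \<in> X" "w1 \<notin> W" "dist z w1 = \<delta> / 2" using ex(1) by blast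
  obtain w2 where w2: "w2 \<in> X" "w2 \<notin> W" "dist z w2 = \<delta> / 3" using ex(2) by blast
  obtain w3 where w3: "w3 \<in> X" "w3 \<notin> W" "dist z w3 = \<delta> / 4" using ex(3) by blast
  define N where "N = {w \<in> X. w \<notin> W \<and> w \<in> ball z \<delta>}"
  have wN: "w1 \<in> N" "w2 \<in> N" "w3 \<in> N" unfolding N_def using w1 w2 w3 \<delta>(1) by auto
  have wd: "w1 \<noteq> w2" "w1 \<noteq> w3" "w2 \<noteq> w3" using w1(3) w2(3) w3(3) \<delta>(1) by auto
  have ND: "w \<in> X" "w \<notin> W" "w \<in> ball z \<delta>" "dist z w < \<rho>" "w \<notin> A0" "w \<noteq> s" "w \<notin> P" if "w \<in> N" for w
    using that \<delta>(2) \<delta>A A0A s(1) unfolding N_def by auto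
  define G where "G w = A0 \<union> {s,w}" for w
  define K where "K w = X - G w - reach R (G w)" for w
  have G: "R \<inter> G w = {}" "closed (G w)" if "w \<in> N" for w
    using okF[of "{s,w}"] sb ND(3)[OF that] unfolding G_def by simp_all
  have k1: "K w \<noteq> {}" if w: "w \<in> N" for w
  proof
    assume "K w = {}"
    then have "X - G w \<subseteq> reach R (G w)" unfolding K_def by blast
    then have "nonsep (G w)" using reach_nonsep[OF R(1) G(1)[OF w]] by blast
    then show False using two[OF sX ND(1,5)[OF w]] ND(6)[OF w] unfolding G_def by blast
  qed
  \<comment> \<open>Points near \<open>z\<close> outside \<open>W\<close> are not cut off by
    \<open>s\<close> and a different \<open>w\<close>. Consequently the points of \<open>K w\<close>
    near \<open>z\<close> all lie in \<open>W\<close>.\<close>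
  have k2: "v \<in> reach R (G w)" if "w \<in> N" "v \<in> X" "v \<notin> W" "dist z v < \<rho>" "v \<noteq> w" for v w
    unfolding G_def
    by (rule C_reach[OF that(2-4) ND(1,3)[OF that(1)] that(5)[symmetric]]) (use s(1) in blast)
  have stay: "J \<subseteq> K w" if "cont J" "v \<in> J" "v \<in> K w" "J \<inter> G w = {}" for J v w
  proof -
    have "J \<inter> reach R (G w) = {}" using reach_absorb[OF that(1,4)] that(2,3) unfolding K_def by blast
    then show ?thesis unfolding K_def using contD(1)[OF that(1)] that(4) by blast
  qed
  have hits: "L \<inter> {s,w} \<noteq> {}" if "w \<in> N" "cont L" "v \<in> L" "p0 \<in> L" "v \<in> K w" "L \<inter> A0 = {}" for L v w
  proof
    assume "L \<inter> {s,w} = {}"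
    then have "L \<inter> G w = {}" unfolding G_def using that(6) by blast
    moreover have "L \<inter> R \<noteq> {}" using that(4) p0R by blast
    ultimately show False using reachI[OF that(2,3)] that(5) unfolding K_def by blast
  qed
  have KX: "K w \<subseteq> X" "K w \<inter> G w = {}" for w unfolding K_def by blast+
  have via: "\<exists>L. cont L \<and> v \<in> L \<and> p0 \<in> L \<and> L \<inter> (A0 \<union> {q}) = {}"
    if "v \<in> X" "v \<notin> A0" "v \<noteq> q" "q \<in> X" "q \<notin> A0" "q \<notin> P" for v q
    using nonsepD[OF one[OF that(4,5)], of v p0] that p0X A0A p0 by blast
  \<comment> \<open>A continuum from \<open>K w\<close> to \<open>p0\<close> that avoids
    \<open>A0\<close> and \<open>s\<close> must pass through \<open>w\<close>. Stopping it just
    before \<open>w\<close> keeps it inside \<open>K w\<close>.\<close>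
  have k3: "\<exists>J y. cont J \<and> v \<in> J \<and> J \<subseteq> K w \<and> y \<in> J \<and> dist w y < e" if w: "w \<in> N" and v: "v \<in> K w" and e: "e > 0" for v w e
  proof -
    have vX: "v \<in> X" "v \<notin> A0" "v \<noteq> s" "v \<noteq> w" using v KX unfolding G_def by blast+
    have sP: "s \<notin> P" using sb \<delta>A(2) by blast
    obtain L where L: "cont L" "v \<in> L" "p0 \<in> L" "L \<inter> (A0 \<union> {s}) = {}"
      using via[OF vX(1-3) sX sP] by blast
    have "L \<inter> {w} \<noteq> {}" using hits[OF w L(1-3) v] L(4) by blast
    from boundary_bumping_near[OF contD(3,4)[OF L(1)] L(2) closed_singleton this _ e] vX(4)
    obtain J y where J: "compact J" "connected J" "J \<subseteq> L" "v \<in> J" "J \<inter> {w} = {}" "y \<in> J" "infdist y {w} < e"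
      by (metis singletonD)
    have JX: "J \<subseteq> X" using J(3) contD(1)[OF L(1)] by blast
    have cJ: "cont J" using contI[OF JX J(4,1,2)] .
    have "J \<inter> G w = {}" unfolding G_def using J(3,5) L(4) by blast
    then have "J \<subseteq> K w" using stay[OF cJ J(4) v] by blast
    moreover have "dist w y < e" using J(7) by (simp add: dist_commute)
    ultimately show ?thesis using cJ J(4,6) by blast
  qed
  \<comment> \<open>A continuum in \<open>K w\<close> that comes close to \<open>w\<close> enters
    the open set \<open>reach R (G w')\<close>, to which \<open>w\<close> belongs, without meeting
    \<open>G w'\<close>. So its starting point is not in \<open>K w'\<close>.\<close>
  have k4: "K w \<inter> K w' = {}" if w: "w \<in> N" "w' \<in> N" "w \<noteq> w'" for w w'
  proof (rule ccontr)
    assume "\<not> ?thesis"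
    then obtain v where v: "v \<in> K w" "v \<in> K w'" by blast
    have "w \<in> reach R (G w')" by (rule k2[OF w(2) ND(1,2,4)[OF w(1)] w(3)])
    from reach_ball[OF fR G(2,1)[OF w(2)] this] obtain e where e: "e > 0" "ball w e \<inter> X \<subseteq> reach R (G w')" by blast
    obtain J y where J: "cont J" "v \<in> J" "J \<subseteq> K w" "y \<in> J" "dist w y < e" using k3[OF w(1) v(1) e(1)] by blast
    have "w' \<in> reach R (G w)" using k2[OF w(1) ND(1,2,4)[OF w(2)]] w(3) by blast
    then have "w' \<notin> J" using J(3) unfolding K_def by blast
    then have "J \<inter> G w' = {}" using J(3) KX(2)[of w] unfolding G_def by blast
    moreover have "y \<in> reach R (G w')" using e(2) J(4,5) contD(1)[OF J(1)] by auto
    ultimately have "J \<subseteq> reach R (G w')" using reach_absorb[OF J(1)] J(4) by blast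
    then show False using J(2) v(2) unfolding K_def by blast
  qed
  have k5: "closure (K w) \<subseteq> K w \<union> G w" if w: "w \<in> N" for w
  proof -
    have "closure (K w) \<subseteq> X - reach R (G w)"
      by (rule closure_minimal[OF _ hull_compact(2)[OF fR G(2,1)[OF w]]]) (auto simp: K_def)
    then show ?thesis unfolding K_def by blast
  qed
  have pick: "\<exists>p. p \<in> K w \<and> p \<in> ball z \<delta>" if w: "w \<in> N" for w
  proof -
    obtain v where v: "v \<in> K w" using k1[OF w] by blast
    have "\<delta> - dist z w > 0" using ND(3)[OF w] by simp
    from k3[OF w v this] obtain J y where "J \<subseteq> K w" "y \<in> J" "dist w y < \<delta> - dist z w" by blast
    moreover have "dist z y \<le> dist z w + dist w y" by (rule dist_triangle)
    ultimately show ?thesis by (intro exI[of _ y]) auto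
  qed
  obtain p1 where p1: "p1 \<in> K w1" "p1 \<in> ball z \<delta>" using pick[OF wN(1)] by blast
  obtain p2 where p2: "p2 \<in> K w2" "p2 \<in> ball z \<delta>" using pick[OF wN(2)] by blast
  have pW: "p \<in> W" if "p \<in> K w" "p \<in> ball z \<delta>" "w \<in> N" for p w
  proof (rule ccontr)
    assume n: "p \<notin> W"
    have "dist z p < \<rho>" using that(2) \<delta>(2) by simp
    moreover have "p \<noteq> w" "p \<in> X" using that(1) KX unfolding G_def by blast+
    ultimately have "p \<in> reach R (G w)" using k2[OF that(3) _ n] by blast
    then show False using that(1) unfolding K_def by blast
  qed
  have pW12: "p1 \<in> W" "p2 \<in> W" using pW[OF p1 wN(1)] pW[OF p2 wN(2)] by blast+
  have p12: "p1 \<noteq> p2" using p1(1) p2(1) k4[OF wN(1,2) wd(1)] by blast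
  have pX: "p1 \<in> X" "p1 \<notin> A0" "p1 \<noteq> s" "p2 \<in> X" "p2 \<notin> A0" "p2 \<noteq> s" "p1 \<notin> P" "p2 \<notin> P"
    using p1 p2 KX \<delta>A(2) unfolding G_def by blast+
  define Q where "Q = reach R (A0 \<union> {p1,p2})"
  have RQ: "R \<inter> (A0 \<union> {p1,p2}) = {}" "closed (A0 \<union> {p1,p2})" using okF[of "{p1,p2}"] p1 p2 by auto
  have CQ: "v \<in> Q" if v: "v \<in> X" "v \<notin> W" "dist z v < \<rho>" for v
    unfolding Q_def by (rule C_reach[OF v sX(1) sb]) (use s(1) v(2) pW12 in blast)+
  have wQ: "w \<in> Q" if "w \<in> N" for w using CQ[OF ND(1,2,4)[OF that]] .
  have Qabs: "J \<subseteq> Q" if "cont J" "J \<inter> (A0 \<union> {p1,p2}) = {}" "J \<inter> Q \<noteq> {}" for J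
    using reach_absorb[OF that(1,2)] that(3) unfolding Q_def by blast
  \<comment> \<open>From a point of \<open>K w3\<close> there are continua to \<open>s\<close> and
    to \<open>w3\<close> within the closure of \<open>K w3\<close>, which contains neither
    \<open>p1\<close> nor \<open>p2\<close>. This is the bypass: \<open>w3\<close> is in
    \<open>Q\<close>, hence so is \<open>s\<close>.\<close>
  have sQ: "s \<in> Q"
  proof -
    obtain v where v: "v \<in> K w3" using k1[OF wN(3)] by blast
    have vX: "v \<in> X" "v \<notin> A0" "v \<noteq> s" "v \<noteq> w3" using v KX unfolding G_def by blast+
    have M: "\<exists>M. cont M \<and> v \<in> M \<and> q \<in> M \<and> M \<inter> (A0 \<union> {p1,p2}) = {}"
      if "q = s \<and> q' = w3 \<or> q = w3 \<and> q' = s" for q q'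
    proof -
      have q: "{q,q'} = {s,w3}" using that by auto
      have "s \<notin> P" using sb \<delta>A(2) by blast
      then have q': "q' \<in> X" "q' \<notin> A0" "q' \<notin> P" "v \<noteq> q'" "v \<noteq> q"
        using that sX ND(1,5,7)[OF wN(3)] vX(3,4) by auto
      obtain L where L: "cont L" "v \<in> L" "p0 \<in> L" "L \<inter> (A0 \<union> {q'}) = {}"
        using via[OF vX(1,2) q'(4) q'(1-3)] by blast
      have "L \<inter> {s,w3} \<noteq> {}" using hits[OF wN(3) L(1-3) v] L(4) by blast
      then have Lq: "L \<inter> {q} \<noteq> {}" using q L(4) by blast
      have vq: "v \<notin> {q}" using q'(5) by blast
      note b = bumping_closure[OF contD(3,4)[OF L(1)] L(2) closed_singleton Lq vq]
      define M where "M = closure (reach_in L {q} v)"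
      have "reach_in L {q} v \<subseteq> K w3"
      proof
        fix y assume "y \<in> reach_in L {q} v"
        then obtain J where J: "compact J" "connected J" "v \<in> J" "J \<subseteq> L - {q}" "y \<in> J" unfolding reach_in_def by blast
        have "J \<subseteq> X" using J(4) contD(1)[OF L(1)] by blast
        then have cJ: "cont J" using contI[OF _ J(3,1,2)] by blast
        have "J \<inter> G w3 = {}" unfolding G_def q[symmetric] using J(4) L(4) by blast
        then show "y \<in> K w3" using stay[OF cJ J(3) v] J(5) by blast
      qed
      then have "M \<subseteq> closure (K w3)" unfolding M_def by (rule closure_mono)
      then have MK: "M \<subseteq> K w3 \<union> G w3" using k5[OF wN(3)] by blast
      have "p1 \<notin> K w3" "p2 \<notin> K w3" using p1(1) p2(1) k4[OF wN(1,3) wd(2)] k4[OF wN(2,3) wd(3)] by blast+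
      moreover have "p1 \<noteq> w3" "p2 \<noteq> w3" using pW12 w3(2) by blast+
      ultimately have "M \<inter> {p1,p2} = {}" using MK pX unfolding G_def by blast
      moreover have "M \<inter> A0 = {}" unfolding M_def using b(3) L(4) by blast
      moreover have "cont M" unfolding M_def
        using contI[OF order_trans[OF b(3) contD(1)[OF L(1)]] b(4,1,2)] .
      ultimately show ?thesis using b(4,5) unfolding M_def by blast
    qed
    obtain M1 where M1: "cont M1" "v \<in> M1" "s \<in> M1" "M1 \<inter> (A0 \<union> {p1,p2}) = {}"
      using M[of s w3] by blast
    obtain M2 where M2: "cont M2" "v \<in> M2" "w3 \<in> M2" "M2 \<inter> (A0 \<union> {p1,p2}) = {}"
      using M[of w3 s] by blast
    have "M2 \<subseteq> Q" using Qabs[OF M2(1,4)] wQ[OF wN(3)] M2(3) by blast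
    then have "M1 \<subseteq> Q" using Qabs[OF M1(1,4)] M1(2) M2(2) by blast
    then show ?thesis using M1(3) by blast
  qed
  have Qball: "\<exists>e>0. ball y e \<inter> X \<subseteq> Q" if "y \<in> Q" for y
    using reach_ball[OF fR RQ(2,1)] that unfolding Q_def by blast
  \<comment> \<open>The continuum \<open>L\<close> avoids \<open>p\<close> and is followed until it
    is close to \<open>s\<close> or \<open>w\<close>, where the open set \<open>Q\<close> is
    entered. Up to that point it misses \<open>G w\<close>, and by \<open>av\<close> it then misses
    \<open>p'\<close> too.\<close>
  have fin: "v \<in> Q"
    if L: "cont L" "v \<in> L" "L \<inter> (A0 \<union> {p}) = {}" and p: "{p,p'} = {p1,p2}" and w: "w \<in> N"
      and v: "v \<noteq> s" "v \<noteq> w" and Lw: "L \<inter> {s,w} \<noteq> {}"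
      and av: "\<And>J. cont J \<Longrightarrow> v \<in> J \<Longrightarrow> J \<inter> G w = {} \<Longrightarrow> p' \<notin> J" for L v p p' w
  proof -
    obtain e1 where e1: "e1 > 0" "ball s e1 \<inter> X \<subseteq> Q" using Qball[OF sQ] by blast
    obtain e2 where e2: "e2 > 0" "ball w e2 \<inter> X \<subseteq> Q" using Qball[OF wQ[OF w]] by blast
    define e where "e = min e1 e2"
    have e: "e > 0" "e \<le> e1" "e \<le> e2" using e1 e2 unfolding e_def by auto
    have cl: "closed {s,w}" and vn: "v \<notin> {s,w}" using v by auto
    from boundary_bumping_near[OF contD(3,4)[OF L(1)] L(2) cl Lw vn e(1)]
    obtain J y where J: "compact J" "connected J" "J \<subseteq> L" "v \<in> J" "J \<inter> {s,w} = {}" "y \<in> J" "infdist y {s,w} < e"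
      by (elim exE conjE)
    have JX: "J \<subseteq> X" using J(3) contD(1)[OF L(1)] by blast
    have cJ: "cont J" using contI[OF JX J(4,1,2)] .
    have "J \<inter> G w = {}" unfolding G_def using J(3,5) L(3) by blast
    then have "p' \<notin> J" using av[OF cJ J(4)] by blast
    then have Jp: "J \<inter> (A0 \<union> {p1,p2}) = {}" using J(3) L(3) p by blast
    obtain q where q: "q \<in> {s,w}" "dist q y < e" using near_finite[OF J(7)] by blast
    have "y \<in> Q"
    proof (cases "q = s")
      case True
      then have "y \<in> ball s e1" using q(2) e by simp
      then show ?thesis using e1(2) J(6) JX by blast
    next
      case False
      then have "y \<in> ball w e2" using q e by simp
      then show ?thesis using e2(2) J(6) JX by blast
    qed
    then show ?thesis using Qabs[OF cJ Jp] J(4,6) by blast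
  qed
  have "v \<in> Q" if v: "v \<in> X" "v \<notin> A0" "v \<noteq> p1" "v \<noteq> p2" for v
  proof (cases "v = s \<or> v = w1 \<or> v = w2")
    case True
    then show ?thesis using sQ wQ wN by blast
  next
    case False
    then have vn: "v \<noteq> s" "v \<noteq> w1" "v \<noteq> w2" by blast+
    obtain L where L: "cont L" "v \<in> L" "p0 \<in> L" "L \<inter> (A0 \<union> {p1}) = {}"
      using via[OF v(1-3) pX(1,2,7)] by blast
    have LA0: "L \<inter> A0 = {}" using L(4) by blast
    \<comment> \<open>A continuum staying in \<open>K w1\<close> cannot contain \<open>p2\<close>,
      and one staying in \<open>K w2\<close> cannot contain \<open>p1\<close>. In the remaining case
      \<open>v\<close> is not cut off by \<open>s\<close> and \<open>w2\<close>, so a continuum from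
      \<open>v\<close> off \<open>G w2\<close> avoids \<open>p2\<close>, a point of
      \<open>K w2\<close>.\<close>
    consider "v \<in> K w1" | "v \<in> K w2" | "v \<notin> K w1" "v \<notin> K w2" by blast
    then show ?thesis
    proof cases
      case 1
      show ?thesis
      proof (rule fin[OF L(1,2,4) refl wN(1) vn(1,2) hits[OF wN(1) L(1-3) 1 LA0]])
        fix J assume "cont J" "v \<in> J" "J \<inter> G w1 = {}"
        then have "J \<subseteq> K w1" using stay 1 by blast
        then show "p2 \<notin> J" using p2(1) k4[OF wN(1,2) wd(1)] by blast
      qed
    next
      case 2
      obtain L' where L': "cont L'" "v \<in> L'" "p0 \<in> L'" "L' \<inter> (A0 \<union> {p2}) = {}"
        using via[OF v(1,2,4) pX(4,5,8)] by blast
      have L'A0: "L' \<inter> A0 = {}" using L'(4) by blast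
      show ?thesis
      proof (rule fin[OF L'(1,2,4) insert_commute wN(2) vn(1,3) hits[OF wN(2) L'(1-3) 2 L'A0]])
        fix J assume "cont J" "v \<in> J" "J \<inter> G w2 = {}"
        then have "J \<subseteq> K w2" using stay 2 by blast
        then show "p1 \<notin> J" using p1(1) k4[OF wN(1,2) wd(1)] by blast
      qed
    next
      case 3
      have vok: "v \<in> reach R (G w2)" using 3(2) v(1,2) vn unfolding K_def G_def by blast
      show ?thesis
      proof (cases "p2 \<in> L")
        case False
        then have "L \<inter> (A0 \<union> {p1,p2}) = {}" using L(4) by blast
        moreover have "L \<inter> R \<noteq> {}" using L(3) p0R by blast
        ultimately show ?thesis unfolding Q_def using reachI[OF L(1,2)] by blast
      next
        case True
        have "L \<inter> {s,w2} \<noteq> {}" using hits[OF wN(2) L(1) True L(3) p2(1) LA0] .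
        then show ?thesis
        proof (rule fin[OF L(1,2,4) refl wN(2) vn(1,3)])
          fix J assume J: "cont J" "v \<in> J" "J \<inter> G w2 = {}"
          then have "J \<subseteq> reach R (G w2)" using reach_absorb[OF J(1,3)] vok by blast
          then show "p2 \<notin> J" using p2(1) unfolding K_def by blast
        qed
      qed
    qed
  qed
  then have "X - (A0 \<union> {p1,p2}) \<subseteq> reach R (A0 \<union> {p1,p2})" unfolding Q_def by blast
  then have "nonsep (A0 \<union> {p1,p2})" using reach_nonsep[OF R(1) RQ(1)] by blast
  then show False using two[OF pX(1,2,4,5) p12] by blast
qed

end

lemma card_pos_obtain: "card A > 0 \<Longrightarrow> \<exists>x. x \<in> A"
  by (metis card.empty ex_in_conv less_nat_zero_code)

section \<open>The critical number of points is one\<close>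

context hereditary_kelley
begin

context
  fixes k :: nat and A P :: "'a set"
  assumes k: "1 \<le> k" "all_nonsep k" "\<forall>F. finite F \<longrightarrow> F \<subseteq> X \<longrightarrow> card F = Suc k \<longrightarrow> \<not> nonsep F"
    and A: "finite A" "A \<subseteq> X" "card A = Suc k" and P: "fat P" "P \<inter> A = {}"
begin

text \<open>\<open>A\<close> is split into a set \<open>A0\<close> of \<open>k - 1\<close> points
  and two more points. Relative to \<open>A0\<close>, one added point never blocks and two distinct
  added points always do, which is the situation of \<open>piece_boundary\<close>.\<close>

lemma piece_closure: "closure (reach P A) \<subseteq> reach P A \<union> A"
proof -
  obtain a where a: "a \<in> A" using card_pos_obtain[of A] A(3) by auto
  have "card (A - {a}) > 0" using A a k(1) by simp
  then obtain b where b: "b \<in> A" "b \<noteq> a" using card_pos_obtain by blast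
  define A0 where "A0 = A - {a,b}"
  have A0: "A = A0 \<union> {a,b}" "finite A0" "A0 \<subseteq> X" "a \<notin> A0" "b \<notin> A0" unfolding A0_def using A a b by auto
  have c: "card A0 = k - 1"
    unfolding A0_def using A a b by (simp add: card_Diff_subset)
  have "closure (reach P (A0 \<union> {a,b})) \<subseteq> reach P (A0 \<union> {a,b}) \<union> (A0 \<union> {a,b})"
  proof (rule piece_boundary[OF A0(2,3)])
    show "nonsep (A0 \<union> {x})" if "x \<in> X" "x \<notin> A0" for x
      using all_nonsepD[OF k(2), of "A0 \<union> {x}"] A0(2,3) c that k(1) by simp
    show "\<not> nonsep (A0 \<union> {x, y})" if "x \<in> X" "x \<notin> A0" "y \<in> X" "y \<notin> A0" "x \<noteq> y" for x y
      using k(3)[rule_format, of "A0 \<union> {x,y}"] A0(2,3) c that k(1) by simp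
    show "a \<in> X" "b \<in> X" using a b A(2) by blast+
    show "fat P" "P \<inter> (A0 \<union> {a,b}) = {}" using P A0(1) by simp_all
  qed
  then show ?thesis using A0(1) by simp
qed

lemma piece_proper: "\<exists>s. s \<in> X \<and> s \<notin> A \<and> s \<notin> reach P A"
proof (rule ccontr)
  assume "\<not> ?thesis"
  then have "X - A \<subseteq> reach P A" by blast
  then show False using reach_nonsep[OF fat_cont[OF P(1)] P(2)] k(3)[rule_format, OF A] by blast
qed

lemma piece_closed: "closed A" "closed (X - reach P A)"
  using A(1) hull_compact(2)[OF P(1) _ P(2)] by (simp_all add: finite_imp_closed)

text \<open>Replace \<open>i\<close> and \<open>j\<close> in \<open>A\<close> by whichever of
  \<open>r\<close>, \<open>s\<close> lies on the side of \<open>z\<close>. At most \<open>k\<close>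
  points remain, so a continuum from \<open>z\<close> to \<open>i\<close> avoids them. Stopped at
  \<open>{i,j}\<close>, it stays on the side of \<open>z\<close> up to points of \<open>A\<close>
  and hence misses the other of \<open>r\<close>, \<open>s\<close>.\<close>

lemma piece_reach:
  assumes ij: "i \<in> A" "j \<in> A" "i \<noteq> j" and r: "r \<in> reach P A" and s: "s \<in> X" "s \<notin> A" "s \<notin> reach P A"
    and z: "z \<in> X" "z \<notin> A" "z \<noteq> r" "z \<noteq> s"
  shows "\<exists>M. cont M \<and> z \<in> M \<and> M \<inter> {i,j} \<noteq> {} \<and> M \<inter> ({r,s} \<union> (A - {i,j})) = {}"
proof -
  have rX: "r \<in> X" "r \<notin> A" using r reach_sub[of P A] by blast+
  have c: "card (A - {i,j}) = k - 1" using A ij by (simp add: card_Diff_subset)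
  define q where "q = (if z \<in> reach P A then r else s)"
  define H where "H = {q} \<union> (A - {i,j})"
  have q: "q \<in> X" "q \<notin> A" "z \<noteq> q" unfolding q_def using rX s z by auto
  have "finite H" "H \<subseteq> X" "card H \<le> k" unfolding H_def using A q(1,2) c k(1) by auto
  then have "nonsep H" by (rule all_nonsepD[OF k(2)])
  moreover have "z \<notin> H" "i \<in> X" "i \<notin> H" unfolding H_def using z q ij A by blast+
  ultimately obtain L where L: "cont L" "z \<in> L" "i \<in> L" "L \<inter> H = {}" using nonsepD[of H z i] z(1) by blast
  have cl: "closed {i,j}" and Li: "L \<inter> {i,j} \<noteq> {}" and zi: "z \<notin> {i,j}" using L(3) ij z(2) by auto
  define M where "M = closure (reach_in L {i,j} z)"
  note b = bumping_closure[OF contD(3,4)[OF L(1)] L(2) cl Li zi, folded M_def]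
  define V where "V = (if z \<in> reach P A then reach P A else X - (A \<union> reach P A))"
  have RV: "reach_in L {i,j} z \<subseteq> V"
  proof
    fix y assume "y \<in> reach_in L {i,j} z"
    then obtain J where J: "compact J" "connected J" "z \<in> J" "J \<subseteq> L - {i,j}" "y \<in> J" unfolding reach_in_def by blast
    have JX: "J \<subseteq> X" using J(4) contD(1)[OF L(1)] by blast
    have cJ: "cont J" using contI[OF JX J(3,1,2)] .
    have JA: "J \<inter> A = {}" using J(4) L(4) unfolding H_def by blast
    show "y \<in> V"
    proof (cases "z \<in> reach P A")
      case True
      then show ?thesis unfolding V_def using reach_absorb[OF cJ JA] J(3,5) by auto
    next
      case False
      then have "J \<inter> reach P A = {}" using reach_absorb[OF cJ JA] J(3) by blast
      then show ?thesis unfolding V_def using False J(5) JX JA by auto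
    qed
  qed
  have "M \<inter> {r,s} = {}"
  proof (cases "z \<in> reach P A")
    case True
    then have "M \<subseteq> reach P A \<union> A" using closure_mono[OF RV] piece_closure unfolding M_def V_def by simp
    then have "s \<notin> M" using s by blast
    moreover have "r \<notin> M" using b(3) L(4) True unfolding H_def q_def by auto
    ultimately show ?thesis by blast
  next
    case False
    have "M \<subseteq> X - reach P A" unfolding M_def
      by (rule closure_minimal[OF _ piece_closed(2)]) (use RV False in \<open>auto simp: V_def\<close>)
    then have "r \<notin> M" using r by blast
    moreover have "s \<notin> M" using b(3) L(4) False unfolding H_def q_def by auto
    ultimately show ?thesis by blast
  qed
  moreover have "M \<inter> (A - {i,j}) = {}" using b(3) L(4) unfolding H_def by blast
  moreover have "cont M" using contI[OF order_trans[OF b(3) contD(1)[OF L(1)]] b(4,1,2)] .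
  ultimately show ?thesis using b(4,5) by blast
qed

text \<open>Such a continuum would contain both points at which all others can arrive, so the
  complement of the \<open>k + 1\<close> points \<open>{r,s} \<union> (A - {i,j})\<close> would be
  continuumwise connected, against the choice of \<open>k\<close>.\<close>

lemma piece_no_join:
  assumes ij: "i \<in> A" "j \<in> A" "i \<noteq> j" and r: "r \<in> reach P A" and s: "s \<in> X" "s \<notin> A" "s \<notin> reach P A"
    and L: "cont L" "i \<in> L" "j \<in> L" "L \<inter> ({r,s} \<union> (A - {i,j})) = {}"
  shows False
proof -
  have rX: "r \<in> X" "r \<notin> A" using r reach_sub[of P A] by blast+
  have rs: "r \<noteq> s" using r s by blast
  define G where "G = {r,s} \<union> (A - {i,j})"
  have "card (A - {i,j}) = k - 1" using A ij by (simp add: card_Diff_subset)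
  then have G: "finite G" "G \<subseteq> X" "card G = Suc k" unfolding G_def using A rX s rs k(1) by auto
  have LG: "L \<inter> G = {}" unfolding G_def by (rule L(4))
  have "X - G \<subseteq> reach L G"
  proof
    fix z assume z: "z \<in> X - G"
    show "z \<in> reach L G"
    proof (cases "z \<in> {i,j}")
      case True
      then show ?thesis using reach_base[OF L(1) LG] L(2,3) by blast
    next
      case False
      then have "z \<notin> A" "z \<noteq> r" "z \<noteq> s" using z unfolding G_def by blast+
      then obtain M where M: "cont M" "z \<in> M" "M \<inter> {i,j} \<noteq> {}" "M \<inter> ({r,s} \<union> (A - {i,j})) = {}"
        using piece_reach[OF ij r s, of z] z by blast
      have "M \<inter> L \<noteq> {}" using M(3) L(2,3) by blast
      then show ?thesis using reachI[OF M(1,2)] M(4) unfolding G_def by blast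
    qed
  qed
  then show False using reach_nonsep[OF L(1) LG] k(3)[rule_format, OF G] by blast
qed

text \<open>If \<open>A\<close> had three points, then for each pair of them some continuum from
  \<open>z\<close> off \<open>r\<close> and \<open>s\<close> would meet \<open>A\<close> in exactly
  one point, a member of that pair. Since no two points of \<open>A\<close> can be joined this way,
  the same point arises each time, but no point belongs to all three pairs.\<close>

lemma critical_eq_1: "k = 1"
proof (rule ccontr)
  assume "k \<noteq> 1"
  then have k2: "k \<ge> 2" using k(1) by simp
  obtain i where i: "i \<in> A" using card_pos_obtain[of A] A(3) by auto
  have "card (A - {i}) > 0" using A i k2 by simp
  then obtain j where j: "j \<in> A" "j \<noteq> i" using card_pos_obtain by blast
  have "card (A - {i,j}) > 0" using A i j k2 by (simp add: card_Diff_subset)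
  then obtain l where l: "l \<in> A" "l \<noteq> i" "l \<noteq> j" using card_pos_obtain by blast
  have cP: "cont P" using fat_cont[OF P(1)] .
  obtain r where "r \<in> P" using contD(2)[OF cP] by blast
  then have r: "r \<in> reach P A" using reach_base[OF cP P(2)] by blast
  have rX: "r \<in> X" using r reach_sub[of P A] by blast
  obtain s where s: "s \<in> X" "s \<notin> A" "s \<notin> reach P A" using piece_proper by blast
  obtain G where G: "open G" "reach P A = G \<inter> X" using reach_open[OF P(1) piece_closed(1) P(2)] by blast
  have "\<not> G \<inter> X \<subseteq> {r}"
    by (rule finite_not_dense) (use G r rX in auto)
  then obtain z where z: "z \<in> reach P A" "z \<noteq> r" using G(2) by blast
  then have zz: "z \<in> X" "z \<notin> A" "z \<noteq> r" "z \<noteq> s" using reach_sub[of P A] s by blast+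
  have ends: "\<exists>M e. cont M \<and> z \<in> M \<and> e \<in> {i',j'} \<and> M \<inter> A = {e} \<and> r \<notin> M \<and> s \<notin> M"
    if ij: "i' \<in> A" "j' \<in> A" "i' \<noteq> j'" for i' j'
  proof -
    obtain M where M: "cont M" "z \<in> M" "M \<inter> {i',j'} \<noteq> {}" "M \<inter> ({r,s} \<union> (A - {i',j'})) = {}"
      using piece_reach[OF ij r s zz] by blast
    have "\<not> (i' \<in> M \<and> j' \<in> M)" using piece_no_join[OF ij r s M(1) _ _ M(4)] by blast
    then have "M \<inter> A = {i'} \<or> M \<inter> A = {j'}" using M(3,4) ij by blast
    then show ?thesis using M by blast
  qed
  have uniq: "e = e'" if M: "cont M" "z \<in> M" "M \<inter> A = {e}" "r \<notin> M" "s \<notin> M"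
    and M': "cont M'" "z \<in> M'" "M' \<inter> A = {e'}" "r \<notin> M'" "s \<notin> M'" for M M' e e'
  proof (rule ccontr)
    assume ne: "e \<noteq> e'"
    have eA: "e \<in> A" "e' \<in> A" using M(3) M'(3) by blast+
    have c: "cont (M \<union> M')" using cont_Un[OF M(1) M'(1)] M(2) M'(2) by blast
    have "(M \<union> M') \<inter> ({r,s} \<union> (A - {e,e'})) = {}" using M M' by blast
    from piece_no_join[OF eA ne r s c _ _ this] show False using M(3) M'(3) by blast
  qed
  obtain M1 e1 where 1: "cont M1" "z \<in> M1" "e1 \<in> {i,j}" "M1 \<inter> A = {e1}" "r \<notin> M1" "s \<notin> M1"
    using ends[OF i j(1) j(2)[symmetric]] by blast
  obtain M2 e2 where 2: "cont M2" "z \<in> M2" "e2 \<in> {i,l}" "M2 \<inter> A = {e2}" "r \<notin> M2" "s \<notin> M2"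
    using ends[OF i l(1) l(2)[symmetric]] by blast
  obtain M3 e3 where 3: "cont M3" "z \<in> M3" "e3 \<in> {j,l}" "M3 \<inter> A = {e3}" "r \<notin> M3" "s \<notin> M3"
    using ends[OF j(1) l(1) l(3)[symmetric]] by blast
  have "e1 = e2" "e1 = e3" using uniq[OF 1(1,2,4-6) 2(1,2,4-6)] uniq[OF 1(1,2,4-6) 3(1,2,4-6)] by blast+
  then show False using 1(3) 2(3) 3(3) j l by blast
qed

end

lemma not_nonsep_pair:
  assumes "a \<in> X" "b \<in> X" "a \<noteq> b"
  shows "\<not> nonsep {a,b}"
proof -
  obtain k where k: "1 \<le> k" "all_nonsep k" "\<forall>F. finite F \<longrightarrow> F \<subseteq> X \<longrightarrow> card F = Suc k \<longrightarrow> \<not> nonsep F"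
    using exists_critical by blast
  have "infinite X" using finite_proper[of X] by blast
  then obtain A where A: "finite A" "A \<subseteq> X" "card A = Suc k"
    using infinite_arbitrarily_large[of X "Suc k"] by blast
  obtain P where "fat P" "P \<inter> A = {}"
    using fat_avoiding[OF finite_imp_closed[OF A(1)] A(2) finite_proper[OF A(1,2)]] by blast
  then have "k = 1" by (rule critical_eq_1[OF k A])
  then show ?thesis using k(3)[rule_format, of "{a,b}"] assms by simp
qed

text \<open>The last clause is a duality: one point on each side of \<open>{a,b}\<close> gives a
  pair separating \<open>a\<close> from \<open>b\<close>. These cuts will order each side from
  \<open>a\<close> to \<open>b\<close>.\<close>

lemma separation:
  assumes "a \<in> X" "b \<in> X" "a \<noteq> b"
  shows "\<exists>W V. W \<union> V = X - {a,b} \<and> W \<inter> V = {} \<and> W \<noteq> {} \<and> V \<noteq> {} \<and>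
    closed (W \<union> {a,b}) \<and> closed (V \<union> {a,b}) \<and>
    (\<forall>r\<in>W. \<forall>s\<in>V. \<exists>C D. closed C \<and> closed D \<and> C \<union> D = X \<and> C \<inter> D = {r,s} \<and> a \<in> C \<and> b \<in> D)"
proof -
  have k3: "\<forall>F. finite F \<longrightarrow> F \<subseteq> X \<longrightarrow> card F = Suc 1 \<longrightarrow> \<not> nonsep F"
    using not_nonsep_pair by (auto simp: card_Suc_eq numeral_2_eq_2)
  have main: "closed (reach P {a,b} \<union> {a,b}) \<and> closed ((X - ({a,b} \<union> reach P {a,b})) \<union> {a,b}) \<and>
      X - ({a,b} \<union> reach P {a,b}) \<noteq> {} \<and> reach P {a,b} \<noteq> {}"
    if ab: "a \<in> X" "b \<in> X" "a \<noteq> b" and P: "fat P" "P \<inter> {a,b} = {}" for a b P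
  proof -
    have A: "finite {a,b}" "{a,b} \<subseteq> X" "card {a,b} = Suc 1" using ab by auto
    note ctx = le_refl[of 1] all_nonsep_1 k3 A P
    have "closure (reach P {a,b} \<union> {a,b}) \<subseteq> reach P {a,b} \<union> {a,b}"
      unfolding closure_Un using piece_closure[OF ctx] closure_closed[OF finite_imp_closed[OF A(1)]] by blast
    then have "closed (reach P {a,b} \<union> {a,b})" using closure_subset_eq by blast
    moreover have "(X - ({a,b} \<union> reach P {a,b})) \<union> {a,b} = X - reach P {a,b}"
      using ab reach_sub[of P "{a,b}"] by blast
    then have "closed ((X - ({a,b} \<union> reach P {a,b})) \<union> {a,b})" using piece_closed(2)[OF ctx] by simp
    moreover have "X - ({a,b} \<union> reach P {a,b}) \<noteq> {}" using piece_proper[OF ctx] by blast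
    moreover have "reach P {a,b} \<noteq> {}" using reach_base[OF fat_cont[OF P(1)] P(2)] contD(2)[OF fat_cont[OF P(1)]] by blast
    ultimately show ?thesis by blast
  qed
  have ex: "\<exists>P. fat P \<and> P \<inter> {a,b} = {}" if "a \<in> X" "b \<in> X" for a b
    using fat_avoiding[of "{a,b}"] finite_proper[of "{a,b}"] that by (simp add: finite_imp_closed)
  obtain P where P: "fat P" "P \<inter> {a,b} = {}" using ex[OF assms(1,2)] by blast
  have A: "finite {a,b}" "{a,b} \<subseteq> X" "card {a,b} = Suc 1" using assms by auto
  note ctx = le_refl[of 1] all_nonsep_1 k3 A P
  define W where "W = reach P {a,b}"
  define V where "V = X - ({a,b} \<union> W)"
  have WX: "W \<subseteq> X - {a,b}" unfolding W_def by (rule reach_sub)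
  have sep: "\<exists>C D. closed C \<and> closed D \<and> C \<union> D = X \<and> C \<inter> D = {r,s} \<and> a \<in> C \<and> b \<in> D"
    if r: "r \<in> W" and s: "s \<in> V" for r s
  proof -
    have rs: "r \<in> X" "s \<in> X" "r \<noteq> s" "a \<notin> {r,s}" "b \<notin> {r,s}" using r s WX unfolding V_def by blast+
    have r': "r \<in> reach P {a,b}" and s': "s \<in> X" "s \<notin> {a,b}" "s \<notin> reach P {a,b}"
      using r s unfolding W_def V_def by blast+
    obtain Q where Q: "fat Q" "Q \<inter> {r,s} = {}" using ex[OF rs(1,2)] by blast
    define W' where "W' = reach Q {r,s}"
    define V' where "V' = X - ({r,s} \<union> W')"
    have m: "closed (W' \<union> {r,s})" "closed (V' \<union> {r,s})" "V' \<noteq> {}" "W' \<noteq> {}"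
      using main[OF rs(1-3) Q] unfolding W'_def V'_def by blast+
    have cQ: "cont Q" using fat_cont[OF Q(1)] .
    have ij: "a \<in> {a,b}" "b \<in> {a,b}" by blast+
    have d: "{a,b} - {a,b} = {}" by blast
    have nj: False if "cont L" "a \<in> L" "b \<in> L" "L \<inter> {r,s} = {}" for L
      using piece_no_join[OF ctx ij assms(3) r' s' that(1-3)] that(4) d by simp
    \<comment> \<open>The piece \<open>W'\<close> contains exactly one of \<open>a\<close> and
      \<open>b\<close>: not both, since no continuum joins them off \<open>{r,s}\<close>, and not
      neither, since every other point is joined to one of them off \<open>{r,s}\<close>.\<close>
    have n1: "\<not> (a \<in> W' \<and> b \<in> W')"
      using reach_join[OF cQ Q(2), of a b] nj unfolding W'_def by blast
    have n2: "a \<in> W' \<or> b \<in> W'"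
    proof (rule ccontr)
      assume n: "\<not> ?thesis"
      obtain z where z: "z \<in> W'" using m(4) by blast
      have zz: "z \<in> X" "z \<notin> {a,b}" "z \<noteq> r" "z \<noteq> s" using z n reach_sub[of Q "{r,s}"] unfolding W'_def by blast+
      obtain M where M: "cont M" "z \<in> M" "M \<inter> {a,b} \<noteq> {}" "M \<inter> ({r,s} \<union> ({a,b} - {a,b})) = {}"
        using piece_reach[OF ctx ij assms(3) r' s' zz] by blast
      have "M \<inter> {r,s} = {}" using M(4) by blast
      then have "M \<subseteq> W'" unfolding W'_def using reach_absorb[OF M(1)] M(2) z unfolding W'_def by blast
      then show False using M(3) n by blast
    qed
    have cov: "(W' \<union> {r,s}) \<union> (V' \<union> {r,s}) = X" "(W' \<union> {r,s}) \<inter> (V' \<union> {r,s}) = {r,s}"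
      unfolding V'_def W'_def using rs reach_sub[of Q "{r,s}"] by blast+
    show ?thesis
    proof (cases "a \<in> W'")
      case True
      then have "b \<in> V'" using n1 assms(2) rs(5) unfolding V'_def by blast
      then show ?thesis using True m(1,2) cov by - (rule exI[of _ "W' \<union> {r,s}"], rule exI[of _ "V' \<union> {r,s}"], simp)
    next
      case False
      then have "b \<in> W'" "a \<in> V'" using n2 assms(1) rs(4) unfolding V'_def by blast+
      then show ?thesis using m(1,2) cov
        by - (rule exI[of _ "V' \<union> {r,s}"], rule exI[of _ "W' \<union> {r,s}"], simp add: Un_commute Int_commute rs(1) insert_absorb)
    qed
  qed
  have "W \<union> V = X - {a,b}" "W \<inter> V = {}" unfolding V_def using WX by blast+
  moreover have "closed (W \<union> {a,b})" "closed (V \<union> {a,b})" "V \<noteq> {}" "W \<noteq> {}"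
    using main[OF assms P] unfolding W_def V_def by blast+
  moreover have "\<forall>r\<in>W. \<forall>s\<in>V. \<exists>C D. closed C \<and> closed D \<and> C \<union> D = X \<and> C \<inter> D = {r,s} \<and> a \<in> C \<and> b \<in> D"
    by (intro ballI sep)
  ultimately show ?thesis by - (rule exI[of _ W], rule exI[of _ V], intro conjI)
qed

end

section \<open>Recognition of the circle\<close>

text \<open>In a separation of \<open>C\<close>, the part without \<open>r\<close> is disjoint from
  \<open>D\<close>, so it would also split off from \<open>H\<close>.\<close>

lemma connected_part:
  fixes H :: "'a::metric_space set"
  assumes "connected H" "closed C" "closed D" "C \<union> D = H" "C \<inter> D = {r}"
  shows "connected C"
  unfolding connected_closed_set[OF assms(2)]
proof
  assume "\<exists>A B. closed A \<and> closed B \<and> A \<noteq> {} \<and> B \<noteq> {} \<and> A \<union> B = C \<and> A \<inter> B = {}"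
  then obtain A B where AB: "closed A" "closed B" "A \<noteq> {}" "B \<noteq> {}" "A \<union> B = C" "A \<inter> B = {}"
    by (elim exE conjE)
  have *: False if "closed A" "closed B" "A \<noteq> {}" "B \<noteq> {}" "A \<union> B = C" "A \<inter> B = {}" "r \<in> A" for A B
  proof -
    have "B \<inter> (A \<union> D) = {}" using that assms(5) by blast
    moreover have "closed (A \<union> D)" using that(1) assms(3) by blast
    moreover have "H \<subseteq> B \<union> (A \<union> D)" using that(5) assms(4) by blast
    moreover have "B \<inter> H \<noteq> {}" "(A \<union> D) \<inter> H \<noteq> {}" using that(3-5) assms(4) by blast+
    ultimately show False using connected_closedD[OF assms(1), of B "A \<union> D"] that(2) by blast
  qed
  have "r \<in> A \<or> r \<in> B" using assms(5) AB(5) by blast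
  moreover have "B \<union> A = C" "B \<inter> A = {}" using AB(5,6) by blast+
  ultimately show False using *[OF AB] *[OF AB(2,1,4,3)] by blast
qed

lemma connected_one_side:
  assumes "connected S" "closed C" "closed D" "S \<subseteq> C \<union> D" "C \<inter> D \<inter> S = {}" "x \<in> S" "x \<in> C"
  shows "S \<subseteq> C"
proof -
  have "C \<inter> S = {} \<or> D \<inter> S = {}" by (rule connected_closedD[OF assms(1,5,4,2,3)])
  moreover have "C \<inter> S \<noteq> {}" using assms(6,7) by blast
  ultimately show ?thesis using assms(4) by blast
qed

lemma compact_separable:
  fixes S :: "'a::metric_space set"
  assumes "compact S"
  shows "\<exists>Q. countable Q \<and> Q \<subseteq> S \<and> S \<subseteq> closure Q"
proof -
  have "\<exists>F. finite F \<and> F \<subseteq> S \<and> S \<subseteq> (\<Union>f\<in>F. ball f (1 / real (Suc n)))" for n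
    by (rule finite_net[OF assms order_refl]) simp
  then obtain F where F: "\<And>n. finite (F n) \<and> F n \<subseteq> S \<and> S \<subseteq> (\<Union>f\<in>F n. ball f (1 / real (Suc n)))"
    by metis
  have "S \<subseteq> closure (\<Union>n. F n)"
  proof
    fix x assume x: "x \<in> S"
    show "x \<in> closure (\<Union>n. F n)" unfolding closure_approachable
    proof (intro allI impI)
      fix e :: real assume "e > 0"
      then obtain n where n: "1 / real (Suc n) < e" by (rule nat_approx_posE)
      have "x \<in> (\<Union>f\<in>F n. ball f (1 / real (Suc n)))" using F[of n] x by blast
      then obtain f where f: "f \<in> F n" "x \<in> ball f (1 / real (Suc n))" by (rule UN_E)
      then have "dist f x < e" using n unfolding mem_ball by linarith
      then show "\<exists>y\<in>\<Union>n. F n. dist y x < e" using f(1) by blast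
    qed
  qed
  moreover have "countable (\<Union>n. F n)" by (intro countable_UN countableI_type countable_finite) (use F in blast)
  moreover have "(\<Union>n. F n) \<subseteq> S" using F by blast
  ultimately show ?thesis by - (rule exI[of _ "\<Union>n. F n"], intro conjI)
qed

text \<open>\<open>C r\<close> and \<open>D r\<close> play the roles of the segments from
  \<open>a\<close> to \<open>r\<close> and from \<open>r\<close> to \<open>b\<close>. The cuts are
  chosen independently of each other, and their nesting is a consequence of connectedness.\<close>

locale cut_ordered =
  fixes H :: "'a::metric_space set" and a b :: 'a and C D :: "'a \<Rightarrow> 'a set"
  assumes cpt: "compact H" and conn: "connected H" and ends: "a \<in> H" "b \<in> H" "a \<noteq> b"
    and cut: "\<And>r. r \<in> H \<Longrightarrow> closed (C r) \<and> closed (D r) \<and> C r \<union> D r = H \<and> C r \<inter> D r = {r} \<and> a \<in> C r \<and> b \<in> D r"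
    and cut_a: "C a = {a}"
begin

lemma cutD:
  assumes "r \<in> H"
  shows "closed (C r)" "closed (D r)" "C r \<union> D r = H" "C r \<inter> D r = {r}" "a \<in> C r" "b \<in> D r" "r \<in> C r" "r \<in> D r"
proof -
  note c = cut[OF assms]
  show "closed (C r)" "closed (D r)" "C r \<union> D r = H" "C r \<inter> D r = {r}" "a \<in> C r" "b \<in> D r" using c by simp_all
  have "r \<in> C r \<inter> D r" using c by simp
  then show "r \<in> C r" "r \<in> D r" by simp_all
qed

lemma cut_unique: "r \<in> H \<Longrightarrow> x \<in> C r \<Longrightarrow> x \<in> D r \<Longrightarrow> x = r"
proof -
  assume "r \<in> H" "x \<in> C r" "x \<in> D r"
  then have "x \<in> C r \<inter> D r" by simp
  then show "x = r" unfolding cutD(4)[OF \<open>r \<in> H\<close>] by simp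
qed

lemma cut_connected:
  assumes "r \<in> H"
  shows "connected (C r)" "connected (D r)"
proof -
  note c = cutD(1-4)[OF assms]
  show "connected (C r)" by (rule connected_part[OF conn c])
  have "D r \<union> C r = H" "D r \<inter> C r = {r}" using c(3,4) by (simp_all add: Un_commute Int_commute)
  then show "connected (D r)" by (rule connected_part[OF conn c(2,1)])
qed

text \<open>\<open>C r\<close> is connected and misses the cut point \<open>s\<close>, so it stays
  on the side of \<open>s\<close> that contains \<open>a\<close>. The same holds for
  \<open>D r\<close> and \<open>b\<close>.\<close>

lemma cut_mono_outside:
  assumes "r \<in> H" "s \<in> H"
  shows "s \<notin> C r \<Longrightarrow> C r \<subseteq> C s" "s \<notin> D r \<Longrightarrow> D r \<subseteq> D s"
proof -
  note c = cutD[OF assms(1)] and d = cutD[OF assms(2)]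
  show "C r \<subseteq> C s" if "s \<notin> C r"
  proof (rule connected_one_side[OF cut_connected(1)[OF assms(1)] d(1,2) _ _ c(5) d(5)])
    show "C r \<subseteq> C s \<union> D s" using c(3) d(3) by blast
    show "C s \<inter> D s \<inter> C r = {}" unfolding d(4) using that by simp
  qed
  show "D r \<subseteq> D s" if "s \<notin> D r"
  proof (rule connected_one_side[OF cut_connected(2)[OF assms(1)] d(2,1) _ _ c(6) d(6)])
    show "D r \<subseteq> D s \<union> C s" using c(3) d(3) by blast
    show "D s \<inter> C s \<inter> D r = {}" unfolding Int_commute[of "D s"] d(4) using that by simp
  qed
qed

lemma cut_mono:
  assumes "r \<in> H" "s \<in> H" "s \<in> D r"
  shows "C r \<subseteq> C s"
proof (cases "r = s")
  case False
  then have "s \<notin> C r" using cut_unique[OF assms(1) _ assms(3)] by blast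
  then show ?thesis by (rule cut_mono_outside(1)[OF assms(1,2)])
qed simp

lemma cut_antisym:
  assumes "r \<in> H" "s \<in> H" "s \<in> C r" "r \<noteq> s"
  shows "r \<in> D s" "r \<notin> C s"
proof -
  have "s \<notin> D r" using cut_unique[OF assms(1,3)] assms(4) by blast
  then have "D r \<subseteq> D s" by (rule cut_mono_outside(2)[OF assms(1,2)])
  then show "r \<in> D s" using cutD(8)[OF assms(1)] by blast
  then show "r \<notin> C s" using cut_unique[OF assms(2)] assms(4) by blast
qed

lemma cut_mono':
  assumes "r \<in> H" "s \<in> H" "s \<in> C r"
  shows "C s \<subseteq> C r"
proof (cases "r = s")
  case False
  then show ?thesis by (rule cut_mono_outside(1)[OF assms(2,1) cut_antisym(2)[OF assms]])
qed simp

lemma cut_total: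
  assumes "r \<in> H" "s \<in> H"
  shows "C r \<subseteq> C s \<or> C s \<subseteq> C r"
  using cut_mono[OF assms] cut_mono'[OF assms] cutD(3)[OF assms(1)] assms(2) by blast

lemma cut_compact:
  assumes "r \<in> H"
  shows "compact (C r)"
proof -
  have "H \<inter> C r = C r" using cutD(3)[OF assms] by blast
  then show ?thesis using compact_Int_closed[OF cpt cutD(1)[OF assms]] by simp
qed

text \<open>Continuity on the right: among the points beyond \<open>y\<close> that are close to \<open>q\<close>, compactness
  gives a first one \<open>m\<close>, and no initial segment ending before \<open>m\<close> comes close to \<open>q\<close>.\<close>

lemma infdist_cut_continuous: "continuous_on H (\<lambda>x. infdist q (C x))"
  unfolding continuous_on_def
proof
  fix y assume y: "y \<in> H"
  show "((\<lambda>x. infdist q (C x)) \<longlongrightarrow> infdist q (C y)) (at y within H)"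
  proof (rule order_tendstoI)
    fix c assume c: "infdist q (C y) < c"
    then obtain z where z: "z \<in> C y" "dist q z < c"
      using infdist_notempty[of "C y" q] cutD(7)[OF y] cINF_less_iff[of "C y" "dist q" c] by (metis bdd_below_image_dist empty_iff)
    have zH: "z \<in> H" using z(1) cutD(3)[OF y] by blast
    \<comment> \<open>If \<open>z\<close> lies strictly before \<open>y\<close>, all points of the
      open set \<open>- C z\<close> have \<open>z\<close> in their segment. If \<open>z = y\<close>,
      this set would omit \<open>y\<close>, and instead the points \<open>x\<close> near
      \<open>y\<close> are themselves close to \<open>q\<close> and lie in
      \<open>C x\<close>.\<close>
    define S where "S = (if z = y then ball q c else - C z)"
    have "infdist q (C x) < c" if x: "x \<in> S" "x \<in> H" for x
    proof (cases "z = y")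
      case True
      then show ?thesis using x infdist_le[OF cutD(7)[OF x(2)], of q] unfolding S_def by auto
    next
      case False
      then have "x \<in> D z" using x cutD(3)[OF zH] unfolding S_def by auto
      then have "z \<in> C x" using cut_mono[OF zH x(2)] cutD(7)[OF zH] by blast
      then show ?thesis using infdist_le[of z "C x" q] z(2) by linarith
    qed
    moreover have "open S" "y \<in> S"
      unfolding S_def using z cutD(1)[OF zH] cut_antisym(2)[OF y zH z(1)] by auto
    ultimately show "\<forall>\<^sub>F x in at y within H. infdist q (C x) < c"
      unfolding eventually_at_topological by blast
  next
    fix c assume c: "c < infdist q (C y)"
    define U where "U = D y \<inter> cball q c"
    have Cy: "dist q w > c" if "w \<in> C y" for w using infdist_le[OF that, of q] c by linarith
    have UH: "U \<subseteq> H" unfolding U_def using cutD(3)[OF y] by blast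
    have far: "c < infdist q (C x)" if x: "x \<in> H" and d: "\<And>w. w \<in> C x \<Longrightarrow> w \<notin> U" for x
    proof -
      have ne: "C x \<noteq> {}" using cutD(7)[OF x] by blast
      have "continuous_on (C x) (dist q)" by (intro continuous_intros)
      from continuous_attains_inf[OF cut_compact[OF x] ne this]
      obtain w where w: "w \<in> C x" "\<forall>v\<in>C x. dist q w \<le> dist q v" by (elim bexE)
      have "w \<in> H" using w(1) cutD(3)[OF x] by blast
      then have "dist q w > c" using d[OF w(1)] Cy[of w] cutD(3)[OF y] unfolding U_def by auto
      moreover have "dist q w \<le> infdist q (C x)"
        unfolding infdist_notempty[OF ne] by (rule cINF_greatest[OF ne]) (use w(2) in blast)
      ultimately show ?thesis by linarith
    qed
    have "\<exists>S. open S \<and> y \<in> S \<and> (\<forall>x\<in>S. x \<in> H \<longrightarrow> (\<forall>w\<in>C x. w \<notin> U))"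
    proof (cases "U = {}")
      case True
      then show ?thesis by (intro exI[of _ UNIV]) simp
    next
      case False
      have cU: "compact U"
      proof -
        have "compact (H \<inter> (D y \<inter> cball q c))" by (rule compact_Int_closed[OF cpt closed_Int[OF cutD(2)[OF y] closed_cball]])
        moreover have "H \<inter> (D y \<inter> cball q c) = U" using UH unfolding U_def by blast
        ultimately show ?thesis by simp
      qed
      have least: "\<exists>t\<in>T. \<forall>u\<in>T. C t \<subseteq> C u" if "finite T" "T \<noteq> {}" "T \<subseteq> U" for T
        using that
      proof (induction rule: finite_ne_induct)
        case (insert v T)
        then obtain t where t: "t \<in> T" "\<forall>u\<in>T. C t \<subseteq> C u" by auto
        have "C t \<subseteq> C v \<or> C v \<subseteq> C t" using cut_total[of t v] insert.prems UH t(1) by blast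
        then show ?case
        proof
          assume "C t \<subseteq> C v"
          then show ?thesis using t by blast
        next
          assume "C v \<subseteq> C t"
          then have "\<forall>u\<in>insert v T. C v \<subseteq> C u" using t(2) by blast
          then show ?thesis by blast
        qed
      qed simp
      have "U \<inter> (\<Inter>u\<in>U. C u) \<noteq> {}"
      proof (rule compact_imp_fip_image[OF cU])
        show "closed (C u)" if "u \<in> U" for u using cutD(1) that UH by blast
        show "U \<inter> (\<Inter>u\<in>T. C u) \<noteq> {}" if T: "finite T" "T \<subseteq> U" for T
        proof (cases "T = {}")
          case False
          obtain t where t: "t \<in> T" "\<forall>u\<in>T. C t \<subseteq> C u" using least[OF T(1) False T(2)] by (elim bexE)
          have "t \<in> H" "t \<in> U" using t(1) T(2) UH by blast+
          then have "t \<in> U \<inter> (\<Inter>u\<in>T. C u)" using t(2) cutD(7) by blast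
          then show ?thesis by blast
        qed (use \<open>U \<noteq> {}\<close> in simp)
      qed
      then obtain m where "m \<in> U \<inter> (\<Inter>u\<in>U. C u)" by blast
      then have m: "m \<in> U" "\<And>u. u \<in> U \<Longrightarrow> m \<in> C u" by blast+
      have mH: "m \<in> H" using m(1) UH by blast
      have my: "m \<in> D y" "m \<noteq> y" using m(1) Cy[OF cutD(7)[OF y]] unfolding U_def by auto
      have "y \<in> C m" using cut_mono[OF y mH my(1)] cutD(7)[OF y] by blast
      then have ym: "y \<notin> D m" using cut_unique[OF mH] my(2) by blast
      have "w \<notin> U" if x: "x \<in> - D m" "x \<in> H" "w \<in> C x" for x w
      proof
        assume "w \<in> U"
        then have "m \<in> C w" by (rule m(2))
        then have "m \<in> C x" using cut_mono'[OF x(2) _ x(3)] \<open>w \<in> U\<close> UH by blast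
        moreover have "x \<noteq> m" using x(1) cutD(8)[OF mH] by blast
        ultimately show False using cut_antisym(1)[OF x(2) mH] x(1) by blast
      qed
      then show ?thesis using ym cutD(2)[OF mH] by (intro exI[of _ "- D m"]) auto
    qed
    then obtain S where S: "open S" "y \<in> S" "\<forall>x\<in>S. x \<in> H \<longrightarrow> (\<forall>w\<in>C x. w \<notin> U)" by (elim exE conjE)
    show "\<forall>\<^sub>F x in at y within H. c < infdist q (C x)"
      unfolding eventually_at_topological
    proof (intro exI conjI ballI impI)
      fix x assume "x \<in> S" "x \<noteq> y" "x \<in> H"
      then show "c < infdist q (C x)" using S(3) by (intro far) simp_all
    qed (fact S)+
  qed
qed

text \<open>If \<open>s\<close> has distance \<open>e\<close> from \<open>C r\<close>, a point of
  the dense set within \<open>e / 2\<close> of \<open>s\<close> is nearer to \<open>s\<close> than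
  to \<open>C r\<close>.\<close>

lemma infdist_cut_less:
  assumes "r \<in> H" "s \<in> D r" "s \<noteq> r" "H \<subseteq> closure Q"
  shows "\<exists>q\<in>Q. infdist q (C s) < infdist q (C r)"
proof -
  have s: "s \<in> H" "s \<notin> C r" using assms(1-3) cutD(3)[OF assms(1)] cut_unique[OF assms(1)] by blast+
  define e where "e = infdist s (C r)"
  have ne: "C r \<noteq> {}" using cutD(7)[OF assms(1)] by blast
  have e: "e > 0" unfolding e_def
    using infdist_pos_not_in_closed[OF cutD(1)[OF assms(1)] ne s(2)] .
  have "s \<in> closure Q" using s(1) assms(4) by blast
  then obtain q where q: "q \<in> Q" "dist q s < e / 2" using e by (meson closure_approachable half_gt_zero)
  have "infdist q (C s) \<le> dist q s" by (rule infdist_le[OF cutD(7)[OF s(1)]])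
  moreover have "e \<le> infdist q (C r) + dist s q" unfolding e_def by (rule infdist_triangle)
  ultimately have "infdist q (C s) < infdist q (C r)" using q(2) by (simp add: dist_commute)
  then show ?thesis using q(1) by blast
qed

text \<open>As in the construction of a Whitney map, the function is a weighted sum of the distances
  from the points of a dense sequence to the segment \<open>C x\<close>. Growing the segment
  decreases every summand weakly and at least one strictly.\<close>

lemma exists_monotone:
  "\<exists>f :: 'a \<Rightarrow> real. continuous_on H f \<and> (\<forall>r\<in>H. \<forall>s\<in>D r. s \<noteq> r \<longrightarrow> f s < f r)"
proof -
  obtain Q where Q: "countable Q" "Q \<subseteq> H" "H \<subseteq> closure Q" using compact_separable[OF cpt] by (elim exE conjE)
  have Qne: "Q \<noteq> {}" using Q(3) ends(1) by auto
  define q where "q = from_nat_into Q"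
  have qH: "q n \<in> H" for n unfolding q_def using from_nat_into[OF Qne] Q(2) by blast
  obtain M where M: "\<And>x y. x \<in> H \<Longrightarrow> y \<in> H \<Longrightarrow> dist x y \<le> M"
    using compact_imp_bounded[OF cpt] bounded_two_points by meson
  define g where "g n x = (1/2)^n * infdist (q n) (C x)" for n x
  have g: "norm (g n x) \<le> (1/2)^n * M" if "x \<in> H" for n x
  proof -
    have "infdist (q n) (C x) \<le> M" using infdist_le[OF cutD(7)[OF that], of "q n"] M[OF qH that, of n] by linarith
    then show ?thesis unfolding g_def by (simp add: infdist_nonneg abs_mult)
  qed
  have sum: "summable (\<lambda>n. (1/2::real)^n * M)" by (intro summable_mult2 summable_geometric) simp
  have gs: "summable (\<lambda>n. g n x)" if "x \<in> H" for x
    by (rule summable_comparison_test'[OF sum]) (rule g[OF that])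
  have "uniform_limit H (\<lambda>n x. \<Sum>i<n. g i x) (\<lambda>x. \<Sum>i. g i x) sequentially"
    by (rule Weierstrass_m_test[OF _ sum]) (rule g)
  moreover have "continuous_on H (\<lambda>x. \<Sum>i<n. g i x)" for n
    unfolding g_def by (intro continuous_intros infdist_cut_continuous)
  ultimately have "continuous_on H (\<lambda>x. \<Sum>i. g i x)"
    by (intro uniform_limit_theorem[OF always_eventually]) auto
  moreover have "(\<Sum>i. g i s) < (\<Sum>i. g i r)" if rs: "r \<in> H" "s \<in> D r" "s \<noteq> r" for r s
  proof -
    have s: "s \<in> H" using rs cutD(3)[OF rs(1)] by blast
    obtain p where p: "p \<in> Q" "infdist p (C s) < infdist p (C r)" using infdist_cut_less[OF rs Q(3)] by (elim bexE)
    obtain m where m: "q m = p" unfolding q_def using from_nat_into_surj[OF Q(1) p(1)] by blast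
    have le: "infdist x (C s) \<le> infdist x (C r)" for x
      by (rule infdist_mono[OF cut_mono[OF rs(1) s rs(2)]]) (use cutD(7)[OF rs(1)] in blast)
    have "0 < (\<Sum>i. g i r - g i s)"
      by (rule suminf_pos2[of _ m]) (use gs rs(1) s le p(2) m in \<open>auto simp: g_def intro!: summable_diff mult_left_mono\<close>)
    then show ?thesis using suminf_diff[OF gs[OF rs(1)] gs[OF s]] by simp
  qed
  ultimately show ?thesis by blast
qed

lemma homeomorphism_interval:
  "\<exists>f :: 'a \<Rightarrow> real. continuous_on H f \<and> inj_on f H \<and> f ` H = {0..1} \<and> f a = 0 \<and> f b = 1"
proof -
  obtain f :: "'a \<Rightarrow> real" where f: "continuous_on H f" "\<forall>r\<in>H. \<forall>s\<in>D r. s \<noteq> r \<longrightarrow> f s < f r"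
    using exists_monotone by (elim exE conjE)
  have Da: "D a = H" using cutD(3,8)[OF ends(1)] cut_a by auto
  have bD: "b \<in> D r" if "r \<in> H" for r by (rule cutD(6)[OF that])
  have le: "f b \<le> f r" "f r \<le> f a" if "r \<in> H" for r
    using f(2) bD[OF that] that ends(1) Da by (metis less_eq_real_def)+
  have ab: "f b < f a" using f(2) bD[OF ends(1)] ends by metis
  define g where "g x = (f a - f x) / (f a - f b)" for x
  have "continuous_on H g" unfolding g_def using ab by (intro continuous_intros f(1)) auto
  moreover have "inj_on f H"
  proof (rule inj_onI)
    fix r s assume rs: "r \<in> H" "s \<in> H" "f r = f s"
    show "r = s"
    proof (rule ccontr)
      assume ne: "r \<noteq> s"
      have "s \<in> D r \<or> r \<in> D s" using cut_antisym(1)[OF rs(1,2)] cutD(3)[OF rs(1)] rs(2) ne by blast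
      then show False using f(2) rs ne by (metis less_irrefl)
    qed
  qed
  then have "inj_on g H" unfolding g_def inj_on_def using ab by (simp add: field_simps)
  moreover have ga: "g a = 0" "g b = 1" unfolding g_def using ab by simp_all
  moreover have "g ` H = {0..1}"
  proof
    show "g ` H \<subseteq> {0..1}" unfolding g_def using le ab by (auto simp: divide_simps)
    have "connected (g ` H)" by (rule connected_continuous_image[OF \<open>continuous_on H g\<close> conn])
    then show "{0..1} \<subseteq> g ` H"
      using connected_contains_Icc[of "g ` H" 0 1] ga ends by (metis imageI)
  qed
  ultimately show ?thesis by blast
qed

end

lemma arc_from_cuts:
  fixes H :: "'a::metric_space set"
  assumes "compact H" "connected H" "a \<in> H" "b \<in> H" "a \<noteq> b"
    and cuts: "\<forall>r\<in>H - {a,b}. \<exists>C D. closed C \<and> closed D \<and> C \<union> D = H \<and> C \<inter> D = {r} \<and> a \<in> C \<and> b \<in> D"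
  shows "\<exists>f :: 'a \<Rightarrow> real. continuous_on H f \<and> inj_on f H \<and> f ` H = {0..1} \<and> f a = 0 \<and> f b = 1"
proof -
  obtain C where "\<forall>r\<in>H - {a,b}. \<exists>D. closed (C r) \<and> closed D \<and> C r \<union> D = H \<and> C r \<inter> D = {r} \<and> a \<in> C r \<and> b \<in> D"
    using bchoice[OF cuts] by (elim exE)
  from bchoice[OF this] obtain D where CD: "\<forall>r\<in>H - {a,b}.
      closed (C r) \<and> closed (D r) \<and> C r \<union> D r = H \<and> C r \<inter> D r = {r} \<and> a \<in> C r \<and> b \<in> D r"
    by (elim exE)
  have cH: "closed H" by (rule compact_imp_closed[OF assms(1)])
  \<comment> \<open>At the two ends the cuts are degenerate: \<open>{a}\<close> against
    \<open>H\<close>, and \<open>H\<close> against \<open>{b}\<close>.\<close>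
  interpret cut_ordered H a b "C(a := {a}, b := H)" "D(a := H, b := {b})"
  proof
    fix r assume r: "r \<in> H"
    consider "r = a" | "r = b" | "r \<in> H - {a,b}" using r by blast
    then show "closed ((C(a := {a}, b := H)) r) \<and> closed ((D(a := H, b := {b})) r) \<and>
      (C(a := {a}, b := H)) r \<union> (D(a := H, b := {b})) r = H \<and>
      (C(a := {a}, b := H)) r \<inter> (D(a := H, b := {b})) r = {r} \<and>
      a \<in> (C(a := {a}, b := H)) r \<and> b \<in> (D(a := H, b := {b})) r"
    proof cases
      case 1
      then show ?thesis using assms(3-5) cH by auto
    next
      case 2
      then show ?thesis using assms(3-5) cH by auto
    next
      case 3
      then have "r \<noteq> a" "r \<noteq> b" by blast+
      then show ?thesis using bspec[OF CD 3] by simp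
    qed
  qed (use assms in simp_all)
  show ?thesis by (rule homeomorphism_interval)
qed

text \<open>\<open>f\<close> parametrises the upper and \<open>g\<close> the lower half circle from
  1 to -1, so they agree at \<open>a\<close> and \<open>b\<close>. The sign of the imaginary part
  tells the two arcs apart, and on each the real part determines the parameter because
  \<open>cos\<close> is injective on the interval from 0 to \<open>pi\<close>.\<close>

lemma homeomorphic_circle:
  fixes H K :: "'a::metric_space set" and f g :: "'a \<Rightarrow> real"
  assumes HK: "compact H" "compact K" "H \<inter> K = {a,b}"
    and f: "continuous_on H f" "inj_on f H" "f ` H = {0..1}" "f a = 0" "f b = 1"
    and g: "continuous_on K g" "inj_on g K" "g ` K = {0..1}" "g a = 0" "g b = 1"
  shows "(H \<union> K) homeomorphic {z::complex. norm z = 1}"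
proof (rule homeomorphic_compact)
  define h where "h x = (if x \<in> H then cis (pi * f x) else cis (- (pi * g x)))" for x
  show "compact (H \<union> K)" using HK by blast
  have ab: "a \<in> K" "b \<in> K" "a \<in> H" "b \<in> H" using HK(3) by auto
  have gk: "0 < g x" "g x < 1" if x: "x \<in> K" "x \<notin> H" for x
  proof -
    have "g x \<in> {0..1}" using g(3) x(1) by blast
    moreover have "g x \<noteq> g a" "g x \<noteq> g b" using inj_onD[OF g(2)] x ab by metis+
    ultimately show "0 < g x" "g x < 1" using g(4,5) by auto
  qed
  have fh: "0 \<le> f x" "f x \<le> 1" if "x \<in> H" for x using f(3) that by (metis imageI atLeastAtMost_iff)+
  show "continuous_on (H \<union> K) h"
    unfolding h_def
  proof (rule continuous_on_If)
    show "\<And>x. x \<in> K \<Longrightarrow> x \<in> H \<Longrightarrow> cis (pi * f x) = cis (- (pi * g x))"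
    proof -
      fix x assume "x \<in> K" "x \<in> H"
      then have "x = a \<or> x = b" using HK(3) by blast
      then show "cis (pi * f x) = cis (- (pi * g x))" using f(4,5) g(4,5) by (auto simp: cis.ctr)
    qed
  qed (use HK f(1) g(1) in \<open>auto intro!: continuous_intros simp: compact_imp_closed\<close>)
  have up: "Im (h x) \<ge> 0" "Re (h x) = cos (pi * f x)" if "x \<in> H" for x
    using fh[OF that] that unfolding h_def by (auto intro!: sin_ge_zero simp: mult_left_le)
  have lo: "Im (h x) < 0" "Re (h x) = cos (pi * g x)" if x: "x \<in> K" "x \<notin> H" for x
    using gk[OF x] x unfolding h_def by (auto intro!: sin_gt_zero)
  have c: "s = t" if "cos (pi * s) = cos (pi * t)" "0 \<le> s" "s \<le> 1" "0 \<le> t" "t \<le> 1" for s t :: real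
    using cos_inj_pi[of "pi * s" "pi * t"] that by (simp add: mult_left_le)
  show "inj_on h (H \<union> K)"
  proof (rule inj_onI)
    fix x y assume xy: "x \<in> H \<union> K" "y \<in> H \<union> K" "h x = h y"
    have iff: "x \<in> H \<longleftrightarrow> y \<in> H"
      using up(1)[of x] up(1)[of y] lo(1)[of x] lo(1)[of y] xy by (metis UnE not_less)
    show "x = y"
    proof (cases "x \<in> H")
      case True
      then have y: "y \<in> H" using iff by blast
      have "cos (pi * f x) = cos (pi * f y)" using up(2)[OF True] up(2)[OF y] xy(3) by simp
      then have "f x = f y" by (rule c[OF _ fh[OF True] fh[OF y]])
      then show ?thesis using inj_onD[OF f(2)] True iff by blast
    next
      case False
      then have xK: "x \<in> K" "y \<in> K" "y \<notin> H" using xy iff by blast+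
      have "cos (pi * g x) = cos (pi * g y)" using lo(2)[OF xK(1) False] lo(2)[OF xK(2,3)] xy(3) by simp
      then have "g x = g y"
        by (rule c) (use gk[OF xK(1) False] gk[OF xK(2,3)] in simp_all)
      then show ?thesis using inj_onD[OF g(2)] xK by blast
    qed
  qed
  show "h ` (H \<union> K) = {z. norm z = 1}"
  proof
    show "h ` (H \<union> K) \<subseteq> {z. norm z = 1}" unfolding h_def by auto
    show "{z. norm z = 1} \<subseteq> h ` (H \<union> K)"
    proof
      fix z :: complex assume "z \<in> {z. norm z = 1}"
      then have z: "(Re z)\<^sup>2 + (Im z)\<^sup>2 = 1" by (simp add: cmod_def)
      have r: "- 1 \<le> Re z" "Re z \<le> 1" using z abs_square_le_1[of "Re z"] by (smt (verit) zero_le_power2)+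
      define s where "s = arccos (Re z) / pi"
      have s: "0 \<le> s" "s \<le> 1" unfolding s_def using arccos_lbound[OF r] arccos_ubound[OF r] by (simp_all add: divide_simps)
      have cs: "cos (pi * s) = Re z" "sin (pi * s) = \<bar>Im z\<bar>"
      proof -
        show "cos (pi * s) = Re z" unfolding s_def using cos_arccos[OF r] by simp
        have "1 - (Re z)\<^sup>2 = (Im z)\<^sup>2" using z by simp
        then show "sin (pi * s) = \<bar>Im z\<bar>" unfolding s_def using sin_arccos_abs[of "Re z"] r by simp
      qed
      obtain x where x: "x \<in> H" "f x = s" using s f(3) by (metis imageE atLeastAtMost_iff)
      obtain y where y: "y \<in> K" "g y = s" using s g(3) by (metis imageE atLeastAtMost_iff)
      show "z \<in> h ` (H \<union> K)"
      proof (cases "Im z \<ge> 0")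
        case True
        then have "h x = z" unfolding h_def using x cs by (simp add: complex_eq_iff)
        then show ?thesis using x(1) by blast
      next
        case False
        have "y \<notin> H"
        proof
          assume "y \<in> H"
          then have "y = a \<or> y = b" using y(1) HK(3) by blast
          then have "s = 0 \<or> s = 1" using y(2) g(4,5) by auto
          then show False using cs(2) False by auto
        qed
        then have "h y = z" unfolding h_def using y cs False by (simp add: complex_eq_iff)
        then show ?thesis using y(1) by blast
      qed
    qed
  qed
qed

context hereditary_kelley
begin

text \<open>Single points do not cut \<open>X\<close>. If a part of a separation meets
  \<open>{a,b}\<close> at most in \<open>x\<close>, then without \<open>x\<close> it is clopen in
  the connected set \<open>X - {x}\<close>, whose remainder contains the other end. So that part is
  contained in \<open>{x}\<close>.\<close>

lemma connected_side:
  assumes ab: "a \<in> X" "b \<in> X" "a \<noteq> b" and WV: "W \<union> V = X - {a,b}" "W \<inter> V = {}" "W \<noteq> {}"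
    and cl: "closed (W \<union> {a,b})" "closed (V \<union> {a,b})"
  shows "connected (W \<union> {a,b})"
  unfolding connected_closed_set[OF cl(1)]
proof
  assume "\<exists>E F. closed E \<and> closed F \<and> E \<noteq> {} \<and> F \<noteq> {} \<and> E \<union> F = W \<union> {a,b} \<and> E \<inter> F = {}"
  then obtain E0 F0 where EF0: "closed E0" "closed F0" "E0 \<noteq> {}" "F0 \<noteq> {}" "E0 \<union> F0 = W \<union> {a,b}" "E0 \<inter> F0 = {}"
    by (elim exE conjE)
  have "\<exists>E F. closed E \<and> closed F \<and> F \<noteq> {} \<and> E \<union> F = W \<union> {a,b} \<and> E \<inter> F = {} \<and> a \<in> E"
  proof (cases "a \<in> E0")
    case True
    then show ?thesis using EF0 by blast
  next
    case False
    then have "a \<in> F0" using EF0(5) by blast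
    moreover have "F0 \<union> E0 = W \<union> {a,b}" "F0 \<inter> E0 = {}" using EF0(5,6) by blast+
    ultimately show ?thesis using EF0(1-4) by blast
  qed
  then obtain E F where EF: "closed E" "closed F" "F \<noteq> {}" "E \<union> F = W \<union> {a,b}" "E \<inter> F = {}" "a \<in> E"
    by (elim exE conjE)
  have side: "G \<inter> (X - {x}) = {}"
    if G: "closed G" "closed G'" "G \<union> G' = W \<union> {a,b}" "G \<inter> G' = {}" "{a,b} \<inter> G \<subseteq> {x}" "x \<in> {a,b}" for G G' x
  proof -
    have xX: "x \<in> X" using G(6) ab by blast
    have c: "connected (X - {x})" by (rule nonsep_connected[OF nonsep_singleton[OF xX]])
    define M where "M = G' \<union> (V \<union> {a,b})"
    have "closed M" unfolding M_def using G(2) cl(2) by blast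
    moreover have "X - {x} \<subseteq> G \<union> M" unfolding M_def using WV(1) G(3) by blast
    moreover have "G \<inter> V = {}" using G(3) WV(1,2) by blast
    then have "G \<inter> M \<inter> (X - {x}) = {}" unfolding M_def using G(4,5) by blast
    ultimately have "G \<inter> (X - {x}) = {} \<or> M \<inter> (X - {x}) = {}"
      using connected_closedD[OF c] G(1) by blast
    moreover have "M \<inter> (X - {x}) \<noteq> {}" unfolding M_def using ab G(6) by blast
    ultimately show ?thesis by blast
  qed
  have sub: "E \<union> F \<subseteq> X" using EF(4) WV(1) ab by blast
  show False
  proof (cases "b \<in> E")
    case True
    have "a \<notin> F" "b \<notin> F" using True EF(5,6) by blast+
    then have "F \<inter> (X - {a}) = {}"
      by (intro side[of F E a]) (use EF in \<open>simp_all add: Un_commute Int_commute\<close>)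
    then have "F \<subseteq> {a}" using sub by blast
    then show False using EF(3) \<open>a \<notin> F\<close> by blast
  next
    case False
    then have b: "b \<in> F" "a \<notin> F" using EF(4-6) by blast+
    have "F \<inter> (X - {b}) = {}"
      by (intro side[of F E b]) (use EF b in \<open>simp_all add: Un_commute Int_commute\<close>)
    moreover have "E \<inter> (X - {a}) = {}"
      by (intro side[of E F a]) (use EF False in \<open>simp_all add: Un_commute Int_commute\<close>)
    ultimately have "E \<union> F \<subseteq> {a,b}" using sub by blast
    then have "W \<subseteq> {a,b}" using EF(4) by blast
    then show False using WV(1,3) by blast
  qed
qed

lemma homeomorphic_circle_X: "X homeomorphic {z::complex. norm z = 1}"
proof -
  obtain a b where ab: "a \<in> X" "b \<in> X" "a \<noteq> b"
  proof -
    obtain a where a: "a \<in> X" using X_ne by blast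
    then have "X \<noteq> {a}" using finite_proper[of "{a}"] by simp
    then show ?thesis using a that by blast
  qed
  from separation[OF ab] obtain W V where WV: "W \<union> V = X - {a,b}" "W \<inter> V = {}" "W \<noteq> {}" "V \<noteq> {}"
      "closed (W \<union> {a,b})" "closed (V \<union> {a,b})"
    and sep: "\<forall>r\<in>W. \<forall>s\<in>V. \<exists>C D. closed C \<and> closed D \<and> C \<union> D = X \<and> C \<inter> D = {r,s} \<and> a \<in> C \<and> b \<in> D"
    by (elim exE conjE)
  obtain r0 s0 where rs: "r0 \<in> W" "s0 \<in> V" using WV(3,4) by blast
  have cpt': "compact S" if "closed S" "S \<subseteq> X" for S
    using compact_Int_closed[OF cpt that(1)] that(2) by (simp add: Int_absorb1)
  \<comment> \<open>A cut of \<open>X\<close> at \<open>{r,s}\<close> is intersected with one closed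
    side. Since \<open>s\<close> lies on the other side, the trace is a cut at \<open>r\<close>
    alone, and one fixed \<open>s\<close> serves for all \<open>r\<close>.\<close>
  have cutW: "\<exists>C D. closed C \<and> closed D \<and> C \<union> D = W' \<union> {a,b} \<and> C \<inter> D = {r} \<and> a \<in> C \<and> b \<in> D"
    if h: "closed (W' \<union> {a,b})" "W' \<subseteq> X" "r \<in> W'" "s \<notin> W' \<union> {a,b}"
      and CD: "\<exists>C D. closed C \<and> closed D \<and> C \<union> D = X \<and> C \<inter> D = {r,s} \<and> a \<in> C \<and> b \<in> D" for W' r s
  proof -
    obtain C D where CD: "closed C" "closed D" "C \<union> D = X" "C \<inter> D = {r,s}" "a \<in> C" "b \<in> D"
      using CD by (elim exE conjE)
    have "(C \<inter> (W' \<union> {a,b})) \<union> (D \<inter> (W' \<union> {a,b})) = X \<inter> (W' \<union> {a,b})" unfolding CD(3)[symmetric] by blast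
    also have "\<dots> = W' \<union> {a,b}" using h(2) ab by blast
    finally have 1: "(C \<inter> (W' \<union> {a,b})) \<union> (D \<inter> (W' \<union> {a,b})) = W' \<union> {a,b}" .
    have "(C \<inter> (W' \<union> {a,b})) \<inter> (D \<inter> (W' \<union> {a,b})) = (C \<inter> D) \<inter> (W' \<union> {a,b})" by blast
    also have "\<dots> = {r}" unfolding CD(4) using h(3,4) by blast
    finally have 2: "(C \<inter> (W' \<union> {a,b})) \<inter> (D \<inter> (W' \<union> {a,b})) = {r}" .
    have "closed (C \<inter> (W' \<union> {a,b}))" "closed (D \<inter> (W' \<union> {a,b}))" by (intro closed_Int CD(1,2) h(1))+
    moreover have "a \<in> C \<inter> (W' \<union> {a,b})" "b \<in> D \<inter> (W' \<union> {a,b})" using CD(5,6) by blast+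
    ultimately show ?thesis using 1 2
      by - (rule exI[of _ "C \<inter> (W' \<union> {a,b})"], rule exI[of _ "D \<inter> (W' \<union> {a,b})"], intro conjI)
  qed
  have sub: "W \<subseteq> X" "V \<subseteq> X" "W \<union> {a,b} \<subseteq> X" "V \<union> {a,b} \<subseteq> X" using WV(1) ab by blast+
  have notin: "s0 \<notin> W \<union> {a,b}" "r0 \<notin> V \<union> {a,b}" using rs WV(1,2) by blast+
  have d: "W \<union> {a,b} - {a,b} = W" "V \<union> {a,b} - {a,b} = V" using WV(1) by blast+
  have VW: "V \<union> W = X - {a,b}" "V \<inter> W = {}" using WV(1,2) by blast+
  have "\<exists>f :: 'a \<Rightarrow> real. continuous_on (W \<union> {a,b}) f \<and> inj_on f (W \<union> {a,b}) \<and> f ` (W \<union> {a,b}) = {0..1} \<and> f a = 0 \<and> f b = 1"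
  proof (rule arc_from_cuts[OF cpt'[OF WV(5) sub(3)] connected_side[OF ab WV(1-3,5,6)] _ _ ab(3)])
    show "\<forall>r\<in>W \<union> {a,b} - {a,b}. \<exists>C D. closed C \<and> closed D \<and> C \<union> D = W \<union> {a,b} \<and> C \<inter> D = {r} \<and> a \<in> C \<and> b \<in> D"
      unfolding d
    proof
      fix r assume r: "r \<in> W"
      show "\<exists>C D. closed C \<and> closed D \<and> C \<union> D = W \<union> {a,b} \<and> C \<inter> D = {r} \<and> a \<in> C \<and> b \<in> D"
        by (rule cutW[OF WV(5) sub(1) r notin(1) bspec[OF bspec[OF sep r] rs(2)]])
    qed
  qed simp_all
  then obtain f :: "'a \<Rightarrow> real" where f: "continuous_on (W \<union> {a,b}) f" "inj_on f (W \<union> {a,b})"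
      "f ` (W \<union> {a,b}) = {0..1}" "f a = 0" "f b = 1"
    by (elim exE conjE)
  have "\<exists>f :: 'a \<Rightarrow> real. continuous_on (V \<union> {a,b}) f \<and> inj_on f (V \<union> {a,b}) \<and> f ` (V \<union> {a,b}) = {0..1} \<and> f a = 0 \<and> f b = 1"
  proof (rule arc_from_cuts[OF cpt'[OF WV(6) sub(4)] connected_side[OF ab VW WV(4,6,5)] _ _ ab(3)])
    show "\<forall>r\<in>V \<union> {a,b} - {a,b}. \<exists>C D. closed C \<and> closed D \<and> C \<union> D = V \<union> {a,b} \<and> C \<inter> D = {r} \<and> a \<in> C \<and> b \<in> D"
      unfolding d
    proof
      fix s assume s: "s \<in> V"
      show "\<exists>C D. closed C \<and> closed D \<and> C \<union> D = V \<union> {a,b} \<and> C \<inter> D = {s} \<and> a \<in> C \<and> b \<in> D"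
      proof (rule cutW[OF WV(6) sub(2) s notin(2)])
        show "\<exists>C D. closed C \<and> closed D \<and> C \<union> D = X \<and> C \<inter> D = {s,r0} \<and> a \<in> C \<and> b \<in> D"
          unfolding insert_commute[of s r0] by (rule bspec[OF bspec[OF sep rs(1)] s])
      qed
    qed
  qed simp_all
  then obtain g :: "'a \<Rightarrow> real" where g: "continuous_on (V \<union> {a,b}) g" "inj_on g (V \<union> {a,b})"
      "g ` (V \<union> {a,b}) = {0..1}" "g a = 0" "g b = 1"
    by (elim exE conjE)
  have "(W \<union> {a,b}) \<inter> (V \<union> {a,b}) = {a,b}" using WV(2) by blast
  from homeomorphic_circle[OF cpt'[OF WV(5) sub(3)] cpt'[OF WV(6) sub(4)] this f g]
  have "(W \<union> {a,b} \<union> (V \<union> {a,b})) homeomorphic {z::complex. norm z = 1}" .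
  moreover have "W \<union> {a,b} \<union> (V \<union> {a,b}) = X" using WV(1) ab by blast
  ultimately show ?thesis by simp
qed

end

section \<open>Passage from the topological definitions to the locales\<close>

lemma continuum_top_of_set:
  fixes S :: "'a::metric_space set"
  shows "continuum (top_of_set S) \<longleftrightarrow> S \<noteq> {} \<and> compact S \<and> connected S"
proof -
  have "compact_space (top_of_set S) \<longleftrightarrow> compact S" using compactin_subspace[of euclidean S] by simp
  moreover have "connected_space (top_of_set S) \<longleftrightarrow> connected S" using connectedin_def[of euclidean S] by simp
  ultimately show ?thesis
    unfolding continuum_def using metrizable_space_subtopology[OF metrizable_space_euclidean, of S] by simp
qed

lemma subcontinuum_iff:
  "subcontinuum K X \<longleftrightarrow> K \<subseteq> X \<and> K \<noteq> {} \<and> compact K \<and> connected K"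
  unfolding subcontinuum_def continuum_top_of_set ..

lemma property_of_Kelley_continuum:
  assumes "compact X" "connected X" "property_of_Kelley X"
  shows "kelley_continuum X"
proof
  fix x :: "nat \<Rightarrow> 'a" and p A
  assume x: "\<And>n. x n \<in> X" "x \<longlonglongrightarrow> p" and A: "A \<subseteq> X" "compact A" "connected A" "p \<in> A"
  have Ah: "A \<in> continuum_hyperspace X"
    unfolding continuum_hyperspace_def using hyperspace_compact[OF assms(1)] A by auto
  have "\<exists>B. (\<forall>n. B n \<in> continuum_hyperspace X \<and> x n \<in> B n) \<and>
      limitin (subtopology (hyperspace_topology X) (continuum_hyperspace X)) B A sequentially"
    using assms(3)[unfolded property_of_Kelley_def, rule_format, of x p A] x A Ah by blast
  then obtain B where B: "\<And>n. B n \<in> continuum_hyperspace X \<and> x n \<in> B n"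
      "limitin (hyperspace_topology X) B A sequentially"
    unfolding limitin_subtopology by (elim exE conjE) blast
  have Bh: "B n \<in> hyperspace X" "connected (B n)" for n using B(1)[of n] unfolding continuum_hyperspace_def by blast+
  have "A \<in> hyperspace X" using Ah unfolding continuum_hyperspace_def by blast
  then have "hlim B A" using limitin_hyperspace[of X B A, OF assms(1) Bh(1)] B(2) by blast
  moreover have "\<forall>n. B n \<subseteq> X \<and> compact (B n) \<and> connected (B n) \<and> x n \<in> B n"
    using Bh hyperspace_compact[OF assms(1)] B(1) by blast
  ultimately show "\<exists>B. (\<forall>n. B n \<subseteq> X \<and> compact (B n) \<and> connected (B n) \<and> x n \<in> B n) \<and> hlim B A" by blast
qed fact+

lemma continuum_nonblockers_hereditary_kelley:
  assumes "kelley_continuum X" "hereditarily_decomposable X"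
    and "continuum (subtopology (hyperspace_topology X) (nonblockers X))"
  shows "hereditary_kelley X"
proof -
  interpret kelley_continuum X by fact
  interpret M: Metric_space "hyperspace X" hausdorff_dist by (rule Metric_space_hausdorff_dist[OF cpt])
  let ?N = "nonblockers X"
  have T: "hyperspace_topology X = M.mtopology" by (simp add: hyperspace_topology_def)
  have Nh: "?N \<subseteq> hyperspace X" unfolding nonblockers_def by blast
  have top: "topspace (subtopology M.mtopology ?N) = ?N" using Nh by auto
  have N: "?N \<noteq> {}" "compact_space (subtopology M.mtopology ?N)" "connected_space (subtopology M.mtopology ?N)"
    using assms(3) unfolding continuum_def T top by blast+
  have cN: "compactin M.mtopology ?N" using N(2) Nh by (simp add: compactin_subspace)
  have lim: "limitin M.mtopology A B sequentially \<longleftrightarrow> hlim A B" if "\<And>n. A n \<in> ?N" "B \<in> ?N" for A B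
    unfolding T[symmetric] using that Nh by (intro limitin_hyperspace cpt) blast+
  have hered: "\<exists>P Q. cont P \<and> cont Q \<and> P \<noteq> K \<and> Q \<noteq> K \<and> K = P \<union> Q"
    if K: "cont K" "\<exists>x\<in>K. \<exists>y\<in>K. x \<noteq> y" for K
  proof -
    have "subcontinuum K X" using K(1) unfolding cont_def subcontinuum_iff .
    then have "decomposable K" using assms(2) K(2) unfolding hereditarily_decomposable_def by blast
    then obtain P Q where PQ: "subcontinuum P K" "P \<noteq> K" "subcontinuum Q K" "Q \<noteq> K" "K = P \<union> Q"
      unfolding decomposable_def by (elim exE conjE)
    have "cont P" "cont Q" using PQ(1,3) contD(1)[OF K(1)] unfolding subcontinuum_iff cont_def by blast+
    then show ?thesis using PQ(2,4,5) by blast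
  qed
  show ?thesis
  proof
    obtain A where A: "A \<in> ?N" using N(1) by blast
    obtain x where x: "x \<in> A" using NBD(2)[OF A] by blast
    obtain y where y: "y \<in> X" "y \<notin> A" using NBD(1,5)[OF A] by blast
    have xX: "x \<in> X" using x NBD(1)[OF A] by blast
    then have "\<exists>x\<in>X. \<exists>y\<in>X. x \<noteq> y" using x y by (intro bexI[of _ x] bexI[of _ y]) auto
    moreover have "cont X" unfolding cont_def using cpt conn xX by auto
    ultimately show "\<exists>P Q. cont P \<and> cont Q \<and> P \<noteq> X \<and> Q \<noteq> X \<and> X = P \<union> Q" by (intro hered)
  next
    fix A :: "nat \<Rightarrow> 'a set" assume A: "\<And>n. A n \<in> ?N"
    then have "range A \<subseteq> ?N" by blast
    then obtain B r where B: "B \<in> ?N" "strict_mono r" "limitin M.mtopology (A \<circ> r) B sequentially"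
      using cN unfolding M.compactin_sequentially by blast
    have "hlim (A \<circ> r) B" using lim[of "A \<circ> r" B] A B(1,3) by simp
    then show "\<exists>B r. B \<in> ?N \<and> strict_mono (r::nat\<Rightarrow>nat) \<and> hlim (\<lambda>n. A (r n)) B"
      using B(1,2) unfolding comp_def by blast
  next
    fix S assume S: "S \<subseteq> ?N" "S \<noteq> {}"
      and cl: "\<And>A B. (\<And>n::nat. A n \<in> S) \<Longrightarrow> B \<in> ?N \<Longrightarrow> hlim A B \<Longrightarrow> B \<in> S"
      and op: "\<And>A B. (\<And>n::nat. A n \<in> ?N - S) \<Longrightarrow> B \<in> ?N \<Longrightarrow> hlim A B \<Longrightarrow> B \<notin> S"
    have cN': "closedin M.mtopology ?N" by (rule compactin_imp_closedin[OF M.Hausdorff_space_mtopology cN])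
    have closed: "closedin (subtopology M.mtopology ?N) R"
      if R: "R \<subseteq> ?N" "\<And>A B. (\<And>n::nat. A n \<in> R) \<Longrightarrow> B \<in> ?N \<Longrightarrow> hlim A B \<Longrightarrow> B \<in> R" for R
    proof -
      have "closedin M.mtopology R"
        unfolding M.metric_closedin_iff_sequentially_closed
      proof (intro conjI allI impI)
        show "R \<subseteq> hyperspace X" using R(1) Nh by blast
        fix A B assume AB: "range A \<subseteq> R \<and> limitin M.mtopology A B sequentially"
        have AR: "A n \<in> R" for n using AB by blast
        have AN: "A n \<in> ?N" for n using AR R(1) by blast
        then have "range A \<subseteq> ?N" by blast
        then have BN: "B \<in> ?N" using cN' AB unfolding M.metric_closedin_iff_sequentially_closed by blast
        have "hlim A B" using lim[of A B, OF AN BN] AB by blast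
        then show "B \<in> R" by (rule R(2)[of A B, OF AR BN])
      qed
      then show ?thesis using R(1) by (rule closedin_subset_topspace)
    qed
    have "closedin (subtopology M.mtopology ?N) S" by (rule closed[OF S(1) cl])
    moreover have "closedin (subtopology M.mtopology ?N) (?N - S)" using op by (intro closed) auto
    then have "openin (subtopology M.mtopology ?N) S" unfolding openin_closedin_eq top using S(1) by blast
    ultimately show "S = ?N" using N(3) S(2) unfolding connected_space_clopen_in top by blast
  qed (fact hered)
qed

section \<open>Nonblockers of a circle\<close>

text \<open>Stereographic projection from the image of \<open>a\<close>. The hyperplane orthogonal
  to 1 in the complex plane is the imaginary axis.\<close>

lemma punctured_circle:
  fixes X :: "'a::metric_space set"
  assumes "X homeomorphic {z::complex. norm z = 1}" "a \<in> X"
  shows "(X - {a}) homeomorphic (UNIV :: real set)"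
proof -
  obtain f g where fg: "homeomorphism X {z::complex. norm z = 1} f g"
    using assms(1) unfolding homeomorphic_def by blast
  have fa: "f a \<in> sphere 0 1" using homeomorphism_image1[OF fg] assms(2) by auto
  have s: "{z::complex. norm z = 1} = sphere 0 1" by auto
  have im: "f ` X = sphere 0 1" using homeomorphism_image1[OF fg] s by simp
  have "inj_on f X" by (rule inj_on_inverseI) (rule homeomorphism_apply1[OF fg])
  from inj_on_image_set_diff[OF this, of X "{a}"] have "f ` (X - {a}) = sphere 0 1 - {f a}"
    using assms(2) im by simp
  from homeomorphism_of_subsets[OF fg _ order_refl this]
  have "(X - {a}) homeomorphic (sphere 0 1 - {f a})" unfolding homeomorphic_def by blast
  also have "(sphere 0 1 - {f a}) homeomorphic {z::complex. 1 \<bullet> z = 0}"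
    by (rule homeomorphic_punctured_sphere_hyperplane) (use fa in auto)
  also have "{z::complex. 1 \<bullet> z = 0} homeomorphic (UNIV :: real set)"
  proof -
    have "homeomorphism {z. 1 \<bullet> z = 0} UNIV Im (\<lambda>t. Complex 0 t)"
      by (rule homeomorphismI) (auto simp: inner_complex_def complex_eq_iff Complex_eq intro!: continuous_intros)
    then show ?thesis unfolding homeomorphic_def by blast
  qed
  finally show ?thesis .
qed

context kelley_continuum
begin

text \<open>Removing one point leaves a line, which is path connected and dense. A second point
  \<open>b\<close> of \<open>A\<close> cuts this line, and no continuum off \<open>A\<close> passes
  from one side of \<open>b\<close> to the other.\<close>

lemma circle_nonblockers:
  assumes "X homeomorphic {z::complex. norm z = 1}"
  shows "nonblockers X = (\<lambda>x. {x}) ` X"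
proof (intro equalityI subsetI)
  have nonsing: "X \<noteq> {x}" for x
  proof
    assume "X = {x}"
    then have "x \<in> X" and e: "X - {x} = {}" by simp_all
    have "({} :: 'a set) homeomorphic (UNIV :: real set)" using punctured_circle[OF assms \<open>x \<in> X\<close>] unfolding e .
    then show False by simp
  qed
  fix A assume "A \<in> (\<lambda>x. {x}) ` X"
  then obtain a where a: "a \<in> X" "A = {a}" by blast
  have path: "path_connected (X - {a})"
    using homeomorphic_path_connectedness[OF punctured_circle[OF assms a(1)]] convex_imp_path_connected[OF convex_UNIV] by blast
  show "A \<in> nonblockers X"
    unfolding NB_iff
  proof (intro conjI ballI allI impI)
    show "A \<subseteq> X" "A \<noteq> {}" "compact A" "A \<noteq> X" using a nonsing by auto
    fix x U assume x: "x \<in> X - A" and U: "open U" "U \<inter> X \<noteq> {}"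
    obtain y where y: "y \<in> U" "y \<in> X" "y \<noteq> a"
    proof (cases "a \<in> U")
      case True
      then show ?thesis
        using connected_imp_perfect[OF conn a(1) nonsing] that U(1) unfolding islimpt_def by metis
    next
      case False
      then show ?thesis using U(2) that by blast
    qed
    then obtain p where p: "path p" "path_image p \<subseteq> X - {a}" "pathstart p = x" "pathfinish p = y"
      using path x a(2) unfolding path_connected_def by blast
    have "cont (path_image p)"
      unfolding cont_def using p(1,2) by (auto simp: compact_path_image connected_path_image)
    moreover have "x \<in> path_image p" "y \<in> path_image p"
      using pathstart_in_path_image[of p] pathfinish_in_path_image[of p] p(3,4) by simp_all
    ultimately show "\<exists>L. cont L \<and> x \<in> L \<and> L \<inter> A = {} \<and> L \<inter> U \<noteq> {}" using p(2) y(1) a(2) by blast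
  qed
next
  fix A assume A: "A \<in> nonblockers X"
  obtain a where a: "a \<in> A" using NBD(2)[OF A] by blast
  have aX: "a \<in> X" using a NBD(1)[OF A] by blast
  obtain \<phi> \<psi> where hom: "homeomorphism (X - {a}) (UNIV :: real set) \<phi> \<psi>"
    using punctured_circle[OF assms aX] unfolding homeomorphic_def by blast
  have \<phi>: "continuous_on (X - {a}) \<phi>" "inj_on \<phi> (X - {a})" "\<phi> ` (X - {a}) = UNIV"
    by (rule homeomorphism_cont1[OF hom], rule inj_on_inverseI[of "X - {a}" \<psi> \<phi>, OF homeomorphism_apply1[OF hom]],
        simp_all add: homeomorphism_image1[OF hom])
  have "A = {a}"
  proof (rule ccontr)
    assume "A \<noteq> {a}"
    then obtain b where b: "b \<in> A" "b \<noteq> a" using a by blast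
    have bX: "b \<in> X - {a}" using b NBD(1)[OF A] by blast
    \<comment> \<open>\<open>Q\<close> is an open set of parameters beyond \<open>\<phi> b\<close>
      as seen from \<open>\<phi> z\<close>. It comes from an open set \<open>U\<close> of the space,
      from which \<open>a\<close> is removed because \<open>\<phi>\<close> says nothing
      there.\<close>
    have sep: False if z: "z \<in> X" "z \<notin> A" and P: "open Q" "Q \<noteq> {}"
      "\<forall>I. connected I \<longrightarrow> \<phi> b \<notin> I \<longrightarrow> \<phi> z \<in> I \<longrightarrow> I \<inter> Q = {}" for z Q
    proof -
      have "openin (top_of_set (X - {a})) ((X - {a}) \<inter> \<phi> -` Q)"
        using continuous_openin_preimage_gen[OF \<phi>(1) P(1)] .
      then obtain U where U: "open U" "(X - {a}) \<inter> \<phi> -` Q = (X - {a}) \<inter> U" unfolding openin_open by blast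
      obtain y where y: "y \<in> X - {a}" "\<phi> y \<in> Q" using P(2) \<phi>(3) by (metis UNIV_I ex_in_conv imageE)
      have yU: "y \<in> U - {a}" using y U(2) by blast
      have "open (U - {a})" using U(1) by (simp add: open_Diff)
      moreover have "(U - {a}) \<inter> X \<noteq> {}" using yU y(1) by blast
      ultimately have "\<exists>L. cont L \<and> z \<in> L \<and> L \<inter> A = {} \<and> L \<inter> (U - {a}) \<noteq> {}" by (rule NB_reach[OF A z])
      then obtain L where L: "cont L" "z \<in> L" "L \<inter> A = {}" "L \<inter> (U - {a}) \<noteq> {}" by (elim exE conjE)
      have LX: "L \<subseteq> X - {a}" using contD(1)[OF L(1)] L(3) a by blast
      have "connected (\<phi> ` L)"
        by (rule connected_continuous_image[OF continuous_on_subset[OF \<phi>(1) LX] contD(4)[OF L(1)]])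
      moreover have "\<phi> b \<notin> \<phi> ` L"
      proof
        assume "\<phi> b \<in> \<phi> ` L"
        then obtain l where "l \<in> L" "\<phi> b = \<phi> l" by blast
        then have "b = l" using inj_onD[OF \<phi>(2) _ bX] LX by blast
        then have "b \<in> L" using \<open>l \<in> L\<close> by simp
        then show False using b(1) L(3) by blast
      qed
      ultimately have "\<phi> ` L \<inter> Q = {}" using P(3)[rule_format, of "\<phi> ` L"] imageI[OF L(2), of \<phi>] by simp
      moreover obtain l where "l \<in> L" "l \<in> U - {a}" using L(4) by blast
      then have "\<phi> l \<in> Q" using U(2) LX by blast
      ultimately show False using \<open>l \<in> L\<close> by blast
    qed
    obtain z where z: "z \<in> X" "z \<notin> A" using NBD(1,5)[OF A] by blast
    then have "z \<in> X - {a}" "z \<noteq> b" using a b by blast+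
    then have "\<phi> z \<noteq> \<phi> b" using inj_onD[OF \<phi>(2) _ _ bX] by blast
    then consider "\<phi> z < \<phi> b" | "\<phi> b < \<phi> z" by linarith
    then show False
    proof cases
      case 1
      have "I \<inter> {\<phi> b <..} = {}" if I: "connected I" "\<phi> b \<notin> I" "\<phi> z \<in> I" for I
      proof -
        have "i \<le> \<phi> b" if "i \<in> I" for i
          using connectedD_interval[OF I(1,3) that, of "\<phi> b"] 1 I(2) by linarith
        then show ?thesis by force
      qed
      then show False using sep[OF z open_greaterThan[of "\<phi> b"] greaterThan_non_empty] by blast
    next
      case 2
      have "I \<inter> {..< \<phi> b} = {}" if I: "connected I" "\<phi> b \<notin> I" "\<phi> z \<in> I" for I
      proof -
        have "\<phi> b \<le> i" if "i \<in> I" for i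
          using connectedD_interval[OF I(1) that I(3), of "\<phi> b"] 2 I(2) by linarith
        then show ?thesis by force
      qed
      then show False using sep[OF z open_lessThan[of "\<phi> b"] lessThan_non_empty] by blast
    qed
  qed
  then show "A \<in> (\<lambda>x. {x}) ` X" using aX by blast
qed

text \<open>The map from a point to its singleton preserves distances, so compactness and
  connectedness of \<open>X\<close> carry over to its image.\<close>

lemma continuum_singletons:
  assumes "X \<noteq> {}"
  shows "continuum (subtopology (hyperspace_topology X) ((\<lambda>x. {x}) ` X))"
proof -
  interpret M: Metric_space "hyperspace X" hausdorff_dist by (rule Metric_space_hausdorff_dist[OF cpt])
  have T: "hyperspace_topology X = M.mtopology" by (simp add: hyperspace_topology_def)
  have sing: "{x} \<in> hyperspace X" if "x \<in> X" for x
    using that unfolding hyperspace_compact[OF cpt] by simp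
  have d: "hausdorff_dist {x} {y} = dist x y" for x y :: 'a
    by (simp add: hausdorff_dist_def dist_commute)
  have f: "continuous_map (top_of_set X) M.mtopology (\<lambda>x. {x})"
    unfolding M.continuous_map_to_metric
  proof (intro ballI allI impI)
    fix x and e :: real assume "x \<in> topspace (top_of_set X)" "0 < e"
    then show "\<exists>U. openin (top_of_set X) U \<and> x \<in> U \<and> (\<forall>y\<in>U. {y} \<in> M.mball {x} e)"
      by (intro exI[of _ "X \<inter> ball x e"]) (auto simp: d sing)
  qed
  have "compactin M.mtopology ((\<lambda>x. {x}) ` X)"
    by (rule image_compactin[OF _ f]) (use cpt in \<open>simp add: compactin_subtopology\<close>)
  moreover have "connectedin M.mtopology ((\<lambda>x. {x}) ` X)"
    by (rule connectedin_continuous_map_image[OF f]) (use conn in \<open>simp add: connectedin_subtopology\<close>)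
  ultimately show ?thesis
    unfolding continuum_def T using assms sing
    by (auto simp: compactin_subspace connectedin_def intro: metrizable_space_subtopology M.metrizable_space_mtopology)
qed

end

theorem theorem5p3:
  fixes X :: "'a::metric_space set"
  assumes "continuum (top_of_set X)"
    and "hereditarily_decomposable X"
    and "property_of_Kelley X"
  shows "continuum (subtopology (hyperspace_topology X) (nonblockers X))
           \<longleftrightarrow> simple_closed_curve X"
proof -
  have X: "X \<noteq> {}" "compact X" "connected X" using assms(1) unfolding continuum_top_of_set by blast+
  then interpret kelley_continuum X using property_of_Kelley_continuum assms(3) by blast
  show ?thesis
  proof
    assume "continuum (subtopology (hyperspace_topology X) (nonblockers X))"
    then interpret hereditary_kelley X
      by (rule continuum_nonblockers_hereditary_kelley[OF kelley_continuum_axioms assms(2)])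
    show "simple_closed_curve X"
      unfolding simple_closed_curve_def using assms(1) homeomorphic_circle_X by blast
  next
    assume "simple_closed_curve X"
    then show "continuum (subtopology (hyperspace_topology X) (nonblockers X))"
      using circle_nonblockers continuum_singletons[OF X(1)] unfolding simple_closed_curve_def by simp
  qed
qed

end
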